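(* For every $n\ge 2$ there is a constant $\kappa=\kappa(n)>0$ depending only on $n$ such that, with $\mu(\varepsilon)$ defined using this $\kappa$ as in the context, the following holds. Let $l\ge 3$, let $1\le d\le n-1$, let $\omega=(0,\tilde\omega)\in\mathbb{R}^d\times\mathbb{R}^{n-d}$ with $\tilde\omega$ non-resonant and $|\tilde\omega|=1$, and let $H:\mathbb{T}^n\times\mathbb{R}^n\to\mathbb{R}$ be a $C^l$ function of the form $$H(\theta,I)=\omega\cdot I+A(\theta)I\cdot I+R(\theta,I),\qquad R(\theta,I)=O_3(I),$$ with $A:\mathbb{T}^n\to\mathrm{Sym}(n,\mathbb{R})$ of class $C^l$. Assume that the averaged map $\bar A:\mathbb{T}^d\to\mathrm{Sym}(n,\mathbb{R})$ is non-constant, so that there exist $\theta^*\in\mathbb{T}^d$ and $i\in\{1,\dots,d\}$ with $A_i^*:=\partial_{\theta_i}\bar A(\theta^* )\neq 0$; fix such $\theta^*$ and $i$. Let $C_i^*:=\{v\in\mathbb{R}^n : A_i^*v\cdot v=0\}$ and fix $\tilde I^0\in\mathbb{R}^n\setminus C_i^*$ with $|\tilde I^0|=1$. Let $C_1,C_2>0$. Then there exist positive constants $\mu_0=\mu_0(n,C_1,C_2,A_i^*,\tilde I^0)$, $c=c(n,C_1,A_i^*,\tilde I^0)$, $\delta=\delta(n,C_1,A_i^*,\tilde I^0)$ and $C=C(n,C_1,C_2,A_i^*,\tilde I^0)$, depending only on the indicated quantities, such that for every $\varepsilon>0$ with $\kappa\varepsilon^{-1}\ge\Psi(1)$ for which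 $$|A|_{C^l(\mathbb{T}^n)}\le C_1,\qquad |\tilde R|_{C^l(\mathbb{T}^n\times B_3)}\le C_2,\qquad \tilde R(\theta,\tilde I):=\varepsilon^{-3}R(\theta,\varepsilon\tilde I),$$ and $$0<\mu(\varepsilon)\le\mu_0,$$ there exists a solution $(\theta(t),I(t))$ of the Hamiltonian system associated to $H$ such that, with $\tau:=\delta\varepsilon^{-1}$, $$I(0)=\varepsilon\tilde I^0,\qquad |I(\tau)-I(0)|\ge|I_i(\tau)-I_i(0)|\ge c\,\varepsilon,$$ and moreover $$\max_{d+1\le j\le n}|I_j(\tau)-I_j(0)|\le C\varepsilon\mu(\varepsilon).$$
   Context: $\mathbb{T}^n=\mathbb{R}^n/\mathbb{Z}^n$; $\cdot$ is the Euclidean inner product; $|\,.\,|$ is the supremum norm on $\mathbb{R}^m$; $\mathrm{Sym}(n,\mathbb{R})$ is the space of real symmetric $n\times n$ matrices; $B_r:=\{I\in\mathbb{R}^n : |I|<r\}$; $|\,.\,|_{C^l(\cdot)}$ is the usual $C^l$-norm on the indicated domain. $R(\theta,I)=O_3(I)$ means that $R$ is of order at least $3$ in $I$ at $I=0$. The Hamiltonian system associated to $H$ is $\dot\theta=\partial_I H$, $\dot I=-\partial_\theta H$. A vector $\tilde\omega\in\mathbb{R}^{n-d}$ is non-resonant if $k\cdot\tilde\omega\ne0$ for all $k\in\mathbb{Z}^{n-d}\setminus\{0\}$. Averaged map: $\bar A(\theta_1,\dots,\theta_d):=\int_{\mathbb{T}^{n-d}}A(\theta_1,\dots,\theta_d,\theta_{d+1},\dots,\theta_n)\,d\theta_{d+1}\cdots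 d\theta_n$. Definition of $\mu(\varepsilon)$: for $Q\ge1$ let $$\Psi(Q):=\max\{|k\cdot\tilde\omega|^{-1} : k\in\mathbb{Z}^{n-d},\ 0<|k_1|+\cdots+|k_{n-d}|\le Q\},$$ for $x\ge\Psi(1)$ let $\Delta(x):=\sup\{Q\ge1 : Q\Psi(Q)\le x\}$, and for $\varepsilon>0$ with $\kappa\varepsilon^{-1}\ge\Psi(1)$ let $\mu(\varepsilon):=\big(\Delta(\kappa\varepsilon^{-1})\big)^{-1}$. *)

theory Defs
  imports "HOL-Analysis.Analysis" "HOL-Library.Landau_Symbols"
begin

text \<open>
  Coordinates of \<open>real ^ 'n\<close> are numbered \<open>1, \<dots>, CARD('n)\<close> along the order of the index type
  \<open>'n::{finite,linorder}\<close>; \<open>slow d\<close> are the first \<open>d\<close> coordinates and \<open>fast d\<close> the others.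
  The supremum norm on a Euclidean space is the library's \<^const>\<open>infnorm\<close>; on matrices it is the
  maximum of the absolute values of the entries.
\<close>

definition slow :: "nat \<Rightarrow> 'n::{finite,linorder} set" where
  "slow d = {j. card {i. i \<le> j} \<le> d}"

definition fast :: "nat \<Rightarrow> 'n::{finite,linorder} set" where
  "fast d = {j. card {i. i \<le> j} > d}"

text \<open>A function on the torus is a function on \<open>real ^ 'n\<close> that is invariant under integer
  translations.\<close>

definition torus_periodic :: "(real ^ 'n \<Rightarrow> 'b) \<Rightarrow> bool" where
  "torus_periodic f \<longleftrightarrow> (\<forall>\<theta> (k :: 'n \<Rightarrow> int). f (\<theta> + (\<chi> j. of_int (k j))) = f \<theta>)"

primrec class_C :: "nat \<Rightarrow> ('a::euclidean_space \<Rightarrow> 'b::euclidean_space) \<Rightarrow> bool" where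
  "class_C 0 f \<longleftrightarrow> continuous_on UNIV f"
| "class_C (Suc l) f \<longleftrightarrow>
     (\<forall>x. f differentiable (at x)) \<and> (\<forall>b\<in>Basis. class_C l (\<lambda>x. frechet_derivative f (at x) b))"

primrec iterated_partial ::
  "'a list \<Rightarrow> ('a::euclidean_space \<Rightarrow> 'b::euclidean_space) \<Rightarrow> 'a \<Rightarrow> 'b" where
  "iterated_partial [] f = f"
| "iterated_partial (b # bs) f = iterated_partial bs (\<lambda>x. frechet_derivative f (at x) b)"

text \<open>The \<open>C\<^sup>l\<close>-norm is the supremum over the open domain \<open>S\<close> of all partial derivatives of order
  at most \<open>l\<close>; it takes values in \<open>ereal\<close> so that it is \<open>\<infinity>\<close> when a derivative is unbounded.\<close>

definition C_norm ::
  "nat \<Rightarrow> 'a set \<Rightarrow> ('a::euclidean_space \<Rightarrow> 'b::euclidean_space) \<Rightarrow> ereal" where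
  "C_norm l S f =
     (SUP bs\<in>{bs. set bs \<subseteq> Basis \<and> length bs \<le> l}. SUP x\<in>S. ereal (infnorm (iterated_partial bs f x)))"

text \<open>The average over the fast angles. It is written as a function on all of \<open>real ^ 'n\<close>, but it
  depends only on the slow coordinates of its argument.\<close>

definition torus_average ::
  "nat \<Rightarrow> ((real, 'n::{finite,linorder}) vec \<Rightarrow> 'b::euclidean_space) \<Rightarrow> (real, 'n) vec \<Rightarrow> 'b" where
  "torus_average d A \<theta> =
     (LINT \<phi> : (\<Pi>\<^sub>E j\<in>fast d. {0..1}) | Pi\<^sub>M (fast d) (\<lambda>_. lborel).
        A (\<chi> j. if j \<in> fast d then \<phi> j else \<theta> $ j))"

text \<open>Only the entries \<open>k j\<close> with \<open>j\<close> a fast coordinate matter below: they form the integer vector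
  in dimension \<open>n - d\<close>.\<close>

definition nonresonant :: "nat \<Rightarrow> (real, 'n::{finite,linorder}) vec \<Rightarrow> bool" where
  "nonresonant d \<omega> \<longleftrightarrow>
     (\<forall>k :: 'n \<Rightarrow> int. (\<exists>j\<in>fast d. k j \<noteq> 0) \<longrightarrow> (\<Sum>j\<in>fast d. of_int (k j) * \<omega> $ j) \<noteq> 0)"

definition Psi :: "nat \<Rightarrow> (real, 'n::{finite,linorder}) vec \<Rightarrow> real \<Rightarrow> real" where
  "Psi d \<omega> Q =
     Max {inverse \<bar>\<Sum>j\<in>fast d. of_int (k j) * \<omega> $ j\<bar> | k :: 'n \<Rightarrow> int.
            0 < (\<Sum>j\<in>fast d. \<bar>k j\<bar>) \<and> of_int (\<Sum>j\<in>fast d. \<bar>k j\<bar>) \<le> Q}"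

definition Delta :: "nat \<Rightarrow> (real, 'n::{finite,linorder}) vec \<Rightarrow> real \<Rightarrow> real" where
  "Delta d \<omega> x = Sup {Q. Q \<ge> 1 \<and> Q * Psi d \<omega> Q \<le> x}"

definition mu :: "real \<Rightarrow> nat \<Rightarrow> (real, 'n::{finite,linorder}) vec \<Rightarrow> real \<Rightarrow> real" where
  "mu \<kappa> d \<omega> \<epsilon> = inverse (Delta d \<omega> (\<kappa> / \<epsilon>))"

text \<open>A solution on the time set \<open>T\<close> of \<open>\<theta>' = \<partial>\<^sub>I H\<close>, \<open>I' = - \<partial>\<^sub>\<theta> H\<close>, the angles being lifted to
  \<open>real ^ 'n\<close>.\<close>

definition hamiltonian_solution ::
  "((real ^ 'n) \<times> (real ^ 'n) \<Rightarrow> real) \<Rightarrow> real set \<Rightarrow> (real \<Rightarrow> real ^ 'n) \<Rightarrow> (real \<Rightarrow> real ^ 'n) \<Rightarrow> bool"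
  where
  "hamiltonian_solution H T \<theta> I \<longleftrightarrow>
     (\<forall>t\<in>T. \<exists>u w.
        GDERIV (\<lambda>p. H (\<theta> t, p)) (I t) :> u \<and>
        GDERIV (\<lambda>q. H (q, I t)) (\<theta> t) :> w \<and>
        (\<theta> has_vector_derivative u) (at t within T) \<and>
        (I has_vector_derivative - w) (at t within T))"

end

theory Submission
  imports Defs "HOL-Complex_Analysis.Cauchy_Integral_Formula" "HOL-Probability.Probability"
    "HOL-Real_Asymp.Real_Asymp"
begin

text \<open>
  On the scale \<open>I = \<epsilon> J\<close> the angles move with velocity \<open>\<omega> + O(\<epsilon>)\<close> and \<open>J\<close> moves with velocity \<open>O(\<epsilon>)\<close>.
  During the time \<open>\<tau> = \<delta>/\<epsilon>\<close> the rescaled actions and the slow angles therefore stay \<open>O(\<delta>)\<close>-close to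
  their initial values, while the fast angles wind around their torus. If the force
  \<open>- \<partial>\<^sub>j A(\<theta>)I\<cdot>I + O(\<epsilon>\<^sup>3)\<close> acting on \<open>I\<^sub>j\<close> may be replaced by its average over the fast angles, then for
  a fast index \<open>j\<close> nothing remains, because \<open>\<partial>\<^sub>j A\<close> has average \<open>0\<close>, and for the slow index \<open>i\<close> the
  force is \<open>- \<epsilon>\<^sup>2 (A\<^sub>i\<^sup>* J\<^sup>0\<cdot>J\<^sup>0 + O(\<delta>))\<close>, where \<open>J\<^sup>0\<close> is the given initial value of \<open>J\<close>. It integrates
  to a drift of size \<open>\<epsilon>\<delta>\<close> once \<open>\<delta>\<close> is small. So the theorem amounts to the claim that averaging
  costs only \<open>O(\<epsilon> \<mu>(\<epsilon>))\<close> over the time \<open>\<tau>\<close>.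

  This claim is proved without a normal form. The tool is a probability measure \<open>\<rho>\<close> on pairs
  \<open>(x, u)\<close> of a translation \<open>x\<close> and a time \<open>u\<close> such that the average of every continuous function \<open>f\<close>
  on the torus is exactly \<open>f\<^sub>a\<^sub>v(\<theta>) = E f(\<theta> + x + u\<omega>)\<close>, with \<open>E\<bar>x\<bar> = O(1/Q)\<close> and \<open>E\<bar>u\<bar> = O(\<Psi>(Q))\<close>
  (\<open>averaging_measure_exists\<close>). It is built from one probability density on the line with compactly
  supported Fourier transform: a nonzero Fourier mode \<open>k\<close> in the fast angles with \<open>\<bar>k\<bar>\<^sub>1 \<le> Q\<close> is killed by
  the average over \<open>u\<close>, because \<open>\<bar>k\<cdot>\<omega>\<bar> \<ge> 1/\<Psi>(Q)\<close>, and one with \<open>\<bar>k\<bar>\<^sub>1 > Q\<close> by the average over \<open>x\<close>. All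
  errors are first moments of \<open>\<rho>\<close>, so no series over small divisors has to be summed, and the number
  of derivatives that enter does not grow with the dimension.

  Translating by \<open>u\<omega>\<close> is the same, up to \<open>O(\<epsilon>\<bar>u\<bar>)\<close>, as following the trajectory for the time \<open>u\<close>, and
  a shift of the time variable changes an integral only near its ends. Hence replacing the force by its
  average along the trajectory costs \<open>O(\<epsilon>(1/Q + \<epsilon>\<Psi>(Q)))\<close> (\<open>averaging_along_trajectory\<close>). The
  definition of \<open>\<Delta>\<close> provides a \<open>Q\<close> with \<open>Q\<Psi>(Q) \<le> 1/\<epsilon>\<close> and \<open>1/Q \<le> 2\<mu>(\<epsilon>)\<close>
  (\<open>almost_optimal_order\<close>), and both terms become \<open>O(\<epsilon> \<mu>(\<epsilon>))\<close>. The two drift estimates are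
  \<open>fast_drift_bound\<close> and \<open>slow_drift_bound\<close>. The value \<open>\<kappa> = 1\<close> works, since all constants can be
  absorbed in \<open>\<mu>\<^sub>0\<close> and \<open>C\<close>.
\<close>

section \<open>A band-limited probability distribution on the line\<close>

definition sinc_ext :: "complex \<Rightarrow> complex" where
  "sinc_ext z = (if z = 0 then 1 else sin z / z)"

lemma holomorphic_sinc_ext: "sinc_ext holomorphic_on UNIV"
proof -
  have "(\<lambda>z::complex. if z = 0 then deriv sin 0 else (sin z - sin 0) / (z - 0)) holomorphic_on UNIV"
    by (intro pole_lemma_open holomorphic_intros) auto
  moreover have "deriv sin (0::complex) = 1"
    by (rule DERIV_imp_deriv) (auto intro!: derivative_eq_intros)
  ultimately show ?thesis by (simp add: sinc_ext_def[abs_def] cong: if_cong)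
qed

lemma norm_sin_upper_half_plane:
  fixes z :: complex
  assumes "Im z \<ge> 0"
  shows "norm (sin z) \<le> exp (Im z)"
proof -
  have "sin z = (exp (\<i> * z) - exp (- (\<i> * z))) / (2 * \<i>)"
    by (simp add: sin_exp_eq)
  then have "norm (sin z) \<le> (norm (exp (\<i> * z)) + norm (exp (- (\<i> * z)))) / 2"
    by (simp only: norm_divide norm_mult norm_ii) (auto intro!: divide_right_mono norm_triangle_ineq4 simp del: norm_exp_eq_Re)
  also have "\<dots> = (exp (- Im z) + exp (Im z)) / 2" by simp
  also have "\<dots> \<le> exp (Im z)" using assms by simp
  finally show ?thesis .
qed

text \<open>
  The integrand extends to an entire function. By Cauchy's theorem its integral over \<open>[-R, R]\<close> is minus
  the integral over the upper half circle of radius \<open>R\<close>. There \<open>\<bar>exp(iaz)\<bar> = exp(-a Im z)\<close>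
  compensates the growth \<open>exp(4 Im z)\<close> of \<open>sin\<^sup>4 z\<close> as soon as \<open>a \<ge> 4\<close>, and \<open>z\<^sup>-\<^sup>4\<close> gives the decay.
\<close>

lemma integral_jackson_symmetric_interval_bound:
  assumes lam: "a \<ge> 4" and R: "R > (0::real)"
  shows "norm (integral {-R..R} (\<lambda>t. exp (\<i> * of_real a * of_real t) * sinc_ext (of_real t) ^ 4)) \<le> pi / R ^ 3"
proof -
  let ?F = "\<lambda>z. exp (\<i> * of_real a * z) * sinc_ext z ^ 4"
  let ?l = "linepath (of_real (-R)) (of_real R) :: real \<Rightarrow> complex" and ?c = "part_circlepath 0 R 0 pi"
  have hol: "?F holomorphic_on UNIV"
    by (intro holomorphic_intros holomorphic_sinc_ext)
  have ends: "pathstart ?c = of_real R" "pathfinish ?c = of_real (- R)"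
    by (simp_all add: pathstart_part_circlepath pathfinish_part_circlepath exp_Euler)
  have *: "(?F has_contour_integral 0) (?l +++ ?c)"
    by (rule Cauchy_theorem_convex_simple[OF hol]) (auto simp: ends)
  have intl: "?F contour_integrable_on ?l"
    by (intro contour_integrable_continuous_linepath holomorphic_on_imp_continuous_on
      holomorphic_on_subset[OF hol]) auto
  have intc: "?F contour_integrable_on ?c"
    by (intro contour_integrable_continuous_part_circlepath holomorphic_on_imp_continuous_on
      holomorphic_on_subset[OF hol]) auto
  have "contour_integral (?l +++ ?c) ?F = contour_integral ?l ?F + contour_integral ?c ?F"
    by (rule contour_integral_join[OF intl intc]) auto
  then have "contour_integral ?l ?F = - contour_integral ?c ?F"
    by (simp only: contour_integral_unique[OF *] eq_neg_iff_add_eq_0)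
  then have eq: "norm (contour_integral ?l ?F) = norm (contour_integral ?c ?F)"
    by (simp only: norm_minus_cancel)
  have "norm (contour_integral ?c ?F) \<le> (1 / R ^ 4) * R * \<bar>pi - 0\<bar>"
  proof (rule contour_integral_bound_part_circlepath[OF intc])
    fix z assume "z \<in> path_image ?c"
    then obtain t where t: "t \<in> {0..pi}" "z = R * cis t"
      using R by (fastforce simp: path_image_part_circlepath cis_conv_exp)
    have y: "Im z \<ge> 0" and nz: "norm z = R" "z \<noteq> 0"
      using t R by (auto simp: norm_mult sin_ge_zero)
    have "norm (?F z) = exp (- a * Im z) * (norm (sin z) / R) ^ 4"
      using nz by (simp add: sinc_ext_def norm_mult norm_power norm_divide)
    also have "\<dots> \<le> exp (- 4 * Im z) * (exp (Im z) / R) ^ 4"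
      using y lam R norm_sin_upper_half_plane[OF y]
      by (intro mult_mono power_mono divide_right_mono) (auto intro: mult_right_mono)
    also have "\<dots> = 1 / R ^ 4"
    proof -
      have "exp (- 4 * Im z) * exp (Im z) ^ 4 = 1"
        by (simp add: exp_of_nat_mult[of 4, symmetric] flip: exp_add)
      then show ?thesis by (simp add: power_divide)
    qed
    finally show "norm (?F z) \<le> 1 / R ^ 4" .
  qed (use R in auto)
  then have "norm (contour_integral ?l ?F) \<le> pi / R ^ 3"
    using R eq by (simp add: field_simps eval_nat_numeral)
  moreover have "contour_integral ?l ?F = integral {-R..R} (\<lambda>t. ?F (of_real t))"
    using R by (subst contour_integral_linepath_Reals_eq) auto
  ultimately show ?thesis by simp
qed

text \<open>
  The fourth power is taken because \<open>(sin t / t)\<^sup>2\<close> has no finite first moment; an even power keeps the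
  kernel nonnegative, so that it is a probability density after normalisation.
\<close>

definition jackson :: "real \<Rightarrow> real" where
  "jackson t = (if t = 0 then 1 else sin t / t) ^ 4"

lemma jackson_nonneg: "jackson t \<ge> 0" by (simp add: jackson_def)

lemma of_real_jackson: "of_real (jackson t) = sinc_ext (of_real t) ^ 4"
  by (simp add: jackson_def sinc_ext_def sin_of_real)

lemma jackson_measurable [measurable]: "jackson \<in> borel_measurable borel"
  unfolding jackson_def by measurable

lemma continuous_jackson: "continuous_on UNIV jackson"
proof -
  have "continuous_on UNIV (\<lambda>t::real. sinc_ext (of_real t))"
    by (rule continuous_on_compose2[OF holomorphic_on_imp_continuous_on[OF holomorphic_sinc_ext]])
       (auto intro!: continuous_intros)
  then have "continuous_on UNIV (\<lambda>t. Re (sinc_ext (of_real t) ^ 4))"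
    by (intro continuous_intros)
  then show ?thesis by (simp flip: of_real_jackson)
qed

lemma jackson_bounds:
  shows "jackson t \<le> 2 * inverse (1 + t\<^sup>2)" and "\<bar>t\<bar> * jackson t \<le> 2 * inverse (1 + t\<^sup>2)"
proof -
  have *: "jackson t \<le> 2 * inverse (1 + t\<^sup>2) \<and> \<bar>t\<bar> * jackson t \<le> 2 * inverse (1 + t\<^sup>2)"
  proof (cases "\<bar>t\<bar> \<le> 1")
    case True
    have "(if t = 0 then 1 else sin t / t) ^ 4 = \<bar>if t = 0 then 1 else sin t / t\<bar> ^ 4" by simp
    also have "\<dots> \<le> 1 ^ 4" using abs_sin_x_le_abs_x[of t]
      by (intro power_mono) (auto simp: abs_divide)
    finally have 1: "jackson t \<le> 1" by (simp add: jackson_def)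
    have "t\<^sup>2 \<le> 1" using True by (simp add: abs_square_le_1)
    then have 2: "1 \<le> 2 * inverse (1 + t\<^sup>2)"
      by (simp add: field_simps add_pos_nonneg)
    have "\<bar>t\<bar> * jackson t \<le> 1 * 1" using True 1 jackson_nonneg[of t] by (intro mult_mono) auto
    with 1 2 show ?thesis by simp
  next
    case False
    then have t: "\<bar>t\<bar> > 1" by simp
    have "jackson t = \<bar>sin t\<bar> ^ 4 / \<bar>t\<bar> ^ 4"
      using t by (auto simp: jackson_def power_divide)
    also have "\<dots> \<le> 1 / \<bar>t\<bar> ^ 4"
      using t by (intro divide_right_mono power_le_one) auto
    finally have 1: "jackson t \<le> 1 / \<bar>t\<bar> ^ 4" .
    have "\<bar>t\<bar> * jackson t \<le> \<bar>t\<bar> * (1 / \<bar>t\<bar> ^ 4)" using 1 by (intro mult_left_mono) auto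
    also have "\<dots> = 1 / \<bar>t\<bar> ^ 3" using t by (simp add: eval_nat_numeral)
    also have "\<dots> \<le> 1 / \<bar>t\<bar> ^ 2" using t by (intro divide_left_mono power_increasing) auto
    also have "\<dots> \<le> 2 * inverse (1 + t\<^sup>2)"
    proof -
      have "1 < \<bar>t\<bar> ^ 2" using t by (intro one_less_power) auto
      then have "1 \<le> t\<^sup>2" by simp
      then show ?thesis using t by (simp add: field_simps add_pos_nonneg)
    qed
    finally have 2: "\<bar>t\<bar> * jackson t \<le> 2 * inverse (1 + t\<^sup>2)" .
    have "1 * jackson t \<le> \<bar>t\<bar> * jackson t" using t jackson_nonneg by (intro mult_right_mono) auto
    with 2 show ?thesis by simp
  qed
  then show "jackson t \<le> 2 * inverse (1 + t\<^sup>2)" and "\<bar>t\<bar> * jackson t \<le> 2 * inverse (1 + t\<^sup>2)" by auto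
qed

lemma integrable_inverse_1_plus_square_lborel: "integrable lborel (\<lambda>x::real. 2 * inverse (1 + x\<^sup>2))"
  using integrable_inverse_1_plus_square by (simp add: set_integrable_def)

lemma integrable_jackson: "integrable lborel jackson"
  by (rule Bochner_Integration.integrable_bound[OF integrable_inverse_1_plus_square_lborel])
     (use jackson_bounds(1) jackson_nonneg in auto)

lemma integrable_abs_jackson: "integrable lborel (\<lambda>t. \<bar>t\<bar> * jackson t)"
  by (rule Bochner_Integration.integrable_bound[OF integrable_inverse_1_plus_square_lborel])
     (use jackson_bounds(2) jackson_nonneg in \<open>auto simp: abs_mult\<close>)

lemma integral_jackson_pos: "integral\<^sup>L lborel jackson > 0"
proof -
  have "integral\<^sup>L lborel jackson \<noteq> 0"
  proof
    assume "integral\<^sup>L lborel jackson = 0"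
    then have "AE t in lborel. jackson t = 0"
      using integral_nonneg_eq_0_iff_AE[OF integrable_jackson] jackson_nonneg by auto
    then have "AE t in lebesgue. t \<in> jackson -` {0}" by (simp add: AE_completion)
    moreover have "closed (jackson -` {0})"
      by (intro continuous_closed_vimage) (use continuous_jackson in \<open>auto simp: continuous_on_eq_continuous_at\<close>)
    ultimately have "0 \<in> jackson -` {0}" using mem_closed_if_AE_lebesgue by blast
    then show False by (simp add: jackson_def)
  qed
  then show ?thesis using jackson_nonneg
    by (simp add: order_less_le integral_nonneg)
qed

lemma cis_measurable [measurable]: "cis \<in> borel_measurable borel"
  by (intro borel_measurable_continuous_onI continuous_intros)

lemma fourier_jackson_eq_0_pos:
  assumes "a \<ge> 4"
  shows "integral\<^sup>L lborel (\<lambda>t. jackson t *\<^sub>R cis (a * t)) = 0"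
proof -
  let ?f = "\<lambda>t. jackson t *\<^sub>R cis (a * t)"
  have int: "integrable lborel ?f"
    by (rule Bochner_Integration.integrable_bound[OF integrable_jackson])
       (auto simp: jackson_nonneg)
  have f: "?f t = exp (\<i> * of_real a * of_real t) * sinc_ext (of_real t) ^ 4" for t
    by (simp add: scaleR_conv_of_real of_real_jackson cis_conv_exp mult_ac)
  have "(\<lambda>n. \<integral>t. indicator {- real (Suc n)..real (Suc n)} t *\<^sub>R ?f t \<partial>lborel) \<longlonglongrightarrow> integral\<^sup>L lborel ?f"
  proof (rule integral_dominated_convergence[OF _ _ integrable_jackson])
    show "AE t in lborel. (\<lambda>n. indicator {- real (Suc n)..real (Suc n)} t *\<^sub>R ?f t) \<longlonglongrightarrow> ?f t"
    proof (rule AE_I2, rule tendsto_eventually)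
      fix t :: real
      obtain N where N: "\<bar>t\<bar> \<le> real N" using real_arch_simple by blast
      show "\<forall>\<^sub>F n in sequentially. indicator {- real (Suc n)..real (Suc n)} t *\<^sub>R ?f t = ?f t"
        using eventually_ge_at_top[of N] by eventually_elim (use N in \<open>auto simp: indicator_def\<close>)
    qed
  qed (auto simp: jackson_nonneg indicator_def)
  moreover have "(\<lambda>n. \<integral>t. indicator {- real (Suc n)..real (Suc n)} t *\<^sub>R ?f t \<partial>lborel) \<longlonglongrightarrow> 0"
  proof (rule tendsto_norm_zero_cancel, rule tendsto_sandwich[OF _ _ tendsto_const])
    show "\<forall>\<^sub>F n in sequentially. norm (\<integral>t. indicator {- real (Suc n)..real (Suc n)} t *\<^sub>R ?f t \<partial>lborel)
       \<le> pi / real (Suc n) ^ 3"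
    proof (rule always_eventually, rule allI)
      fix n
      have "set_integrable lborel {- real (Suc n)..real (Suc n)} ?f"
        unfolding set_integrable_def by (rule integrable_mult_indicator[OF _ int]) auto
      from set_borel_integral_eq_integral(2)[OF this]
      show "norm (\<integral>t. indicator {- real (Suc n)..real (Suc n)} t *\<^sub>R ?f t \<partial>lborel) \<le> pi / real (Suc n) ^ 3"
        using integral_jackson_symmetric_interval_bound[OF assms, of "real (Suc n)"]
        unfolding set_lebesgue_integral_def f by (simp del: of_nat_Suc)
    qed
    show "(\<lambda>n. pi / real (Suc n) ^ 3) \<longlonglongrightarrow> 0" by real_asymp
  qed auto
  ultimately show ?thesis using LIMSEQ_unique by blast
qed

lemma fourier_jackson_eq_0:
  assumes "\<bar>a\<bar> \<ge> 4"
  shows "integral\<^sup>L lborel (\<lambda>t. jackson t *\<^sub>R cis (a * t)) = 0"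
proof (cases "a \<ge> 0")
  case True
  with assms show ?thesis by (intro fourier_jackson_eq_0_pos) auto
next
  case False
  then have "integral\<^sup>L lborel (\<lambda>t. jackson t *\<^sub>R cis (- a * t)) = 0"
    using assms by (intro fourier_jackson_eq_0_pos) auto
  moreover have *: "cnj (jackson t *\<^sub>R cis (a * t)) = jackson t *\<^sub>R cis (- a * t)" for t
    by (simp add: cis_cnj)
  have "cnj (integral\<^sup>L lborel (\<lambda>t. jackson t *\<^sub>R cis (a * t)))
      = integral\<^sup>L lborel (\<lambda>t. jackson t *\<^sub>R cis (- a * t))"
    using Bochner_Integration.integral_cnj[of lborel "\<lambda>t. jackson t *\<^sub>R cis (a * t)"] by (simp only: *)
  ultimately show ?thesis by simp
qed

text \<open>
  This distribution takes the place of a cutoff in frequency space: averaging over it annihilates all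
  high frequencies, and its finite first moment makes the average of a Lipschitz function close to
  the function itself.
\<close>

lemma band_limited_distribution_exists:
  obtains P :: "real measure" where "prob_space P" "sets P = sets borel"
    "integrable P (\<lambda>t. \<bar>t\<bar>)" "\<And>a. \<bar>a\<bar> \<ge> 4 \<Longrightarrow> integral\<^sup>L P (\<lambda>t. cis (a * t)) = 0"
proof
  define c where "c = integral\<^sup>L lborel jackson"
  have c: "c > 0" using integral_jackson_pos by (simp add: c_def)
  define p where "p t = jackson t / c" for t
  have p0: "p t \<ge> 0" for t using c jackson_nonneg by (simp add: p_def)
  have [measurable]: "p \<in> borel_measurable borel" unfolding p_def by measurable
  let ?P = "density lborel (\<lambda>t. ennreal (p t))"
  have pint: "integrable lborel p" unfolding p_def using integrable_jackson by simp
  have "integral\<^sup>L lborel p = 1" unfolding p_def using c by (simp add: c_def)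
  then have "(\<integral>\<^sup>+ t. ennreal (p t) \<partial>lborel) = 1"
    by (subst nn_integral_eq_integral[OF pint]) (auto simp: p0)
  then show "prob_space ?P" by (intro prob_spaceI) (simp add: emeasure_density)
  show "sets ?P = sets borel" by simp
  show "integrable ?P (\<lambda>t. \<bar>t\<bar>)"
    using integrable_abs_jackson by (subst integrable_density) (auto simp: p0 c p_def mult_ac intro!: divide_nonneg_pos jackson_nonneg)
  show "integral\<^sup>L ?P (\<lambda>t. cis (a * t)) = 0" if "\<bar>a\<bar> \<ge> 4" for a
  proof -
    have "integral\<^sup>L ?P (\<lambda>t. cis (a * t)) = (\<integral>t. p t *\<^sub>R cis (a * t) \<partial>lborel)"
      by (subst integral_density) (auto simp: p0)
    also have "\<dots> = (\<integral>t. inverse c *\<^sub>R (jackson t *\<^sub>R cis (a * t)) \<partial>lborel)"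
      by (simp add: p_def field_simps)
    also have "\<dots> = 0" using fourier_jackson_eq_0[OF that]
      by (simp only: integral_scaleR_right scaleR_zero_right)
    finally show ?thesis .
  qed
qed

section \<open>Trigonometric polynomials on the torus\<close>

definition character :: "('n::finite \<Rightarrow> int) \<Rightarrow> real ^ 'n \<Rightarrow> complex" where
  "character k \<theta> = cis (2 * pi * (\<Sum>j\<in>UNIV. of_int (k j) * \<theta> $ j))"

lemma character_mult: "character k \<theta> * character m \<theta> = character (\<lambda>j. k j + m j) \<theta>"
  by (simp add: character_def cis_mult distrib_left distrib_right sum.distrib)

lemma character_add: "character k (\<theta> + \<phi>) = character k \<theta> * character k \<phi>"
  by (simp add: character_def cis_mult distrib_left sum.distrib)

lemma norm_character [simp]: "norm (character k \<theta>) = 1"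
  by (simp add: character_def)

lemma continuous_character: "continuous_on UNIV (character k)"
  unfolding character_def[abs_def] by (intro continuous_intros)

inductive trig_poly :: "(real ^ 'n::finite \<Rightarrow> complex) \<Rightarrow> bool" where
  character: "trig_poly (\<lambda>\<theta>. c * character k \<theta>)"
| add: "trig_poly u \<Longrightarrow> trig_poly v \<Longrightarrow> trig_poly (\<lambda>\<theta>. u \<theta> + v \<theta>)"

lemma trig_poly_const: "trig_poly (\<lambda>\<theta>. c)"
  using trig_poly.character[of c "\<lambda>_. 0"] by (simp add: character_def)

lemma trig_poly_sum: "(\<And>i. i \<in> S \<Longrightarrow> trig_poly (u i)) \<Longrightarrow> trig_poly (\<lambda>\<theta>. \<Sum>i\<in>S. u i \<theta>)"
  by (induction S rule: infinite_finite_induct) (auto intro: trig_poly_const trig_poly.add)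

lemma trig_poly_mult:
  assumes "trig_poly u" "trig_poly v"
  shows "trig_poly (\<lambda>\<theta>. u \<theta> * v \<theta>)"
  using assms
proof (induction u rule: trig_poly.induct)
  case (character c k)
  from character show ?case
  proof (induction v rule: trig_poly.induct)
    case (character c' k')
    have "(c * character k \<theta>) * (c' * character k' \<theta>) = (c * c') * character (\<lambda>j. k j + k' j) \<theta>" for \<theta>
      by (simp flip: character_mult)
    then show ?case by (simp only: trig_poly.character)
  qed (simp add: distrib_left trig_poly.add)
qed (simp add: distrib_right trig_poly.add)

lemma trig_poly_continuous: "trig_poly u \<Longrightarrow> continuous_on UNIV u"
  by (induction rule: trig_poly.induct) (auto intro!: continuous_intros continuous_character)

lemma trig_poly_bounded: "trig_poly u \<Longrightarrow> \<exists>B. \<forall>\<theta>. norm (u \<theta>) \<le> B"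
proof (induction rule: trig_poly.induct)
  case (character c k)
  then show ?case by (auto simp: norm_mult)
next
  case (add u v)
  then obtain B C where "\<forall>\<theta>. norm (u \<theta>) \<le> B" "\<forall>\<theta>. norm (v \<theta>) \<le> C" by auto
  then have "norm (u \<theta> + v \<theta>) \<le> B + C" for \<theta>
    by (intro order_trans[OF norm_triangle_ineq] add_mono) (simp_all add: \<open>\<forall>\<theta>. norm (u \<theta>) \<le> B\<close> \<open>\<forall>\<theta>. norm (v \<theta>) \<le> C\<close>)
  then show ?case by blast
qed

text \<open>
  The embedding of the torus as a product of unit circles: periodic functions become functions on a
  compact set, to which the theorem of Stone and Weierstrass applies.
\<close>

definition circle_coords :: "real ^ 'n \<Rightarrow> complex ^ 'n" where
  "circle_coords \<theta> = (\<chi> j. cis (2 * pi * \<theta> $ j))"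

lemma trig_poly_circle_coord:
  fixes j :: "'n::finite"
  shows "trig_poly (\<lambda>\<theta>. of_real (Re (circle_coords \<theta> $ j)))" (is ?A)
    and "trig_poly (\<lambda>\<theta>. of_real (Im (circle_coords \<theta> $ j)))" (is ?B)
proof -
  let ?k = "\<lambda>i. if i = j then 1 else 0 :: int" and ?m = "\<lambda>i. if i = j then - 1 else 0 :: int"
  have *: "(\<Sum>i\<in>UNIV. of_int (if i = j then c else 0) * \<theta> $ i) = of_int c * \<theta> $ j" for c and \<theta> :: "real ^ 'n"
  proof -
    have "(\<Sum>i\<in>UNIV. of_int (if i = j then c else 0) * \<theta> $ i) = (\<Sum>i\<in>UNIV. if i = j then of_int c * \<theta> $ i else 0)"
      by (intro sum.cong) auto
    then show ?thesis by simp
  qed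
  have k: "character ?k \<theta> = cis (2 * pi * \<theta> $ j)" and m: "character ?m \<theta> = cis (- (2 * pi * \<theta> $ j))" for \<theta>
    using * by (simp_all add: character_def)
  have "of_real (Re (circle_coords \<theta> $ j)) = (1/2) * character ?k \<theta> + (1/2) * character ?m \<theta>" for \<theta>
    unfolding k m by (rule complex_eqI) (simp_all add: circle_coords_def)
  then show ?A by (simp only: trig_poly.intros)
  have "of_real (Im (circle_coords \<theta> $ j)) = (-\<i>/2) * character ?k \<theta> + (\<i>/2) * character ?m \<theta>" for \<theta>
    unfolding k m by (rule complex_eqI) (simp_all add: circle_coords_def)
  then show ?B by (simp only: trig_poly.intros)
qed

lemma trig_poly_of_real_polynomial:
  assumes "real_polynomial_function g"
  shows "trig_poly (\<lambda>\<theta>. of_real (g (circle_coords \<theta> :: complex ^ 'n::finite)))"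
  using assms
proof (induction g rule: real_polynomial_function.induct)
  case (linear g)
  interpret g: bounded_linear g by fact
  have g_eq: "g w = (\<Sum>j\<in>UNIV. Re (w $ j) * g (axis j 1) + Im (w $ j) * g (axis j \<i>))" for w :: "complex ^ 'n"
  proof -
    have "w = (\<Sum>j\<in>UNIV. Re (w $ j) *\<^sub>R axis j 1 + Im (w $ j) *\<^sub>R axis j \<i>)"
    proof (rule vec_eq_iff[THEN iffD2], rule allI)
      fix i
      have "(\<Sum>j\<in>UNIV. Re (w $ j) *\<^sub>R axis j 1 + Im (w $ j) *\<^sub>R axis j \<i> :: complex ^ 'n) $ i
          = (\<Sum>j\<in>UNIV. if i = j then complex_of_real (Re (w $ j)) + complex_of_real (Im (w $ j)) * \<i> else 0)"
        unfolding sum_component by (intro sum.cong) (auto simp: axis_def complex_eq_iff)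
      then show "w $ i = (\<Sum>j\<in>UNIV. Re (w $ j) *\<^sub>R axis j 1 + Im (w $ j) *\<^sub>R axis j \<i>) $ i"
        by (simp add: complex_eq_iff)
    qed
    then have "g w = g (\<Sum>j\<in>UNIV. Re (w $ j) *\<^sub>R axis j 1 + Im (w $ j) *\<^sub>R axis j \<i>)" by (rule arg_cong)
    then show ?thesis by (simp only: g.sum g.add g.scaleR real_scaleR_def)
  qed
  have "(\<lambda>\<theta>. complex_of_real (g (circle_coords \<theta>))) = (\<lambda>\<theta>. \<Sum>j\<in>UNIV.
      of_real (Re (circle_coords \<theta> $ j)) * of_real (g (axis j 1)) +
      of_real (Im (circle_coords \<theta> $ j)) * of_real (g (axis j \<i>)))"
    by (intro ext) (simp only: g_eq[of "circle_coords _"] of_real_sum of_real_add of_real_mult)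
  then show ?case
    by (simp only:) (intro trig_poly_sum trig_poly.add trig_poly_mult trig_poly_circle_coord trig_poly_const)
qed (auto intro: trig_poly_const trig_poly.add trig_poly_mult)

lemma torus_periodic_cong_circle_coords:
  assumes "torus_periodic f" "circle_coords \<theta> = circle_coords \<phi>"
  shows "f \<theta> = f \<phi>"
proof -
  have "\<exists>m::int. \<theta> $ j = \<phi> $ j + m" for j
  proof -
    have "cis (2 * pi * \<theta> $ j) = cis (2 * pi * \<phi> $ j)"
      using assms(2) by (simp add: circle_coords_def vec_eq_iff)
    then have "sin (2 * pi * \<theta> $ j) = sin (2 * pi * \<phi> $ j) \<and> cos (2 * pi * \<theta> $ j) = cos (2 * pi * \<phi> $ j)"
      by (simp add: complex_eq_iff)
    then obtain m :: int where "2 * pi * \<theta> $ j = 2 * pi * \<phi> $ j + 2 * of_int m * pi"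
      by (auto simp: sin_cos_eq_iff)
    then have "2 * pi * (\<theta> $ j) = 2 * pi * (\<phi> $ j + m)" by (simp add: algebra_simps)
    then show ?thesis by (intro exI[of _ m]) simp
  qed
  then obtain m :: "'a \<Rightarrow> int" where "\<And>j. \<theta> $ j = \<phi> $ j + m j" by metis
  then have "\<theta> = \<phi> + (\<chi> j. of_int (m j))" by (simp add: vec_eq_iff)
  then show ?thesis using assms(1) by (simp add: torus_periodic_def)
qed

text \<open>
  A periodic function descends to the image of the unit cube in the product of circles. The descended
  function is continuous because the cube is compact, so that preimages of closed sets are images of
  compact sets. A polynomial in the circle coordinates is a trigonometric polynomial.
\<close>

lemma trig_poly_dense:
  fixes f :: "real ^ 'n::finite \<Rightarrow> real"
  assumes cont: "continuous_on UNIV f" and per: "torus_periodic f" and e: "e > 0"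
  obtains u where "trig_poly u" "\<And>\<theta>. norm (of_real (f \<theta>) - u \<theta>) < e"
proof -
  let ?C = "cbox 0 1 :: (real ^ 'n) set"
  define K where "K = circle_coords ` ?C"
  define F where "F w = f (SOME \<theta>. circle_coords \<theta> = w)" for w
  have F: "F (circle_coords \<theta>) = f \<theta>" for \<theta>
    unfolding F_def by (rule torus_periodic_cong_circle_coords[OF per]) (rule someI, rule refl)
  have cc: "continuous_on UNIV (circle_coords :: real ^ 'n \<Rightarrow> _)"
    unfolding circle_coords_def by (intro continuous_intros)
  have K: "compact K" unfolding K_def
    by (intro compact_continuous_image continuous_on_subset[OF cc]) auto
  have surj: "circle_coords \<theta> \<in> K" for \<theta>
  proof -
    have "circle_coords (\<chi> j. frac (\<theta> $ j)) = circle_coords \<theta>"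
    proof -
      have "cis (2 * pi * frac x) = cis (2 * pi * x)" for x
      proof -
        have "2 * pi * x = 2 * pi * frac x + 2 * pi * of_int \<lfloor>x\<rfloor>"
          by (simp add: frac_def algebra_simps)
        then have "cis (2 * pi * x) = cis (2 * pi * frac x) * cis (2 * pi * of_int \<lfloor>x\<rfloor>)"
          by (simp only: cis_mult)
        moreover have "cis (2 * pi * of_int \<lfloor>x\<rfloor>) = 1" by (rule cis_multiple_2pi) simp
        ultimately show ?thesis by simp
      qed
      then show ?thesis by (simp add: circle_coords_def)
    qed
    moreover have "(\<chi> j. frac (\<theta> $ j)) \<in> ?C"
      by (simp add: mem_box_cart frac_ge_0 less_imp_le frac_lt_1)
    ultimately show ?thesis unfolding K_def by (metis image_eqI)
  qed
  have "continuous_on K F"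
  proof (subst continuous_on_closed_vimage[OF compact_imp_closed[OF K]], intro allI impI)
    fix B :: "real set" assume "closed B"
    then have "closed (f -` B)" using cont by (simp add: continuous_on_closed_vimage)
    then have "compact (?C \<inter> f -` B)" by (intro compact_Int_closed) auto
    then have "compact (circle_coords ` (?C \<inter> f -` B))"
      by (intro compact_continuous_image continuous_on_subset[OF cc]) auto
    moreover have "circle_coords ` (?C \<inter> f -` B) = F -` B \<inter> K"
      by (auto simp: K_def F)
    ultimately show "closed (F -` B \<inter> K)" by (simp add: compact_imp_closed)
  qed
  then obtain g where g: "real_polynomial_function g" "\<And>w. w \<in> K \<Longrightarrow> \<bar>F w - g w\<bar> < e"
    using Stone_Weierstrass_real_polynomial_function[OF K _ e] by metis
  show thesis
  proof
    show "trig_poly (\<lambda>\<theta>. of_real (g (circle_coords \<theta> :: complex ^ 'n)))"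
      by (rule trig_poly_of_real_polynomial[OF g(1)])
    show "norm (of_real (f \<theta>) - complex_of_real (g (circle_coords \<theta>))) < e" for \<theta>
      using g(2)[OF surj, of \<theta>] by (simp add: F flip: of_real_diff)
  qed
qed

text \<open>
  Two random points of the torus have the same distribution if their Fourier coefficients agree. The
  maps \<open>g\<close> and \<open>h\<close> take values in the universal cover, where they may be distributed differently.
\<close>

lemma integral_eq_if_character_integrals_eq:
  fixes f :: "real ^ 'n::finite \<Rightarrow> real"
  assumes M: "prob_space M" and N: "prob_space N"
    and g: "g \<in> borel_measurable M" and h: "h \<in> borel_measurable N"
    and char: "\<And>k. (\<integral>x. character k (g x) \<partial>M) = (\<integral>y. character k (h y) \<partial>N)"
    and cont: "continuous_on UNIV f" and per: "torus_periodic f"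
  shows "(\<integral>x. f (g x) \<partial>M) = (\<integral>y. f (h y) \<partial>N)"
proof -
  interpret M: prob_space M by fact
  interpret N: prob_space N by fact
  have meas: "(\<lambda>x. u (g x)) \<in> borel_measurable M" "(\<lambda>y. u (h y)) \<in> borel_measurable N"
    if "continuous_on UNIV u" for u :: "real ^ 'n \<Rightarrow> complex"
    using measurable_compose[OF g borel_measurable_continuous_onI[OF that]]
      measurable_compose[OF h borel_measurable_continuous_onI[OF that]] by auto
  have int: "integrable M (\<lambda>x. u (g x))" "integrable N (\<lambda>y. u (h y))" if tp: "trig_poly u" for u
  proof -
    obtain B where "\<forall>\<theta>. norm (u \<theta>) \<le> B" using trig_poly_bounded[OF tp] by auto
    then show "integrable M (\<lambda>x. u (g x))" "integrable N (\<lambda>y. u (h y))"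
      using meas[OF trig_poly_continuous[OF tp]]
      by (auto intro!: M.integrable_const_bound[where B=B] N.integrable_const_bound[where B=B])
  qed
  have eq: "(\<integral>x. u (g x) \<partial>M) = (\<integral>y. u (h y) \<partial>N)" if "trig_poly u" for u
    using that by (induction rule: trig_poly.induct) (simp_all add: char int)
  have "\<bar>(\<integral>x. f (g x) \<partial>M) - (\<integral>y. f (h y) \<partial>N)\<bar> \<le> 2 * e" if e: "e > 0" for e
  proof -
    obtain u where u: "trig_poly u" "\<And>\<theta>. norm (of_real (f \<theta>) - u \<theta>) < e"
      using trig_poly_dense[OF cont per e] by metis
    obtain B where B: "\<forall>\<theta>. norm (u \<theta>) \<le> B" using trig_poly_bounded[OF u(1)] by auto
    have fb: "norm (complex_of_real (f \<theta>)) \<le> B + e" for \<theta>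
      using norm_triangle_sub[of "complex_of_real (f \<theta>)" "u \<theta>"] u(2)[of \<theta>] B[rule_format, of \<theta>] by linarith
    have fc: "continuous_on UNIV (\<lambda>\<theta>. complex_of_real (f \<theta>))" using cont by (intro continuous_intros)
    have fi: "integrable M (\<lambda>x. complex_of_real (f (g x)))" "integrable N (\<lambda>y. complex_of_real (f (h y)))"
      using fb meas[OF fc]
      by (auto intro!: M.integrable_const_bound[where B="B+e"] N.integrable_const_bound[where B="B+e"])
    have 1: "norm ((\<integral>x. complex_of_real (f (g x)) \<partial>M) - (\<integral>x. u (g x) \<partial>M)) \<le> e"
    proof -
      have "norm (\<integral>x. complex_of_real (f (g x)) - u (g x) \<partial>M) \<le> (\<integral>x. e \<partial>M)"
        by (rule order_trans[OF integral_norm_bound], rule integral_mono)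
           (use fi int[OF u(1)] u(2) in \<open>auto intro: less_imp_le\<close>)
      then show ?thesis using fi int[OF u(1)] by (simp add: M.prob_space)
    qed
    have 2: "norm ((\<integral>x. complex_of_real (f (h x)) \<partial>N) - (\<integral>x. u (h x) \<partial>N)) \<le> e"
    proof -
      have "norm (\<integral>x. complex_of_real (f (h x)) - u (h x) \<partial>N) \<le> (\<integral>x. e \<partial>N)"
        by (rule order_trans[OF integral_norm_bound], rule integral_mono)
           (use fi int[OF u(1)] u(2) in \<open>auto intro: less_imp_le\<close>)
      then show ?thesis using fi int[OF u(1)] by (simp add: N.prob_space)
    qed
    have "norm ((\<integral>x. complex_of_real (f (g x)) \<partial>M) - (\<integral>x. complex_of_real (f (h x)) \<partial>N)) \<le> 2 * e"
      using norm_diff_triangle_le[OF 1 2[unfolded eq[OF u(1), symmetric], unfolded norm_minus_commute[of "integral\<^sup>L N _"]]]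
      by simp
    then show ?thesis by (simp flip: of_real_diff)
  qed
  from this[of "\<bar>(\<integral>x. f (g x) \<partial>M) - (\<integral>y. f (h y) \<partial>N)\<bar> / 4"] show ?thesis
    by (cases "(\<integral>x. f (g x) \<partial>M) = (\<integral>y. f (h y) \<partial>N)") auto
qed

section \<open>Fast averages as expectations over short translations and times\<close>

lemma borel_measurable_vec_lambda:
  fixes g :: "'n::finite \<Rightarrow> 'a \<Rightarrow> real"
  assumes "\<And>j. g j \<in> borel_measurable M"
  shows "(\<lambda>x. \<chi> j. g j x) \<in> borel_measurable M"
proof (subst borel_measurable_euclidean_space, intro ballI)
  fix b :: "real ^ 'n" assume "b \<in> Basis"
  then obtain i where "b = axis i 1" by (auto simp: Basis_vec_def)
  then show "(\<lambda>x. (\<chi> j. g j x) \<bullet> b) \<in> borel_measurable M"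
    using assms[of i] by (simp add: inner_axis)
qed

lemma prod_cis: "finite S \<Longrightarrow> (\<Prod>j\<in>S. cis (x j)) = cis (\<Sum>j\<in>S. x j)"
  by (induction S rule: finite_induct) (auto simp: cis_mult)

lemma integral_cis_unit_interval:
  fixes k :: int
  shows "(\<integral>t. indicator {0..1::real} t *\<^sub>R cis (2 * pi * (of_int k * t)) \<partial>lborel) = (if k = 0 then 1 else 0)"
proof (cases "k = 0")
  case True
  then show ?thesis by (simp add: measure_def)
next
  case False
  let ?c = "2 * pi * of_int k :: real"
  have c: "?c \<noteq> 0" using False by simp
  let ?F = "\<lambda>t. cis (?c * t) / (\<i> * of_real ?c)"
  have "(\<integral>t. indicator {0..1::real} t *\<^sub>R cis (?c * t) \<partial>lborel) = ?F 1 - ?F 0"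
  proof (rule integral_FTC_atLeastAtMost)
    show "(?F has_vector_derivative cis (?c * t)) (at t within {0..1})" for t
    proof -
      have "((\<lambda>t. exp (\<i> * of_real ?c * of_real t) / (\<i> * of_real ?c)) has_vector_derivative
          exp (\<i> * of_real ?c * of_real t)) (at t within {0..1})"
        by (rule has_vector_derivative_real_field) (use c in \<open>auto intro!: derivative_eq_intros\<close>)
      then show ?thesis by (simp add: cis_conv_exp mult_ac)
    qed
  qed (auto intro!: continuous_intros)
  also have "cis (?c * 1) = 1" by (simp add: cis_multiple_2pi)
  finally show ?thesis using False by (simp add: mult.assoc)
qed

text \<open>
  The uniform distribution of the fast angles, and the point of the torus with these fast angles and
  given slow angles.
\<close>

definition fast_cube :: "nat \<Rightarrow> ('n::{finite,linorder} \<Rightarrow> real) measure" where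
  "fast_cube d = restrict_space (Pi\<^sub>M (fast d) (\<lambda>_. lborel)) (\<Pi>\<^sub>E j\<in>fast d. {0..1})"

definition set_fast :: "nat \<Rightarrow> (real, 'n::{finite,linorder}) vec \<Rightarrow> ('n \<Rightarrow> real) \<Rightarrow> (real, 'n) vec" where
  "set_fast d \<theta> \<phi> = (\<chi> j. if j \<in> fast d then \<phi> j else \<theta> $ j)"

lemma sets_fast_cube_aux:
  "(\<Pi>\<^sub>E j\<in>fast d. {0..1::real}) \<in> sets (Pi\<^sub>M (fast d :: 'n::{finite,linorder} set) (\<lambda>_. lborel))"
  by (intro sets_PiM_I_finite) auto

lemma prob_space_fast_cube: "prob_space (fast_cube d)"
proof -
  interpret product_sigma_finite "\<lambda>_::'a. lborel :: real measure" by standard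
  show ?thesis unfolding fast_cube_def
    by (intro prob_space_restrict_space sets_fast_cube_aux) (subst emeasure_PiM, auto)
qed

lemma torus_average_eq_integral_fast_cube:
  "torus_average d A \<theta> = (\<integral>\<phi>. A (set_fast d \<theta> \<phi>) \<partial>fast_cube d)"
  unfolding torus_average_def fast_cube_def set_fast_def set_lebesgue_integral_def
  using sets_fast_cube_aux[where d = d]
  by (subst integral_restrict_space) (simp_all add: sets.Int_space_eq2)

lemma set_fast_measurable: "set_fast d \<theta> \<in> borel_measurable (fast_cube d)"
  unfolding fast_cube_def set_fast_def
proof (intro measurable_restrict_space1 borel_measurable_vec_lambda)
  show "(\<lambda>\<phi>. if j \<in> fast d then \<phi> j else \<theta> $ j) \<in> borel_measurable (Pi\<^sub>M (fast d) (\<lambda>_. lborel))" for j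
    by (cases "j \<in> fast d") (auto intro: measurable_component_singleton[of _ _ "\<lambda>_. lborel", simplified])
qed

lemma integral_character_fast_cube:
  "(\<integral>\<phi>. character k (set_fast d \<theta> \<phi>) \<partial>fast_cube d) =
    (if \<forall>j\<in>fast d. k j = 0 then character k \<theta> else 0)"
proof -
  interpret product_sigma_finite "\<lambda>_::'a. lborel :: real measure" by standard
  let ?s = "cis (2 * pi * (\<Sum>j\<in>- fast d. of_int (k j) * \<theta> $ j))"
  let ?u = "\<lambda>j t. indicator {0..1::real} t *\<^sub>R cis (2 * pi * (of_int (k j) * t))"
  have split: "character k v = cis (2 * pi * (\<Sum>j\<in>- fast d. of_int (k j) * v $ j)) *
      (\<Prod>j\<in>fast d. cis (2 * pi * (of_int (k j) * v $ j)))" for v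
    unfolding character_def
    by (subst sum.subset_diff[of "fast d"])
       (auto simp: prod_cis cis_mult Compl_eq_Diff_UNIV distrib_left sum_distrib_left)
  have "(\<integral>\<phi>. character k (set_fast d \<theta> \<phi>) \<partial>fast_cube d) =
      (\<integral>\<phi>. indicator (\<Pi>\<^sub>E j\<in>fast d. {0..1}) \<phi> *\<^sub>R character k (set_fast d \<theta> \<phi>) \<partial>Pi\<^sub>M (fast d) (\<lambda>_. lborel))"
    unfolding fast_cube_def using sets_fast_cube_aux[where d = d]
    by (subst integral_restrict_space) (simp_all add: sets.Int_space_eq2)
  also have "\<dots> = (\<integral>\<phi>. ?s * (\<Prod>j\<in>fast d. ?u j (\<phi> j)) \<partial>Pi\<^sub>M (fast d) (\<lambda>_. lborel))"
  proof (rule Bochner_Integration.integral_cong[OF refl])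
    fix \<phi> :: "'a \<Rightarrow> real" assume \<phi>: "\<phi> \<in> space (Pi\<^sub>M (fast d) (\<lambda>_. lborel))"
    have "indicator (\<Pi>\<^sub>E j\<in>fast d. {0..1}) \<phi> = (\<Prod>j\<in>fast d. indicator {0..1} (\<phi> j) :: real)"
    proof (cases "\<forall>j\<in>fast d. \<phi> j \<in> {0..1}")
      case True
      then show ?thesis using \<phi> by (simp add: space_PiM PiE_iff indicator_def)
    next
      case False
      then have "(\<Prod>j\<in>fast d. indicator {0..1} (\<phi> j) :: real) = 0"
        by (intro prod_zero) (auto simp: indicator_def)
      then show ?thesis using False by (auto simp: PiE_iff indicator_def)
    qed
    moreover have "character k (set_fast d \<theta> \<phi>) = ?s * (\<Prod>j\<in>fast d. cis (2 * pi * (of_int (k j) * \<phi> j)))"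
      unfolding split by (simp add: set_fast_def)
    ultimately show "indicator (\<Pi>\<^sub>E j\<in>fast d. {0..1}) \<phi> *\<^sub>R character k (set_fast d \<theta> \<phi>) =
        ?s * (\<Prod>j\<in>fast d. ?u j (\<phi> j))"
      by (simp add: scaleR_conv_of_real prod.distrib mult_ac)
  qed
  also have "\<dots> = ?s * (\<Prod>j\<in>fast d. integral\<^sup>L lborel (?u j))"
  proof -
    have "integrable lborel (?u j)" for j
      by (intro borel_integrable_atLeastAtMost' [unfolded set_integrable_def] continuous_intros)
    then show ?thesis
      by (subst integral_mult_right_zero, subst product_integral_prod) auto
  qed
  also have "\<dots> = ?s * (\<Prod>j\<in>fast d. if k j = 0 then 1 else 0)"
    by (simp only: integral_cis_unit_interval)
  also have "\<dots> = (if \<forall>j\<in>fast d. k j = 0 then character k \<theta> else 0)"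
  proof (cases "\<forall>j\<in>fast d. k j = 0")
    case True
    then show ?thesis by (simp add: split[of \<theta>])
  next
    case False
    then have "(\<Prod>j\<in>fast d. if k j = 0 then 1 else 0 :: complex) = 0" by (intro prod_zero) auto
    then show ?thesis using False by auto
  qed
  finally show ?thesis .
qed

text \<open>
  The torus average is an expectation over points near the orbit \<open>u \<mapsto> \<theta> + u\<omega>\<close>; the numbers \<open>a\<close> and
  \<open>b\<close> bound the mean distance from the orbit and the mean time spent on it.
\<close>

definition averaging_measure ::
  "nat \<Rightarrow> (real, 'n::{finite,linorder}) vec \<Rightarrow> real \<Rightarrow> real \<Rightarrow> ((real, 'n) vec \<times> real) measure \<Rightarrow> bool" where
  "averaging_measure d \<omega> a b \<rho> \<longleftrightarrow> prob_space \<rho> \<and> sets \<rho> = sets borel \<and>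
     integrable \<rho> (\<lambda>z. norm (fst z)) \<and> integrable \<rho> (\<lambda>z. \<bar>snd z\<bar>) \<and>
     (\<integral>z. norm (fst z) \<partial>\<rho>) \<le> a \<and> (\<integral>z. \<bar>snd z\<bar> \<partial>\<rho>) \<le> b \<and>
     (\<forall>f :: (real, 'n) vec \<Rightarrow> real. \<forall>\<theta>. continuous_on UNIV f \<and> torus_periodic f \<longrightarrow>
        torus_average d f \<theta> = (\<integral>z. f (\<theta> + fst z + snd z *\<^sub>R \<omega>) \<partial>\<rho>))"

text \<open>
  The translation has independent components \<open>n/Q \<cdot> x\<^sub>j\<close> in the fast directions and the time is
  \<open>T u\<close>, where the \<open>x\<^sub>j\<close> and \<open>u\<close> follow the band-limited distribution. The Fourier multiplier of the
  mode \<open>k\<close> is then the product of the characteristic functions at \<open>2\<pi> n k\<^sub>j / Q\<close> and at \<open>2\<pi> T k\<cdot>\<omega>\<close>,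
  and it vanishes unless \<open>k\<close> has no fast component: if \<open>\<bar>k\<bar>\<^sub>1 \<le> Q\<close>, the last argument is at least
  \<open>2\<pi>\<close> in absolute value by the small divisor hypothesis, and otherwise some \<open>\<bar>k\<^sub>j\<bar> > Q/n\<close>.
  The constant depends only on the dimension.
\<close>

lemma averaging_measure_exists:
  obtains c :: real where "c > 0"
    "\<And>d (\<omega> :: (real, 'n::{finite,linorder}) vec) Q T. \<lbrakk>Q \<ge> 1; T > 0; \<And>j. j \<in> slow d \<Longrightarrow> \<omega> $ j = 0;
      \<And>k :: 'n \<Rightarrow> int. \<lbrakk>\<exists>j\<in>fast d. k j \<noteq> 0; of_int (\<Sum>j\<in>fast d. \<bar>k j\<bar>) \<le> Q\<rbrakk> \<Longrightarrow>
         1 \<le> T * \<bar>\<Sum>j\<in>fast d. of_int (k j) * \<omega> $ j\<bar>\<rbrakk>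
     \<Longrightarrow> \<exists>\<rho>. averaging_measure d \<omega> (c / Q) (c * T) \<rho>"
proof -
  obtain P :: "real measure" where P: "prob_space P" "sets P = sets borel"
    "integrable P (\<lambda>t. \<bar>t\<bar>)" and Pfourier: "\<And>a. \<bar>a\<bar> \<ge> 4 \<Longrightarrow> integral\<^sup>L P (\<lambda>t. cis (a * t)) = 0"
    using band_limited_distribution_exists by blast
  interpret P: prob_space P by fact
  note P(2)[measurable_cong]
  define m where "m = (\<integral>t. \<bar>t\<bar> \<partial>P)"
  have m: "m \<ge> 0" by (simp add: m_def)
  define n where "n = real CARD('n)"
  have n: "n \<ge> 1" by (simp add: n_def Suc_leI)
  show thesis
  proof (rule that[of "n\<^sup>2 * m + m + 1"])
    show "n\<^sup>2 * m + m + 1 > 0" using m by (simp add: add_nonneg_pos)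
    fix d and \<omega> :: "(real, 'n) vec" and Q T :: real
    assume Q: "Q \<ge> 1" and T: "T > 0" and slow: "\<And>j. j \<in> slow d \<Longrightarrow> \<omega> $ j = 0"
      and gap: "\<And>k :: 'n \<Rightarrow> int. \<lbrakk>\<exists>j\<in>fast d. k j \<noteq> 0; of_int (\<Sum>j\<in>fast d. \<bar>k j\<bar>) \<le> Q\<rbrakk> \<Longrightarrow>
         1 \<le> T * \<bar>\<Sum>j\<in>fast d. of_int (k j) * \<omega> $ j\<bar>"
    let ?F = "fast d :: 'n set"
    \<comment> \<open>The index \<open>None\<close> carries the time, the index \<open>Some j\<close> the translation in the direction \<open>j\<close>.\<close>
    let ?I = "insert None (Some ` ?F)"
    let ?M = "Pi\<^sub>M ?I (\<lambda>_. P)"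
    define X :: "('n option \<Rightarrow> real) \<Rightarrow> (real, 'n) vec" where "X x = (\<chi> j. if j \<in> ?F then n / Q * x (Some j) else 0)" for x
    define U where "U x = T * x None" for x :: "'n option \<Rightarrow> real"
    interpret PS: product_prob_space "\<lambda>_::'n option. P" by standard
    interpret M: prob_space ?M by (rule prob_space_PiM) (rule P(1))
    have comp: "(\<lambda>x. x i) \<in> borel_measurable ?M" if "i \<in> ?I" for i
      using measurable_component_singleton[of i ?I "\<lambda>_. P"] that by (simp cong: measurable_cong_sets)
    have Xm: "X \<in> borel_measurable ?M" unfolding X_def
    proof (rule borel_measurable_vec_lambda)
      show "(\<lambda>x. if j \<in> ?F then n / Q * x (Some j) else 0) \<in> borel_measurable ?M" for j
        by (cases "j \<in> ?F") (use comp[of "Some j"] in auto)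
    qed
    have Um: "U \<in> borel_measurable ?M" unfolding U_def using comp[of None] by auto
    have XU: "(\<lambda>x. (X x, U x)) \<in> borel_measurable ?M"
      by (rule borel_measurable_Pair[OF Xm Um])
    define \<rho> where "\<rho> = distr ?M borel (\<lambda>x. (X x, U x))"
    have abs_comp: "integrable ?M (\<lambda>x. \<bar>x i\<bar>)" "(\<integral>x. \<bar>x i\<bar> \<partial>?M) = m" if "i \<in> ?I" for i
    proof -
      have d: "distr ?M P (\<lambda>x. x i) = P" by (rule distr_PiM_component[OF P(1) that])
      have meas: "(\<lambda>x. x i) \<in> measurable ?M P" by (rule measurable_component_singleton[OF that])
      have "integrable (distr ?M P (\<lambda>x. x i)) (\<lambda>t. \<bar>t\<bar>)" unfolding d by (rule P(3))
      then show "integrable ?M (\<lambda>x. \<bar>x i\<bar>)" using meas borel_measurable_integrable[OF P(3)] by (subst (asm) integrable_distr_eq) auto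
      show "(\<integral>x. \<bar>x i\<bar> \<partial>?M) = m" unfolding m_def
        by (subst (2) d[symmetric], subst integral_distr[OF meas])
           (use borel_measurable_integrable[OF P(3)] in auto)
    qed
    have normX: "norm (X x) \<le> (\<Sum>j\<in>?F. n / Q * \<bar>x (Some j)\<bar>)" for x
    proof -
      have "norm (X x) \<le> (\<Sum>j\<in>UNIV. \<bar>X x $ j\<bar>)" by (rule norm_le_l1_cart)
      also have "\<dots> = (\<Sum>j\<in>?F. \<bar>X x $ j\<bar>)"
        by (rule sum.mono_neutral_right) (auto simp: X_def)
      also have "\<dots> = (\<Sum>j\<in>?F. n / Q * \<bar>x (Some j)\<bar>)"
        using Q n by (intro sum.cong) (auto simp: X_def abs_mult)
      finally show ?thesis .
    qed
    have Bint: "integrable ?M (\<lambda>x. \<Sum>j\<in>?F. n / Q * \<bar>x (Some j)\<bar>)"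
      by (intro Bochner_Integration.integrable_sum integrable_mult_right abs_comp) auto
    have Xint: "integrable ?M (\<lambda>x. norm (X x))"
      by (rule Bochner_Integration.integrable_bound[OF Bint])
         (use Xm normX in \<open>auto intro: order_trans[OF _ abs_ge_self]\<close>)
    have Uint: "integrable ?M (\<lambda>x. \<bar>U x\<bar>)" using T abs_comp(1)[of None] by (simp add: U_def abs_mult)
    have "(\<integral>x. norm (X x) \<partial>?M) \<le> (\<integral>x. (\<Sum>j\<in>?F. n / Q * \<bar>x (Some j)\<bar>) \<partial>?M)"
      by (rule integral_mono[OF Xint Bint normX])
    also have "\<dots> = (\<Sum>j\<in>?F. n / Q * m)"
      using abs_comp by (subst Bochner_Integration.integral_sum) auto
    also have "\<dots> \<le> n * (n / Q * m)"
    proof -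
      have "real (card ?F) * (n / Q * m) \<le> n * (n / Q * m)"
        using Q n m card_mono[of UNIV ?F] by (intro mult_right_mono) (auto simp: n_def)
      then show ?thesis by simp
    qed
    also have "\<dots> = (n\<^sup>2 * m) / Q" by (simp add: power2_eq_square)
    also have "\<dots> \<le> (n\<^sup>2 * m + m + 1) / Q" using Q m by (intro divide_right_mono) auto
    finally have X1: "(\<integral>x. norm (X x) \<partial>?M) \<le> (n\<^sup>2 * m + m + 1) / Q" .
    have "(\<integral>x. \<bar>U x\<bar> \<partial>?M) = T * m" using T abs_comp(2)[of None] by (simp add: U_def abs_mult)
    also have "\<dots> \<le> (n\<^sup>2 * m + m + 1) * T" using T m by (simp add: algebra_simps)
    finally have U1: "(\<integral>x. \<bar>U x\<bar> \<partial>?M) \<le> (n\<^sup>2 * m + m + 1) * T" .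
    have char: "(\<integral>\<phi>. character k (set_fast d \<theta> \<phi>) \<partial>fast_cube d) =
        (\<integral>x. character k (\<theta> + X x + U x *\<^sub>R \<omega>) \<partial>?M)" for k and \<theta> :: "(real, 'n) vec"
    proof -
      let ?s = "\<Sum>j\<in>?F. of_int (k j) * \<omega> $ j"
      define a where "a i = (case i of None \<Rightarrow> 2 * pi * (T * ?s) | Some j \<Rightarrow> 2 * pi * (n / Q * of_int (k j)))" for i
      have slow_iff: "j \<notin> ?F \<Longrightarrow> \<omega> $ j = 0" for j
        using slow[of j] by (simp add: slow_def fast_def)
      have "character k (\<theta> + X x + U x *\<^sub>R \<omega>) = character k \<theta> * (\<Prod>i\<in>?I. cis (a i * x i))" for x
      proof -
        have "(\<Sum>j\<in>UNIV. of_int (k j) * X x $ j) = (\<Sum>j\<in>?F. of_int (k j) * (n / Q * x (Some j)))"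
          by (rule sum.mono_neutral_cong_right) (auto simp: X_def)
        moreover have "(\<Sum>j\<in>UNIV. of_int (k j) * (U x *\<^sub>R \<omega>) $ j) = U x * ?s"
          unfolding sum_distrib_left by (rule sum.mono_neutral_cong_right) (auto simp: slow_iff)
        moreover have "(\<Prod>i\<in>?I. cis (a i * x i)) = cis (\<Sum>i\<in>?I. a i * x i)" by (rule prod_cis) auto
        moreover have "(\<Sum>i\<in>?I. a i * x i) = 2 * pi * (U x * ?s) + 2 * pi * (\<Sum>j\<in>?F. of_int (k j) * (n / Q * x (Some j)))"
          by (subst sum.insert) (auto simp: a_def U_def sum.reindex sum_distrib_left mult_ac)
        ultimately show ?thesis unfolding character_add
          by (simp add: character_def cis_mult add_ac)
      qed
      then have "(\<integral>x. character k (\<theta> + X x + U x *\<^sub>R \<omega>) \<partial>?M) =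
          character k \<theta> * (\<integral>x. (\<Prod>i\<in>?I. cis (a i * x i)) \<partial>?M)" by simp
      also have "(\<integral>x. (\<Prod>i\<in>?I. cis (a i * x i)) \<partial>?M) = (\<Prod>i\<in>?I. integral\<^sup>L P (\<lambda>t. cis (a i * t)))"
      proof (rule PS.product_integral_prod)
        have "(\<lambda>t. cis (b * t)) \<in> borel_measurable P" for b by measurable
        then show "integrable P (\<lambda>t. cis (a i * t))" for i
          by (intro P.integrable_const_bound[where B=1]) auto
      qed auto
      also have "character k \<theta> * \<dots> = (if \<forall>j\<in>fast d. k j = 0 then character k \<theta> else 0)"
      proof (cases "\<forall>j\<in>?F. k j = 0")
        case True
        then have "a i = 0" if "i \<in> ?I" for i using that by (auto simp: a_def)
        then show ?thesis using True by (simp add: P.prob_space)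
      next
        case False
        have "\<exists>i\<in>?I. \<bar>a i\<bar> \<ge> 4"
        proof (cases "of_int (\<Sum>j\<in>?F. \<bar>k j\<bar>) \<le> Q")
          case True
          then have "1 \<le> T * \<bar>?s\<bar>" using gap[of k] False by auto
          then have "2 * pi * 1 \<le> 2 * pi * (T * \<bar>?s\<bar>)" by (intro mult_left_mono) auto
          moreover have "\<bar>a None\<bar> = 2 * pi * (T * \<bar>?s\<bar>)" using T by (simp add: a_def abs_mult)
          ultimately have "\<bar>a None\<bar> \<ge> 4" using pi_gt3 by linarith
          then show ?thesis by blast
        next
          case big: False
          have "\<exists>j\<in>?F. real_of_int \<bar>k j\<bar> > Q / n"
          proof (rule ccontr)
            assume "\<not> ?thesis"
            then have "(\<Sum>j\<in>?F. real_of_int \<bar>k j\<bar>) \<le> (\<Sum>j\<in>?F. Q / n)" by (intro sum_mono) auto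
            also have "\<dots> \<le> n * (Q / n)"
            proof -
              have "real (card ?F) * (Q / n) \<le> n * (Q / n)"
                using Q n card_mono[of UNIV ?F] by (intro mult_right_mono) (auto simp: n_def)
              then show ?thesis by simp
            qed
            finally show False using big n by simp
          qed
          then obtain j where j: "j \<in> ?F" "real_of_int \<bar>k j\<bar> > Q / n" by auto
          then have "n / Q * real_of_int \<bar>k j\<bar> \<ge> n / Q * (Q / n)"
            using n Q by (intro mult_left_mono) auto
          then have "n / Q * real_of_int \<bar>k j\<bar> \<ge> 1" using n Q by simp
          then have "2 * pi * 1 \<le> 2 * pi * (n / Q * real_of_int \<bar>k j\<bar>)" by (intro mult_left_mono) auto
          moreover have "\<bar>a (Some j)\<bar> = 2 * pi * (n / Q * real_of_int \<bar>k j\<bar>)"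
            using n Q by (simp add: a_def abs_mult)
          ultimately have "\<bar>a (Some j)\<bar> \<ge> 4" using pi_gt3 by linarith
          then show ?thesis using j by blast
        qed
        then have "(\<Prod>i\<in>?I. integral\<^sup>L P (\<lambda>t. cis (a i * t))) = 0"
          by (intro prod_zero) (auto intro: Pfourier)
        then show ?thesis using False by auto
      qed
      finally show ?thesis by (simp add: integral_character_fast_cube)
    qed
    have avg: "torus_average d f \<theta> = (\<integral>z. f (\<theta> + fst z + snd z *\<^sub>R \<omega>) \<partial>\<rho>)"
      if f: "continuous_on UNIV f" "torus_periodic f" for f :: "(real, 'n) vec \<Rightarrow> real" and \<theta>
    proof -
      have meas: "(\<lambda>x. \<theta> + X x + U x *\<^sub>R \<omega>) \<in> borel_measurable ?M"
        using Xm Um by (intro borel_measurable_add borel_measurable_scaleR) auto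
      have "torus_average d f \<theta> = (\<integral>x. f (\<theta> + X x + U x *\<^sub>R \<omega>) \<partial>?M)"
        unfolding torus_average_eq_integral_fast_cube
        by (rule integral_eq_if_character_integrals_eq[OF prob_space_fast_cube M.prob_space_axioms
              set_fast_measurable meas char f])
      also have "\<dots> = (\<integral>z. f (\<theta> + fst z + snd z *\<^sub>R \<omega>) \<partial>\<rho>)"
        unfolding \<rho>_def by (subst integral_distr[OF XU])
          (auto intro!: borel_measurable_continuous_onI continuous_on_compose2[OF f(1)] continuous_intros)
      finally show ?thesis .
    qed
    have [measurable]: "(\<lambda>z::(real, 'n) vec \<times> real. norm (fst z)) \<in> borel_measurable borel"
      "(\<lambda>z::(real, 'n) vec \<times> real. \<bar>snd z\<bar>) \<in> borel_measurable borel"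
      by (auto intro!: borel_measurable_continuous_onI continuous_intros)
    show "\<exists>\<rho>. averaging_measure d \<omega> ((n\<^sup>2 * m + m + 1) / Q) ((n\<^sup>2 * m + m + 1) * T) \<rho>"
      unfolding averaging_measure_def
    proof (intro exI[of _ \<rho>] conjI allI impI)
      show "prob_space \<rho>" unfolding \<rho>_def by (rule M.prob_space_distr[OF XU])
      show "sets \<rho> = sets borel" by (simp add: \<rho>_def)
      show "integrable \<rho> (\<lambda>z. norm (fst z))" "integrable \<rho> (\<lambda>z. \<bar>snd z\<bar>)"
        unfolding \<rho>_def using Xint Uint by (subst integrable_distr_eq[OF XU]; simp)+
      show "(\<integral>z. norm (fst z) \<partial>\<rho>) \<le> (n\<^sup>2 * m + m + 1) / Q" "(\<integral>z. \<bar>snd z\<bar> \<partial>\<rho>) \<le> (n\<^sup>2 * m + m + 1) * T"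
        unfolding \<rho>_def using X1 U1 by (subst integral_distr[OF XU]; simp)+
    qed (use avg in auto)
  qed
qed

section \<open>Solutions of Hamiltonian systems on a box\<close>

text \<open>
  Picard iteration for \<open>z(t) = z\<^sub>0 + exp(2Lt) u(t)\<close>. The weight makes the integral operator a
  contraction with constant \<open>1/2\<close> on bounded continuous functions \<open>u\<close>, whatever the length of the
  time interval.
\<close>

lemma lipschitz_field_solution_exists:
  fixes X :: "'a::euclidean_space \<Rightarrow> 'a"
  assumes L: "L > 0" and lip: "\<And>x y. dist (X x) (X y) \<le> L * dist x y"
    and bd: "\<And>x. norm (X x) \<le> K" and T: "T \<ge> 0"
  obtains z where "z 0 = z0"
    "\<And>t. t \<in> {0..T} \<Longrightarrow> (z has_vector_derivative X (z t)) (at t within {0..T})"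
proof -
  \<comment> \<open>Freezing the time outside \<open>[0, T]\<close> gives functions on the whole line, as the function space asks for.\<close>
  define m where "m t = max 0 (min t T)" for t
  have m: "m t \<in> {0..T}" and m_id: "t \<in> {0..T} \<Longrightarrow> m t = t" for t using T by (auto simp: m_def)
  have m_cont: "continuous_on UNIV m" unfolding m_def by (intro continuous_intros)
  have X_cont: "continuous_on S X" for S
    by (rule continuous_on_subset[of UNIV], rule lipschitz_on_continuous_on[of L])
       (use L lip in \<open>auto intro!: lipschitz_onI\<close>)
  define F where "F u s = X (z0 + exp (2 * L * s) *\<^sub>R apply_bcontfun u s)" for u s
  have F_cont: "continuous_on S (F u)" for S u
    unfolding F_def by (rule continuous_on_compose2[OF X_cont[of UNIV]]) (auto intro!: continuous_intros)
  have F_int: "F u integrable_on {a..b}" for u a b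
    by (rule integrable_continuous_real[OF F_cont])
  define g where "g u t = exp (- (2 * L * m t)) *\<^sub>R integral {0..m t} (F u)" for u t
  have g_in: "g u \<in> bcontfun" for u
  proof (rule bcontfun_normI)
    have "continuous_on {0..T} (\<lambda>t. integral {0..t} (F u))"
      by (rule indefinite_integral_continuous_1[OF F_int])
    then have "continuous_on UNIV (\<lambda>t. integral {0..m t} (F u))"
      by (rule continuous_on_compose2[OF _ m_cont]) (use m in auto)
    then show "continuous_on UNIV (g u)" unfolding g_def by (intro continuous_intros m_cont)
    fix t
    have "norm (integral {0..m t} (F u)) \<le> integral {0..m t} (\<lambda>_. K)"
      by (rule integral_norm_bound_integral[OF F_int]) (auto simp: F_def bd)
    also have "\<dots> = K * m t" using m[of t] by simp
    also have "\<dots> \<le> K * T" using m[of t] norm_ge_zero[of "X z0"] bd[of z0]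
      by (intro mult_left_mono) (auto simp del: norm_ge_zero)
    finally have "norm (integral {0..m t} (F u)) \<le> K * T" .
    moreover have "exp (- (2 * L * m t)) \<le> 1" using L m[of t] by simp
    ultimately have "exp (- (2 * L * m t)) * norm (integral {0..m t} (F u)) \<le> 1 * (K * T)"
      by (intro mult_mono) auto
    then show "norm (g u t) \<le> K * T" by (simp add: g_def)
  qed
  define G where "G u = Bcontfun (g u)" for u
  have G: "apply_bcontfun (G u) t = g u t" for u t
    unfolding G_def by (simp add: Bcontfun_inverse g_in)
  have contr: "dist (G u) (G v) \<le> 1/2 * dist u v" for u v
  proof (rule dist_bound)
    fix t
    have "norm (integral {0..m t} (F u) - integral {0..m t} (F v)) = norm (integral {0..m t} (\<lambda>s. F u s - F v s))"
      by (subst Henstock_Kurzweil_Integration.integral_diff[OF F_int F_int]) simp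
    also have "\<dots> \<le> integral {0..m t} (\<lambda>s. L * dist u v * exp (2 * L * s))"
    proof (rule integral_norm_bound_integral)
      show "(\<lambda>s. F u s - F v s) integrable_on {0..m t}" by (intro integrable_diff F_int)
      show "(\<lambda>s. L * dist u v * exp (2 * L * s)) integrable_on {0..m t}"
        by (intro integrable_continuous_real continuous_intros)
      fix s
      have "norm (F u s - F v s) \<le> L * dist (z0 + exp (2 * L * s) *\<^sub>R apply_bcontfun u s) (z0 + exp (2 * L * s) *\<^sub>R apply_bcontfun v s)"
        unfolding F_def dist_norm[symmetric] by (rule lip)
      also have "\<dots> = L * (exp (2 * L * s) * dist (apply_bcontfun u s) (apply_bcontfun v s))"
        by (simp add: dist_norm flip: scaleR_diff_right)
      also have "\<dots> \<le> L * (exp (2 * L * s) * dist u v)"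
        using L by (intro mult_left_mono dist_bounded) auto
      finally show "norm (F u s - F v s) \<le> L * dist u v * exp (2 * L * s)" by (simp add: mult_ac)
    qed
    also have "\<dots> = dist u v * exp (2 * L * m t) / 2 - dist u v * exp (2 * L * 0) / 2"
      using m[of t] L
      by (intro integral_unique fundamental_theorem_of_calculus)
         (auto intro!: derivative_eq_intros simp flip: has_real_derivative_iff_has_vector_derivative)
    also have "\<dots> \<le> dist u v * exp (2 * L * m t) / 2" by simp
    finally have *: "norm (integral {0..m t} (F u) - integral {0..m t} (F v)) \<le> dist u v * exp (2 * L * m t) / 2" .
    have "dist (apply_bcontfun (G u) t) (apply_bcontfun (G v) t) =
        exp (- (2 * L * m t)) * norm (integral {0..m t} (F u) - integral {0..m t} (F v))"
      by (simp add: G g_def dist_norm flip: scaleR_diff_right)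
    also have "\<dots> \<le> exp (- (2 * L * m t)) * (dist u v * exp (2 * L * m t) / 2)"
      by (intro mult_left_mono *) auto
    also have "\<dots> = 1/2 * dist u v" by (simp add: exp_minus field_simps)
    finally show "dist (apply_bcontfun (G u) t) (apply_bcontfun (G v) t) \<le> 1/2 * dist u v" .
  qed
  obtain u where u: "G u = u" using banach_fix_type[of "1/2" G] contr by auto
  define z where "z t = z0 + integral {0..t} (F u)" for t
  have F_eq: "F u t = X (z t)" if t: "t \<in> {0..T}" for t
  proof -
    have "apply_bcontfun u t = exp (- (2 * L * t)) *\<^sub>R integral {0..t} (F u)"
      using G[of u t] u m_id[OF t] by (simp add: g_def)
    then have "exp (2 * L * t) *\<^sub>R apply_bcontfun u t = integral {0..t} (F u)"
      by (simp flip: exp_add)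
    then show ?thesis by (simp add: F_def z_def)
  qed
  show thesis
  proof (rule that[of z])
    show "z 0 = z0" by (simp add: z_def)
    fix t assume t: "t \<in> {0..T}"
    show "(z has_vector_derivative X (z t)) (at t within {0..T})"
      unfolding z_def[abs_def] F_eq[OF t, symmetric, unfolded z_def]
      using integral_has_vector_derivative[OF F_cont t, of u]
      by (auto intro!: derivative_eq_intros)
  qed
qed

lemma norm_linear_le_sum_Basis:
  fixes f :: "'a::euclidean_space \<Rightarrow> 'b::real_normed_vector"
  assumes "linear f" "\<And>b. b \<in> Basis \<Longrightarrow> norm (f b) \<le> B"
  shows "norm (f h) \<le> real DIM('a) * B * norm h"
proof -
  interpret linear f by fact
  have "f h = (\<Sum>b\<in>Basis. (h \<bullet> b) *\<^sub>R f b)"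
    by (subst euclidean_representation[of h, symmetric]) (simp only: sum scaleR)
  then have "norm (f h) \<le> (\<Sum>b\<in>Basis. \<bar>h \<bullet> b\<bar> * norm (f b))"
    by (simp only:) (rule sum_norm_le, simp)
  also have "\<dots> \<le> (\<Sum>b\<in>(Basis::'a set). norm h * B)"
    by (intro sum_mono mult_mono assms(2) Basis_le_norm) auto
  also have "\<dots> = real DIM('a) * B * norm h" by simp
  finally show ?thesis .
qed

lemma lipschitz_if_partials_bounded:
  fixes f :: "'a::euclidean_space \<Rightarrow> 'b::real_normed_vector"
  assumes "convex S" and diff: "\<And>x. x \<in> S \<Longrightarrow> f differentiable (at x)"
    and bd: "\<And>x b. x \<in> S \<Longrightarrow> b \<in> Basis \<Longrightarrow> norm (frechet_derivative f (at x) b) \<le> B"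
    and "x \<in> S" "y \<in> S"
  shows "norm (f x - f y) \<le> real DIM('a) * B * norm (x - y)"
proof (rule differentiable_bound[OF \<open>convex S\<close> _ _ \<open>x \<in> S\<close> \<open>y \<in> S\<close>])
  fix x assume x: "x \<in> S"
  have d: "(f has_derivative frechet_derivative f (at x)) (at x)"
    using diff[OF x] by (simp add: frechet_derivative_works)
  then show "(f has_derivative frechet_derivative f (at x)) (at x within S)"
    by (rule has_derivative_at_withinI)
  show "onorm (frechet_derivative f (at x)) \<le> real DIM('a) * B"
    using norm_linear_le_sum_Basis[OF has_derivative_linear[OF d] bd[OF x]]
    by (intro onorm_le) auto
qed

lemma class_C_1_lipschitz_on_cbox:
  fixes f :: "'a::euclidean_space \<Rightarrow> 'b::euclidean_space"
  assumes "class_C (Suc 0) f"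
  obtains L where "L > 0" "\<And>x y. x \<in> cbox a b \<Longrightarrow> y \<in> cbox a b \<Longrightarrow> dist (f x) (f y) \<le> L * dist x y"
proof -
  have diff: "f differentiable (at x)" for x using assms by simp
  have cont: "continuous_on UNIV (\<lambda>x. frechet_derivative f (at x) e)" if "e \<in> Basis" for e
    using assms that by simp
  have "\<exists>B. \<forall>x\<in>cbox a b. norm (frechet_derivative f (at x) e) \<le> B" if "e \<in> Basis" for e
  proof -
    have "compact ((\<lambda>x. frechet_derivative f (at x) e) ` cbox a b)"
      by (intro compact_continuous_image continuous_on_subset[OF cont[OF that]]) auto
    then show ?thesis using compact_imp_bounded bounded_iff by (metis (no_types, lifting) imageI)
  qed
  then obtain B where B: "\<And>e x. e \<in> Basis \<Longrightarrow> x \<in> cbox a b \<Longrightarrow> norm (frechet_derivative f (at x) e) \<le> B e"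
    by metis
  define M where "M = (\<Sum>e\<in>(Basis::'a set). \<bar>B e\<bar>)"
  have M: "B e \<le> M" if "e \<in> Basis" for e
  proof -
    have "\<bar>B e\<bar> \<le> M" unfolding M_def by (rule member_le_sum) (use that in auto)
    then show ?thesis by simp
  qed
  have M0: "M \<ge> 0" by (simp add: M_def sum_nonneg)
  show thesis
  proof (rule that[of "real DIM('a) * M + 1"])
    show "real DIM('a) * M + 1 > 0" using M0 by (simp add: add_nonneg_pos)
    fix x y assume xy: "x \<in> cbox a b" "y \<in> cbox a b"
    have "dist (f x) (f y) \<le> real DIM('a) * M * dist x y"
      unfolding dist_norm
      by (rule lipschitz_if_partials_bounded[where S="cbox a b"])
         (use xy diff order_trans[OF B M] in auto)
    also have "\<dots> \<le> (real DIM('a) * M + 1) * dist x y" by (intro mult_right_mono) auto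
    finally show "dist (f x) (f y) \<le> (real DIM('a) * M + 1) * dist x y" .
  qed
qed

text \<open>
  The sum over the standard basis writes \<open>(\<partial>\<^sub>I H, - \<partial>\<^sub>\<theta> H)\<close> as a combination of the partial
  derivatives of \<open>H\<close> with constant vectors, so that regularity passes from the partial derivatives to
  the field.
\<close>

definition hamiltonian_field ::
  "((real ^ 'n) \<times> (real ^ 'n) \<Rightarrow> real) \<Rightarrow> (real ^ 'n) \<times> (real ^ 'n) \<Rightarrow> (real ^ 'n) \<times> (real ^ 'n)" where
  "hamiltonian_field H z = (\<Sum>b\<in>Basis. frechet_derivative H (at z) b *\<^sub>R (snd b, - fst b))"

lemma hamiltonian_field_inner:
  fixes H :: "(real ^ 'n::finite) \<times> (real ^ 'n) \<Rightarrow> real"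
  assumes "H differentiable (at z)"
  shows "h \<bullet> fst (hamiltonian_field H z) = frechet_derivative H (at z) (0, h)"
    and "h \<bullet> snd (hamiltonian_field H z) = - frechet_derivative H (at z) (h, 0)"
proof -
  interpret D: linear "frechet_derivative H (at z)"
    using assms linear_frechet_derivative by auto
  have rep: "frechet_derivative H (at z) w = (\<Sum>b\<in>Basis. (w \<bullet> b) * frechet_derivative H (at z) b)" for w
    by (subst euclidean_representation[of w, symmetric]) (simp only: D.sum D.scaleR real_scaleR_def)
  show "h \<bullet> fst (hamiltonian_field H z) = frechet_derivative H (at z) (0, h)"
    unfolding hamiltonian_field_def rep[of "(0, h)"]
    by (simp add: fst_sum inner_sum_right inner_prod_def mult.commute)
  show "h \<bullet> snd (hamiltonian_field H z) = - frechet_derivative H (at z) (h, 0)"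
    unfolding hamiltonian_field_def rep[of "(h, 0)"]
    by (simp add: snd_sum inner_sum_right inner_prod_def mult.commute sum_negf)
qed

lemma hamiltonian_solution_if_field:
  assumes diff: "\<And>z. H differentiable (at z)"
    and sol: "\<And>t. t \<in> S \<Longrightarrow> (z has_vector_derivative hamiltonian_field H (z t)) (at t within S)"
  shows "hamiltonian_solution H S (\<lambda>t. fst (z t)) (\<lambda>t. snd (z t))"
  unfolding hamiltonian_solution_def
proof (intro ballI exI conjI)
  fix t assume t: "t \<in> S"
  let ?Y = "hamiltonian_field H (z t)"
  have d: "(H has_derivative frechet_derivative H (at (z t))) (at (z t))"
    using diff by (simp add: frechet_derivative_works)
  have "((\<lambda>p. H (fst (z t), p)) has_derivative (\<lambda>h. frechet_derivative H (at (z t)) (0, h))) (at (snd (z t)))"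
    by (rule has_derivative_compose[of "\<lambda>p. (fst (z t), p)" "\<lambda>h. (0, h)" _ _ H, simplified])
       (use d in \<open>auto intro!: derivative_eq_intros\<close>)
  then show "GDERIV (\<lambda>p. H (fst (z t), p)) (snd (z t)) :> fst ?Y"
    unfolding gderiv_def hamiltonian_field_inner[OF diff] .
  have "((\<lambda>q. H (q, snd (z t))) has_derivative (\<lambda>h. frechet_derivative H (at (z t)) (h, 0))) (at (fst (z t)))"
    by (rule has_derivative_compose[of "\<lambda>q. (q, snd (z t))" "\<lambda>h. (h, 0)" _ _ H, simplified])
       (use d in \<open>auto intro!: derivative_eq_intros\<close>)
  then show "GDERIV (\<lambda>q. H (q, snd (z t))) (fst (z t)) :> - snd ?Y"
    unfolding gderiv_def inner_minus_right hamiltonian_field_inner[OF diff] by simp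
  show "((\<lambda>t. fst (z t)) has_vector_derivative fst ?Y) (at t within S)"
    using sol[OF t] bounded_linear.has_vector_derivative[OF bounded_linear_fst] by blast
  show "((\<lambda>t. snd (z t)) has_vector_derivative - (- snd ?Y)) (at t within S)"
    using sol[OF t] bounded_linear.has_vector_derivative[OF bounded_linear_snd] by fastforce
qed

text \<open>
  The second derivatives of \<open>H\<close> are bounded on a box only. Evaluating the field at the nearest point of
  the box makes it globally Lipschitz; a solution that does not leave the box solves the original
  system. Bounds for the field on the box hold along the whole solution, and these bounds show
  directly that it stays inside.
\<close>

lemma clamped_hamiltonian_flow_exists:
  fixes H :: "(real ^ 'n::finite) \<times> (real ^ 'n) \<Rightarrow> real"
  assumes C2: "class_C (Suc (Suc 0)) H" and T: "T \<ge> 0" and ab: "cbox a b \<noteq> {}"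
  obtains z where "z 0 = z0"
    "\<And>t. t \<in> {0..T} \<Longrightarrow>
       (z has_vector_derivative hamiltonian_field H (clamp a b (z t))) (at t within {0..T})"
proof -
  have "\<exists>L>0. \<forall>x\<in>cbox a b. \<forall>y\<in>cbox a b. dist (frechet_derivative H (at x) e) (frechet_derivative H (at y) e) \<le> L * dist x y"
    if "e \<in> Basis" for e
  proof -
    have "class_C (Suc 0) (\<lambda>x. frechet_derivative H (at x) e)" using C2 that by simp
    then show ?thesis using class_C_1_lipschitz_on_cbox[of "\<lambda>x. frechet_derivative H (at x) e" a b] by metis
  qed
  then obtain L where L: "\<And>e. e \<in> Basis \<Longrightarrow> L e > 0"
    "\<And>e x y. e \<in> Basis \<Longrightarrow> x \<in> cbox a b \<Longrightarrow> y \<in> cbox a b \<Longrightarrow>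
       \<bar>frechet_derivative H (at x) e - frechet_derivative H (at y) e\<bar> \<le> L e * dist x y"
    unfolding dist_real_def by metis
  define M where "M = (\<Sum>e\<in>(Basis :: ((real ^ 'n) \<times> (real ^ 'n)) set). L e * norm (snd e, - fst e))"
  let ?X = "\<lambda>z. hamiltonian_field H (clamp a b z)"
  have M0: "M \<ge> 0" unfolding M_def using L(1) by (intro sum_nonneg) (auto simp: less_imp_le)
  have c: "clamp a b x \<in> cbox a b" for x using ab by (intro clamp_in_interval) (auto simp: box_ne_empty)
  have lip: "dist (?X x) (?X y) \<le> (M + 1) * dist x y" for x y
  proof -
    let ?x = "clamp a b x" and ?y = "clamp a b y"
    have "dist (?X x) (?X y) = norm (\<Sum>e\<in>Basis. (frechet_derivative H (at ?x) e - frechet_derivative H (at ?y) e) *\<^sub>R (snd e, - fst e))"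
      unfolding hamiltonian_field_def dist_norm by (simp only: sum_subtractf scaleR_diff_left)
    also have "\<dots> \<le> (\<Sum>e\<in>Basis. L e * dist x y * norm (snd e, - fst e))"
    proof (rule sum_norm_le)
      fix e :: "(real ^ 'n) \<times> (real ^ 'n)" assume e: "e \<in> Basis"
      have "\<bar>frechet_derivative H (at ?x) e - frechet_derivative H (at ?y) e\<bar> \<le> L e * dist ?x ?y"
        by (rule L(2)[OF e c c])
      also have "\<dots> \<le> L e * dist x y"
        using L(1)[OF e] by (intro mult_left_mono dist_clamps_le_dist_args) auto
      finally show "norm ((frechet_derivative H (at ?x) e - frechet_derivative H (at ?y) e) *\<^sub>R (snd e, - fst e))
          \<le> L e * dist x y * norm (snd e, - fst e)"
        unfolding norm_scaleR by (rule mult_right_mono) auto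
    qed
    also have "\<dots> = M * dist x y" unfolding M_def sum_distrib_right by (intro sum.cong) auto
    also have "\<dots> \<le> (M + 1) * dist x y" by (intro mult_right_mono) auto
    finally show ?thesis .
  qed
  obtain u where u: "u \<in> cbox a b" using ab by auto
  have bdd: "norm (?X x) \<le> norm (hamiltonian_field H u) + (M + 1) * diameter (cbox a b)" for x
  proof -
    have "dist (?X (clamp a b x)) (?X u) \<le> (M + 1) * dist (clamp a b x) u" by (rule lip)
    also have "\<dots> \<le> (M + 1) * diameter (cbox a b)"
      using M0 by (intro mult_left_mono diameter_bounded_bound c u) auto
    finally have "dist (?X x) (hamiltonian_field H u) \<le> (M + 1) * diameter (cbox a b)" using u c by simp
    then show ?thesis using norm_triangle_sub[of "?X x" "hamiltonian_field H u"] by (simp add: dist_norm)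
  qed
  show thesis
  proof (rule lipschitz_field_solution_exists[OF _ lip bdd T])
    show "M + 1 > 0" using M0 by simp
  qed (rule that)
qed

section \<open>Averaging along a nearly linear motion\<close>

lemma integral_shift_bound:
  fixes g :: "real \<Rightarrow> real"
  assumes cont: "continuous_on UNIV g" and B: "\<And>t. \<bar>g t\<bar> \<le> B" and T: "T \<ge> 0"
  shows "\<bar>integral {0..T} g - integral {0..T} (\<lambda>t. g (t + u))\<bar> \<le> 2 * B * \<bar>u\<bar>"
proof -
  let ?S = "{- \<bar>u\<bar>..T + \<bar>u\<bar>}"
  obtain G where G: "\<And>x. x \<in> ?S \<Longrightarrow> (G has_vector_derivative g x) (at x within ?S)"
    using antiderivative_continuous[OF continuous_on_subset[OF cont, of ?S]] by auto
  have "(g has_integral (G T - G 0)) {0..T}"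
    by (rule fundamental_theorem_of_calculus[OF T])
       (rule has_vector_derivative_within_subset[OF G], auto)
  moreover have "((\<lambda>t. g (t + u)) has_integral (G (T + u) - G (0 + u))) {0..T}"
  proof (rule fundamental_theorem_of_calculus[OF T])
    fix t assume t: "t \<in> {0..T}"
    have "(G has_vector_derivative g (t + u)) (at (t + u) within (\<lambda>t. t + u) ` {0..T})"
      by (rule has_vector_derivative_within_subset[OF G]) (use t in auto)
    then have "((G \<circ> (\<lambda>t. t + u)) has_vector_derivative 1 *\<^sub>R g (t + u)) (at t within {0..T})"
      by (intro vector_diff_chain_within) (auto intro!: derivative_eq_intros)
    then show "((\<lambda>t. G (t + u)) has_vector_derivative g (t + u)) (at t within {0..T})"
      by (simp add: o_def)
  qed
  moreover have lip: "\<bar>G x - G y\<bar> \<le> B * \<bar>x - y\<bar>" if "x \<in> ?S" "y \<in> ?S" for x y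
    using field_differentiable_bound[of ?S G g B x y] G B that
    by (auto simp: has_real_derivative_iff_has_vector_derivative)
  have "\<bar>G (T + u) - G T\<bar> \<le> B * \<bar>u\<bar>" "\<bar>G (0 + u) - G 0\<bar> \<le> B * \<bar>u\<bar>"
  proof -
    have "T + u \<in> ?S" "T \<in> ?S" "0 + u \<in> ?S" "0 \<in> ?S" using T by (auto simp: abs_if)
    then show "\<bar>G (T + u) - G T\<bar> \<le> B * \<bar>u\<bar>" "\<bar>G (0 + u) - G 0\<bar> \<le> B * \<bar>u\<bar>"
      using lip[of "T + u" T] lip[of "0 + u" 0] by simp_all
  qed
  ultimately show ?thesis by (simp only: integral_unique)
qed

text \<open>
  The value \<open>f(\<theta>(t) + x + u\<omega>)\<close> is compared with \<open>f(\<theta>(t + u))\<close>: the two points differ by \<open>O(\<bar>x\<bar> + K\<bar>u\<bar>)\<close>.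
  After \<open>h(t)\<close> is replaced by \<open>h(t + u)\<close>, the shift of the time variable costs two boundary pieces of
  length \<open>\<bar>u\<bar>\<close>.
\<close>

lemma trajectory_shift_bound:
  fixes f :: "real ^ 'n \<Rightarrow> real"
  assumes M: "\<And>\<theta>. \<bar>f \<theta>\<bar> \<le> M" and L: "L \<ge> 0" "\<And>x y. \<bar>f x - f y\<bar> \<le> L * norm (x - y)"
    and h: "\<And>t. \<bar>h t\<bar> \<le> H0" "\<And>s t. \<bar>h s - h t\<bar> \<le> H1 * \<bar>s - t\<bar>"
    and K: "\<And>s t. norm (\<theta> s - \<theta> t - (s - t) *\<^sub>R \<omega>) \<le> K * \<bar>s - t\<bar>" and T: "T \<ge> 0"
    and cont: "continuous_on UNIV f" "continuous_on UNIV h" "continuous_on UNIV \<theta>"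
  shows "\<bar>integral {0..T} (\<lambda>t. h t * (f (\<theta> t) - f (\<theta> t + x + u *\<^sub>R \<omega>)))\<bar>
    \<le> T * H0 * L * norm x + (T * H0 * L * K + T * M * H1 + 2 * H0 * M) * \<bar>u\<bar>"
proof -
  have H0: "H0 \<ge> 0" using h(1)[of 0] by linarith
  have M0: "M \<ge> 0" using M[of 0] by linarith
  have cf: "continuous_on S (\<lambda>t. f (p t))" if "continuous_on S p" for S :: "real set" and p
    by (rule continuous_on_compose2[OF cont(1) that]) auto
  have ch: "continuous_on S (\<lambda>t. h (p t))" if "continuous_on S p" for S :: "real set" and p
    by (rule continuous_on_compose2[OF cont(2) that]) auto
  have ct: "continuous_on S (\<lambda>t. \<theta> (p t))" if "continuous_on S p" for S :: "real set" and p
    by (rule continuous_on_compose2[OF cont(3) that]) auto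
  let ?g = "\<lambda>t. h t * f (\<theta> t)" and ?k = "\<lambda>t. h t * f (\<theta> t + x + u *\<^sub>R \<omega>)"
  have int: "?g integrable_on {0..T}" "(\<lambda>t. ?g (t + u)) integrable_on {0..T}" "?k integrable_on {0..T}"
    by (intro integrable_continuous_real continuous_intros cf ch ct cont continuous_on_subset[OF cont(2)] continuous_on_subset[OF cont(3)]; simp)+
  have "\<bar>integral {0..T} ?g - integral {0..T} (\<lambda>t. ?g (t + u))\<bar> \<le> 2 * (H0 * M) * \<bar>u\<bar>"
  proof (rule integral_shift_bound[OF _ _ T])
    show "continuous_on UNIV ?g" by (intro continuous_intros cf cont)
    show "\<bar>?g t\<bar> \<le> H0 * M" for t unfolding abs_mult using h M H0 by (intro mult_mono) auto
  qed
  moreover have "\<bar>integral {0..T} (\<lambda>t. ?g (t + u)) - integral {0..T} ?k\<bar>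
      \<le> T * (H1 * \<bar>u\<bar> * M + H0 * (L * (norm x + K * \<bar>u\<bar>)))"
  proof -
    have "norm (integral {0..T} (\<lambda>t. ?g (t + u) - ?k t)) \<le> integral {0..T} (\<lambda>_. H1 * \<bar>u\<bar> * M + H0 * (L * (norm x + K * \<bar>u\<bar>)))"
    proof (rule integral_norm_bound_integral)
      show "(\<lambda>t. ?g (t + u) - ?k t) integrable_on {0..T}" by (intro integrable_diff int)
      fix t
      have "?g (t + u) - ?k t = (h (t + u) - h t) * f (\<theta> (t + u)) + h t * (f (\<theta> (t + u)) - f (\<theta> t + x + u *\<^sub>R \<omega>))"
        by (simp add: algebra_simps)
      then have "\<bar>?g (t + u) - ?k t\<bar> \<le> \<bar>h (t + u) - h t\<bar> * \<bar>f (\<theta> (t + u))\<bar> + \<bar>h t\<bar> * \<bar>f (\<theta> (t + u)) - f (\<theta> t + x + u *\<^sub>R \<omega>)\<bar>"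
        by (simp only: abs_triangle_ineq flip: abs_mult)
      also have "\<dots> \<le> (H1 * \<bar>u\<bar>) * M + H0 * (L * (norm x + K * \<bar>u\<bar>))"
      proof (intro add_mono mult_mono)
        show "\<bar>h (t + u) - h t\<bar> \<le> H1 * \<bar>u\<bar>" using h(2)[of "t + u" t] by simp
        then show "0 \<le> H1 * \<bar>u\<bar>" by linarith
        have "\<theta> (t + u) - (\<theta> t + x + u *\<^sub>R \<omega>) = (\<theta> (t + u) - \<theta> t - (t + u - t) *\<^sub>R \<omega>) - x"
          by (simp add: algebra_simps)
        then have "norm (\<theta> (t + u) - (\<theta> t + x + u *\<^sub>R \<omega>)) \<le>
            norm (\<theta> (t + u) - \<theta> t - (t + u - t) *\<^sub>R \<omega>) + norm x"
          by (simp only: norm_triangle_ineq4)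
        also have "\<dots> \<le> K * \<bar>u\<bar> + norm x" using K[of "t + u" t] by simp
        finally have "norm (\<theta> (t + u) - (\<theta> t + x + u *\<^sub>R \<omega>)) \<le> K * \<bar>u\<bar> + norm x" .
        then have "L * norm (\<theta> (t + u) - (\<theta> t + x + u *\<^sub>R \<omega>)) \<le> L * (norm x + K * \<bar>u\<bar>)"
          using L(1) by (intro mult_left_mono) auto
        then show "\<bar>f (\<theta> (t + u)) - f (\<theta> t + x + u *\<^sub>R \<omega>)\<bar> \<le> L * (norm x + K * \<bar>u\<bar>)"
          using L(2)[of "\<theta> (t + u)" "\<theta> t + x + u *\<^sub>R \<omega>"] by linarith
      qed (use h M H0 M0 in auto)
      finally show "norm (?g (t + u) - ?k t) \<le> H1 * \<bar>u\<bar> * M + H0 * (L * (norm x + K * \<bar>u\<bar>))" by simp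
    qed (rule integrable_continuous_real, rule continuous_on_const)
    then show ?thesis using T
      by (simp add: Henstock_Kurzweil_Integration.integral_diff[OF int(2,3)])
  qed
  moreover have "integral {0..T} (\<lambda>t. h t * (f (\<theta> t) - f (\<theta> t + x + u *\<^sub>R \<omega>))) = integral {0..T} ?g - integral {0..T} ?k"
    using Henstock_Kurzweil_Integration.integral_diff[OF int(1,3)] by (simp add: algebra_simps)
  ultimately have "\<bar>integral {0..T} (\<lambda>t. h t * (f (\<theta> t) - f (\<theta> t + x + u *\<^sub>R \<omega>)))\<bar> \<le>
    2 * (H0 * M) * \<bar>u\<bar> + T * (H1 * \<bar>u\<bar> * M + H0 * (L * (norm x + K * \<bar>u\<bar>)))" by linarith
  then show ?thesis by (simp add: algebra_simps)
qed

text \<open>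
  Fubini's theorem writes the left-hand side as the expectation, over the averaging measure, of the
  integrals bounded in \<open>trajectory_shift_bound\<close>. In the bound only the boundary term
  \<open>2 H0 M b\<close> is not proportional to the length of the time interval.
\<close>

lemma averaging_along_trajectory:
  fixes f :: "(real, 'n::{finite,linorder}) vec \<Rightarrow> real"
  assumes \<rho>: "averaging_measure d \<omega> a b \<rho>" and per: "torus_periodic f"
    and M: "\<And>\<theta>. \<bar>f \<theta>\<bar> \<le> M" and L: "L \<ge> 0" "\<And>x y. \<bar>f x - f y\<bar> \<le> L * norm (x - y)"
    and h: "\<And>t. \<bar>h t\<bar> \<le> H0" "\<And>s t. \<bar>h s - h t\<bar> \<le> H1 * \<bar>s - t\<bar>"
    and K: "\<And>s t. norm (\<theta> s - \<theta> t - (s - t) *\<^sub>R \<omega>) \<le> K * \<bar>s - t\<bar>" and T: "T \<ge> 0"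
  shows "\<bar>integral {0..T} (\<lambda>t. h t * (f (\<theta> t) - torus_average d f (\<theta> t)))\<bar>
    \<le> T * H0 * L * a + (T * H0 * L * K + T * M * H1 + 2 * H0 * M) * b"
    and "(\<lambda>t. h t * (f (\<theta> t) - torus_average d f (\<theta> t))) integrable_on {0..T}"
proof -
  have H0: "H0 \<ge> 0" using h(1)[of 0] by linarith
  have H1: "H1 \<ge> 0" using h(2)[of 1 0] abs_ge_zero[of "h 1 - h 0"] by simp
  have K0: "K \<ge> 0" using order_trans[OF norm_ge_zero K[of 1 0]] by simp
  have M0: "M \<ge> 0" using M[of 0] by linarith
  have lip_cont: "continuous_on UNIV g" if "B \<ge> 0" "\<And>x y. norm (g x - g y) \<le> B * norm (x - y)"
    for g :: "'a::real_normed_vector \<Rightarrow> 'b::real_normed_vector" and B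
    by (rule lipschitz_on_continuous_on[of B]) (use that in \<open>auto intro!: lipschitz_onI simp: dist_norm\<close>)
  have cont: "continuous_on UNIV f" "continuous_on UNIV h"
    using lip_cont[of L f] lip_cont[of H1 h] L h(2) H1 by auto
  have ct: "continuous_on UNIV \<theta>"
  proof (rule lip_cont[of "K + norm \<omega>"])
    fix s t :: real
    have "norm (\<theta> s - \<theta> t) \<le> norm (\<theta> s - \<theta> t - (s - t) *\<^sub>R \<omega>) + norm ((s - t) *\<^sub>R \<omega>)"
      using norm_triangle_ineq[of "\<theta> s - \<theta> t - (s - t) *\<^sub>R \<omega>" "(s - t) *\<^sub>R \<omega>"] by simp
    also have "\<dots> \<le> K * \<bar>s - t\<bar> + \<bar>s - t\<bar> * norm \<omega>" using K[of s t] by simp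
    finally show "norm (\<theta> s - \<theta> t) \<le> (K + norm \<omega>) * norm (s - t)" by (simp add: algebra_simps)
  qed (use K0 in auto)
  interpret \<rho>: prob_space \<rho> using \<rho> by (simp add: averaging_measure_def)
  have sets: "sets \<rho> = sets borel" and int: "integrable \<rho> (\<lambda>z. norm (fst z))" "integrable \<rho> (\<lambda>z. \<bar>snd z\<bar>)"
    and bd: "(\<integral>z. norm (fst z) \<partial>\<rho>) \<le> a" "(\<integral>z. \<bar>snd z\<bar> \<partial>\<rho>) \<le> b"
    and avg: "\<And>\<theta>. torus_average d f \<theta> = (\<integral>z. f (\<theta> + fst z + snd z *\<^sub>R \<omega>) \<partial>\<rho>)"
    using \<rho> cont per by (auto simp: averaging_measure_def)
  let ?I = "restrict_space lborel {0..T}"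
  have finI: "finite_measure ?I"
    by (rule finite_measureI) (simp add: emeasure_restrict_space space_restrict_space T)
  interpret I: finite_measure ?I by (rule finI)
  interpret P: pair_sigma_finite \<rho> ?I by standard
  interpret PF: finite_measure "\<rho> \<Otimes>\<^sub>M ?I"
    by (rule finite_measure_pair_measure[OF finI]) (rule \<rho>.finite_measure_axioms)
  let ?p = "\<lambda>z t. h t * (f (\<theta> t) - f (\<theta> t + fst z + snd z *\<^sub>R \<omega>))"
  have "continuous_on UNIV (\<lambda>(z, t). ?p z t)"
    unfolding split_def
    by (intro continuous_intros continuous_on_compose2[OF cont(1)] continuous_on_compose2[OF cont(2)]
        continuous_on_compose2[OF ct]) auto
  then have "(\<lambda>(z, t). ?p z t) \<in> borel_measurable (borel \<Otimes>\<^sub>M borel)"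
    unfolding borel_prod by (rule borel_measurable_continuous_onI)
  moreover have "(\<lambda>q. q) \<in> measurable (\<rho> \<Otimes>\<^sub>M ?I) (borel \<Otimes>\<^sub>M borel)"
  proof -
    have "fst \<in> measurable (\<rho> \<Otimes>\<^sub>M ?I) borel"
      using measurable_fst[of \<rho> ?I] measurable_cong_sets[OF refl sets] by blast
    moreover have "snd \<in> measurable (\<rho> \<Otimes>\<^sub>M ?I) borel"
      by (rule measurable_compose[OF measurable_snd]) (auto intro: measurable_restrict_space1)
    ultimately show ?thesis by (subst measurable_pair_iff) (simp add: o_def)
  qed
  ultimately have pm: "(\<lambda>(z, t). ?p z t) \<in> borel_measurable (\<rho> \<Otimes>\<^sub>M ?I)"
    by (rule measurable_compose[rotated])
  have pint: "integrable (\<rho> \<Otimes>\<^sub>M ?I) (\<lambda>(z, t). ?p z t)"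
  proof (rule PF.integrable_const_bound[OF _ pm, of "H0 * (M + M)"], rule AE_I2)
    fix q
    have "\<bar>?p (fst q) (snd q)\<bar> \<le> H0 * (M + M)" unfolding abs_mult
      by (intro mult_mono order_trans[OF abs_triangle_ineq4] add_mono h M H0) auto
    then show "norm (case q of (z, t) \<Rightarrow> ?p z t) \<le> H0 * (M + M)" by (simp add: split_def)
  qed
  have fi: "integrable \<rho> (\<lambda>z. f (v + fst z + snd z *\<^sub>R \<omega>))" for v
  proof (rule \<rho>.integrable_const_bound[of _ M])
    have "continuous_on UNIV (\<lambda>z. f (v + fst z + snd z *\<^sub>R \<omega>))"
      by (intro continuous_on_compose2[OF cont(1)] continuous_intros) auto
    then show "(\<lambda>z. f (v + fst z + snd z *\<^sub>R \<omega>)) \<in> borel_measurable \<rho>"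
      using measurable_cong_sets[OF sets refl] borel_measurable_continuous_onI by blast
  qed (use M in auto)
  have inner: "(\<integral>z. ?p z t \<partial>\<rho>) = h t * (f (\<theta> t) - torus_average d f (\<theta> t))" for t
    using fi by (simp add: avg \<rho>.prob_space)
  have Iset: "{0..T} \<inter> space lborel \<in> sets lborel" by simp
  have si: "set_integrable lborel {0..T} (\<lambda>t. h t * (f (\<theta> t) - torus_average d f (\<theta> t)))"
    using P.integrable_snd[OF pint] unfolding inner set_integrable_def
    by (subst (asm) integrable_restrict_space[OF Iset])
  from set_borel_integral_eq_integral(1)[OF si]
  show "(\<lambda>t. h t * (f (\<theta> t) - torus_average d f (\<theta> t))) integrable_on {0..T}" .
  have tint: "(\<integral>t. ?p z t \<partial>?I) = integral {0..T} (?p z)" for z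
  proof -
    have "set_integrable lborel {0..T} (?p z)"
      by (rule borel_integrable_atLeastAtMost')
         (intro continuous_intros continuous_on_compose2[OF cont(1)] continuous_on_compose2[OF ct]
           continuous_on_subset[OF cont(2)]; simp)
    then show ?thesis
      using set_borel_integral_eq_integral(2) unfolding set_lebesgue_integral_def
      by (subst integral_restrict_space[OF Iset]) blast
  qed
  have eq: "integral {0..T} (\<lambda>t. h t * (f (\<theta> t) - torus_average d f (\<theta> t))) = (\<integral>z. integral {0..T} (?p z) \<partial>\<rho>)"
  proof -
    have "integral {0..T} (\<lambda>t. h t * (f (\<theta> t) - torus_average d f (\<theta> t))) = (\<integral>t. (\<integral>z. ?p z t \<partial>\<rho>) \<partial>?I)"
      unfolding inner set_borel_integral_eq_integral(2)[OF si, symmetric] set_lebesgue_integral_def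
      by (subst integral_restrict_space[OF Iset]) simp
    also have "\<dots> = (\<integral>z. (\<integral>t. ?p z t \<partial>?I) \<partial>\<rho>)" by (rule P.Fubini_integral[OF pint])
    finally show ?thesis by (simp only: tint)
  qed
  let ?C = "T * H0 * L" and ?D = "T * H0 * L * K + T * M * H1 + 2 * H0 * M"
  have "\<bar>\<integral>z. integral {0..T} (?p z) \<partial>\<rho>\<bar> \<le> (\<integral>z. \<bar>integral {0..T} (?p z)\<bar> \<partial>\<rho>)"
    by (rule integral_abs_bound)
  also have "\<dots> \<le> (\<integral>z. ?C * norm (fst z) + ?D * \<bar>snd z\<bar> \<partial>\<rho>)"
  proof (rule integral_mono)
    show "integrable \<rho> (\<lambda>z. \<bar>integral {0..T} (?p z)\<bar>)"
      using P.integrable_fst'[OF pint] unfolding split_conv tint by (rule integrable_abs)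
    show "integrable \<rho> (\<lambda>z. ?C * norm (fst z) + ?D * \<bar>snd z\<bar>)" using int by auto
    show "\<bar>integral {0..T} (?p z)\<bar> \<le> ?C * norm (fst z) + ?D * \<bar>snd z\<bar>" for z
      by (rule trajectory_shift_bound[OF M L h K T cont ct])
  qed
  also have "\<dots> = ?C * (\<integral>z. norm (fst z) \<partial>\<rho>) + ?D * (\<integral>z. \<bar>snd z\<bar> \<partial>\<rho>)"
    using int by simp
  also have "\<dots> \<le> ?C * a + ?D * b"
    using bd T H0 H1 M0 K0 L(1) by (intro add_mono mult_left_mono) auto
  finally show "\<bar>integral {0..T} (\<lambda>t. h t * (f (\<theta> t) - torus_average d f (\<theta> t)))\<bar> \<le> ?C * a + ?D * b"
    unfolding eq .
qed

section \<open>Derivatives of fast averages\<close>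

lemma integrable_fast_cube:
  fixes f :: "(real, 'n::{finite,linorder}) vec \<Rightarrow> 'b::euclidean_space"
  assumes "continuous_on UNIV f" "\<And>\<theta>. norm (f \<theta>) \<le> M"
  shows "integrable (fast_cube d) (\<lambda>\<phi>. f (set_fast d \<theta> \<phi>))"
proof -
  interpret prob_space "fast_cube d :: ('n \<Rightarrow> real) measure" by (rule prob_space_fast_cube)
  show ?thesis
    using measurable_compose[OF set_fast_measurable borel_measurable_continuous_onI[OF assms(1)]] assms(2)
    by (intro integrable_const_bound[of _ M]) auto
qed

lemma torus_average_component:
  fixes A :: "(real, 'n::{finite,linorder}) vec \<Rightarrow> ((real, 'n) vec, 'n) vec"
  assumes "continuous_on UNIV A" "\<And>\<theta>. norm (A \<theta>) \<le> M"
  shows "torus_average d A \<theta> $ a $ b = torus_average d (\<lambda>\<theta>. A \<theta> $ a $ b) \<theta>"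
proof -
  have "bounded_linear (\<lambda>m :: ((real, 'n) vec, 'n) vec. m $ a $ b)"
    by (intro bounded_linear_compose[OF bounded_linear_vec_nth bounded_linear_vec_nth])
  from integral_bounded_linear[OF this integrable_fast_cube[OF assms]]
  show ?thesis unfolding torus_average_eq_integral_fast_cube by simp
qed

lemma torus_average_bound:
  fixes f :: "(real, 'n::{finite,linorder}) vec \<Rightarrow> real"
  assumes "continuous_on UNIV f" "\<And>\<theta>. \<bar>f \<theta>\<bar> \<le> M"
  shows "\<bar>torus_average d f \<theta>\<bar> \<le> M"
proof -
  interpret prob_space "fast_cube d :: ('n \<Rightarrow> real) measure" by (rule prob_space_fast_cube)
  have int: "integrable (fast_cube d) (\<lambda>\<phi>. f (set_fast d \<theta> \<phi>))"
    by (rule integrable_fast_cube) (use assms in auto)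
  have "\<bar>\<integral>\<phi>. f (set_fast d \<theta> \<phi>) \<partial>fast_cube d\<bar> \<le> (\<integral>\<phi>. \<bar>f (set_fast d \<theta> \<phi>)\<bar> \<partial>fast_cube d)"
    by (rule integral_abs_bound)
  also have "\<dots> \<le> (\<integral>\<phi>. M \<partial>(fast_cube d :: ('n \<Rightarrow> real) measure))"
    by (rule integral_mono) (use int assms in auto)
  finally show ?thesis by (simp add: torus_average_eq_integral_fast_cube prob_space)
qed

lemma torus_average_lipschitz_slow:
  fixes f :: "(real, 'n::{finite,linorder}) vec \<Rightarrow> real"
  assumes cont: "continuous_on UNIV f" and M: "\<And>\<theta>. \<bar>f \<theta>\<bar> \<le> M"
    and L: "\<And>x y. \<bar>f x - f y\<bar> \<le> L * norm (x - y)"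
  shows "\<bar>torus_average d f \<theta> - torus_average d f \<theta>'\<bar>
    \<le> L * norm (\<chi> j. if j \<in> fast d then 0 else \<theta> $ j - \<theta>' $ j)"
proof -
  interpret prob_space "fast_cube d :: ('n \<Rightarrow> real) measure" by (rule prob_space_fast_cube)
  let ?r = "L * norm (\<chi> j. if j \<in> fast d then 0 else \<theta> $ j - \<theta>' $ j)"
  have int: "integrable (fast_cube d) (\<lambda>\<phi>. f (set_fast d v \<phi>))" for v
    by (rule integrable_fast_cube) (use assms in auto)
  have pt: "\<bar>f (set_fast d \<theta> \<phi>) - f (set_fast d \<theta>' \<phi>)\<bar> \<le> ?r" for \<phi>
  proof -
    have "set_fast d \<theta> \<phi> - set_fast d \<theta>' \<phi> = (\<chi> j. if j \<in> fast d then 0 else \<theta> $ j - \<theta>' $ j)"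
      by (simp add: set_fast_def vec_eq_iff)
    then show ?thesis using L[of "set_fast d \<theta> \<phi>" "set_fast d \<theta>' \<phi>"] by simp
  qed
  have "\<bar>\<integral>\<phi>. f (set_fast d \<theta> \<phi>) - f (set_fast d \<theta>' \<phi>) \<partial>fast_cube d\<bar>
      \<le> (\<integral>\<phi>. \<bar>f (set_fast d \<theta> \<phi>) - f (set_fast d \<theta>' \<phi>)\<bar> \<partial>fast_cube d)"
    by (rule integral_abs_bound)
  also have "\<dots> \<le> (\<integral>\<phi>. ?r \<partial>(fast_cube d :: ('n \<Rightarrow> real) measure))"
    by (rule integral_mono) (use int pt in auto)
  finally show ?thesis using int by (simp add: torus_average_eq_integral_fast_cube prob_space)
qed

lemma first_order_taylor_bound:
  fixes f g :: "'a::real_normed_vector \<Rightarrow> real"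
  assumes der: "\<And>\<theta>. ((\<lambda>s. f (\<theta> + s *\<^sub>R v)) has_real_derivative g \<theta>) (at 0)"
    and lip: "\<And>x y. \<bar>g x - g y\<bar> \<le> L * norm (x - y)" and L: "L \<ge> 0"
  shows "\<bar>f (\<theta> + s *\<^sub>R v) - f \<theta> - s * g \<theta>\<bar> \<le> L * norm v * s\<^sup>2"
proof -
  have d: "((\<lambda>r. f (\<theta> + r *\<^sub>R v) - r * g \<theta>) has_field_derivative g (\<theta> + r *\<^sub>R v) - g \<theta>) (at r within S)" for r S
  proof -
    have "((\<lambda>s. f (\<theta> + (s + r) *\<^sub>R v)) has_real_derivative g (\<theta> + r *\<^sub>R v)) (at 0)"
      using der[of "\<theta> + r *\<^sub>R v"] by (simp add: algebra_simps)
    then have "((\<lambda>s. f (\<theta> + s *\<^sub>R v)) has_real_derivative g (\<theta> + r *\<^sub>R v)) (at r)"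
      using DERIV_shift[of "\<lambda>s. f (\<theta> + s *\<^sub>R v)" _ 0 r] by simp
    then show ?thesis by (intro derivative_eq_intros) (auto intro: DERIV_subset)
  qed
  have "norm ((f (\<theta> + s *\<^sub>R v) - s * g \<theta>) - (f (\<theta> + 0 *\<^sub>R v) - 0 * g \<theta>)) \<le> L * (\<bar>s\<bar> * norm v) * norm (s - 0)"
  proof (rule field_differentiable_bound[OF _ d])
    fix r assume r: "r \<in> closed_segment 0 s"
    then have "\<bar>r\<bar> \<le> \<bar>s\<bar>" by (auto simp: closed_segment_eq_real_ivl split: if_splits)
    then have "L * norm (r *\<^sub>R v) \<le> L * (\<bar>s\<bar> * norm v)"
      using L by (auto intro!: mult_left_mono mult_right_mono)
    then show "norm (g (\<theta> + r *\<^sub>R v) - g \<theta>) \<le> L * (\<bar>s\<bar> * norm v)"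
      using lip[of "\<theta> + r *\<^sub>R v" \<theta>] by simp
  qed auto
  then show ?thesis by (simp add: power2_eq_square algebra_simps)
qed

text \<open>
  Differentiation under the integral sign, done with the averaging measure instead of the cube. In
  this form the direction \<open>v\<close> may also be fast: the translation by \<open>s v\<close> is visible inside the
  expectation although the average does not depend on the fast angles.
\<close>

lemma torus_average_has_derivative:
  fixes f g :: "(real, 'n::{finite,linorder}) vec \<Rightarrow> real" and \<omega> :: "(real, 'n) vec"
  assumes \<rho>: "averaging_measure d \<omega> a b \<rho>"
    and f: "continuous_on UNIV f" "torus_periodic f" "\<And>\<theta>. \<bar>f \<theta>\<bar> \<le> M"
    and g: "continuous_on UNIV g" "torus_periodic g" "\<And>\<theta>. \<bar>g \<theta>\<bar> \<le> M'"
    and der: "\<And>\<theta>. ((\<lambda>s. f (\<theta> + s *\<^sub>R v)) has_real_derivative g \<theta>) (at 0)"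
    and lip: "\<And>x y. \<bar>g x - g y\<bar> \<le> L * norm (x - y)" "L \<ge> 0"
  shows "((\<lambda>s. torus_average d f (\<theta> + s *\<^sub>R v)) has_real_derivative torus_average d g \<theta>) (at 0)"
proof -
  interpret prob_space \<rho> using \<rho> by (simp add: averaging_measure_def)
  have sets: "sets \<rho> = sets borel" using \<rho> by (simp add: averaging_measure_def)
  have avg: "torus_average d u \<theta> = (\<integral>z. u (\<theta> + fst z + snd z *\<^sub>R \<omega>) \<partial>\<rho>)"
    if "continuous_on UNIV u" "torus_periodic u" for u :: "(real, 'n) vec \<Rightarrow> real" and \<theta>
    using \<rho> that by (auto simp: averaging_measure_def)
  have int: "integrable \<rho> (\<lambda>z. u (\<theta> + fst z + snd z *\<^sub>R \<omega>))"
    if "continuous_on UNIV u" "\<And>\<theta>. \<bar>u \<theta>\<bar> \<le> B" for u :: "(real, 'n) vec \<Rightarrow> real" and B \<theta>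
  proof (rule integrable_const_bound[of _ B])
    have "continuous_on UNIV (\<lambda>z. u (\<theta> + fst z + snd z *\<^sub>R \<omega>))"
      by (intro continuous_on_compose2[OF that(1)] continuous_intros) auto
    then show "(\<lambda>z. u (\<theta> + fst z + snd z *\<^sub>R \<omega>)) \<in> borel_measurable \<rho>"
      using measurable_cong_sets[OF sets refl] borel_measurable_continuous_onI by blast
  qed (use that in auto)
  let ?F = "\<lambda>s. torus_average d f (\<theta> + s *\<^sub>R v)" and ?D = "torus_average d g \<theta>"
  have bd: "\<bar>?F s - ?F 0 - s * ?D\<bar> \<le> L * norm v * s\<^sup>2" for s
  proof -
    let ?q = "\<lambda>z. \<theta> + fst z + snd z *\<^sub>R \<omega>"
    have shift: "\<theta> + s *\<^sub>R v + fst z + snd z *\<^sub>R \<omega> = ?q z + s *\<^sub>R v" for z by simp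
    have i: "integrable \<rho> (\<lambda>z. f (?q z + s *\<^sub>R v))" "integrable \<rho> (\<lambda>z. f (?q z))" "integrable \<rho> (\<lambda>z. g (?q z))"
      using int[OF f(1,3), of "\<theta> + s *\<^sub>R v"] int[OF f(1,3), of \<theta>] int[OF g(1,3), of \<theta>] by (simp_all only: shift)
    have eq: "?F s - ?F 0 - s * ?D = (\<integral>z. f (?q z + s *\<^sub>R v) - f (?q z) - s * g (?q z) \<partial>\<rho>)"
      using i by (simp add: avg[OF f(1,2)] avg[OF g(1,2)] shift)
    have "\<bar>?F s - ?F 0 - s * ?D\<bar> \<le> (\<integral>z. \<bar>f (?q z + s *\<^sub>R v) - f (?q z) - s * g (?q z)\<bar> \<partial>\<rho>)"
      unfolding eq by (rule integral_abs_bound)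
    also have "\<dots> \<le> (\<integral>z. L * norm v * s\<^sup>2 \<partial>\<rho>)"
    proof (rule integral_mono)
      show "integrable \<rho> (\<lambda>z. \<bar>f (?q z + s *\<^sub>R v) - f (?q z) - s * g (?q z)\<bar>)"
        by (intro integrable_abs Bochner_Integration.integrable_diff integrable_mult_right i)
      show "\<bar>f (?q z + s *\<^sub>R v) - f (?q z) - s * g (?q z)\<bar> \<le> L * norm v * s\<^sup>2" for z
        by (rule first_order_taylor_bound[OF der lip])
    qed simp
    finally show ?thesis by (simp add: prob_space)
  qed
  have "((\<lambda>s. (?F (0 + s) - ?F 0) / s) \<longlongrightarrow> ?D) (at 0)"
  proof (rule LIM_zero_cancel, rule Lim_null_comparison)
    show "\<forall>\<^sub>F s in at 0. norm ((?F (0 + s) - ?F 0) / s - ?D) \<le> L * norm v * \<bar>s\<bar>"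
      unfolding eventually_at_filter
    proof (rule always_eventually, intro allI impI)
      fix s :: real assume s: "s \<noteq> 0"
      have "(?F (0 + s) - ?F 0) / s - ?D = (?F s - ?F 0 - s * ?D) / s" using s by (simp add: field_simps)
      then have "norm ((?F (0 + s) - ?F 0) / s - ?D) = \<bar>?F s - ?F 0 - s * ?D\<bar> / \<bar>s\<bar>" by (simp add: abs_divide)
      also have "\<dots> \<le> (L * norm v * s\<^sup>2) / \<bar>s\<bar>" by (intro divide_right_mono bd) auto
      also have "\<dots> = L * norm v * \<bar>s\<bar>" using s by (simp add: power2_eq_square abs_if)
      finally show "norm ((?F (0 + s) - ?F 0) / s - ?D) \<le> L * norm v * \<bar>s\<bar>" .
    qed
    show "((\<lambda>s. L * norm v * \<bar>s\<bar>) \<longlongrightarrow> 0) (at 0)" by (auto intro!: tendsto_eq_intros)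
  qed
  then show ?thesis by (simp add: DERIV_def)
qed

text \<open>
  Combined with \<open>torus_average_has_derivative\<close> this says that the derivative of a function in a fast
  direction has average \<open>0\<close>.
\<close>

lemma torus_average_fast_derivative_eq_0:
  fixes f g :: "(real, 'n::{finite,linorder}) vec \<Rightarrow> real"
  assumes "((\<lambda>s. torus_average d f (\<theta> + s *\<^sub>R axis j 1)) has_real_derivative D) (at 0)"
    and j: "j \<in> fast d"
  shows "D = 0"
proof -
  have "set_fast d (\<theta> + s *\<^sub>R axis j 1) \<phi> = set_fast d \<theta> \<phi>" for s \<phi>
    using j by (auto simp: set_fast_def vec_eq_iff axis_def)
  then have "(\<lambda>s. torus_average d f (\<theta> + s *\<^sub>R axis j 1)) = (\<lambda>s. torus_average d f \<theta>)"
    by (simp add: torus_average_eq_integral_fast_cube)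
  with assms(1) show ?thesis using DERIV_unique[OF _ DERIV_const] by metis
qed

lemma C_norm_bound:
  assumes "C_norm l S f \<le> ereal C" "set bs \<subseteq> Basis" "length bs \<le> l" "x \<in> S"
  shows "infnorm (iterated_partial bs f x) \<le> C"
proof -
  have "ereal (infnorm (iterated_partial bs f x)) \<le> (SUP x\<in>S. ereal (infnorm (iterated_partial bs f x)))"
    using assms(4) by (rule SUP_upper)
  also have "\<dots> \<le> C_norm l S f" unfolding C_norm_def
    by (rule SUP_upper) (use assms in auto)
  also have "\<dots> \<le> ereal C" by fact
  finally show ?thesis by simp
qed

lemma class_C_mono: "class_C k f \<Longrightarrow> l \<le> k \<Longrightarrow> class_C l f"
proof (induction l arbitrary: k f)
  case 0
  then show ?case
    by (cases k) (auto intro!: differentiable_imp_continuous_on simp: differentiable_on_def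
        intro: differentiable_at_withinI)
next
  case (Suc l)
  then obtain k' where "k = Suc k'" "l \<le> k'" by (cases k) auto
  with Suc show ?case by auto
qed

lemma abs_matrix_entry_le_infnorm:
  fixes m :: "((real, 'n::finite) vec, 'n) vec"
  shows "\<bar>m $ a $ b\<bar> \<le> infnorm m"
proof -
  have "axis a (axis b 1) \<in> (Basis :: ((real, 'n) vec, 'n) vec set)"
    by (auto simp: Basis_vec_def)
  from Basis_le_infnorm[OF this, of m] show ?thesis by (simp add: inner_axis)
qed

lemma torus_periodic_frechet_derivative:
  fixes f :: "(real, 'n::finite) vec \<Rightarrow> 'b::real_normed_vector"
  assumes "torus_periodic f"
  shows "torus_periodic (\<lambda>\<theta>. frechet_derivative f (at \<theta>) v)"
  unfolding torus_periodic_def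
proof (intro allI)
  fix \<theta> and k :: "'n \<Rightarrow> int"
  let ?k = "\<chi> j. real_of_int (k j)"
  have shift: "(f has_derivative D) (at x)" if "(f has_derivative D) (at (x + c))" "\<And>y. f (y + c) = f y" for x c D
  proof -
    have "((\<lambda>x. x + c) has_derivative (\<lambda>h. h)) (at x)" by (auto intro!: derivative_eq_intros)
    from has_derivative_compose[OF this that(1)] that(2) show ?thesis by simp
  qed
  have per: "f (y + ?k) = f y" "f (y + - ?k) = f y" for y
    using assms[unfolded torus_periodic_def, rule_format, of y k]
      assms[unfolded torus_periodic_def, rule_format, of "y + - ?k" k] by simp_all
  have "(f has_derivative D) (at (\<theta> + ?k)) \<longleftrightarrow> (f has_derivative D) (at \<theta>)" for D
    using shift[of D \<theta> ?k] shift[of D "\<theta> + ?k" "- ?k"] per by (auto simp: add.assoc)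
  then show "frechet_derivative f (at (\<theta> + ?k)) v = frechet_derivative f (at \<theta>) v"
    by (simp add: frechet_derivative_def)
qed

text \<open>
  The averaging argument concerns real functions; it is applied to these entries of \<open>\<partial>\<^sub>j A\<close>.
\<close>

definition entry_partial ::
  "(real ^ 'n \<Rightarrow> real ^ 'm ^ 'k) \<Rightarrow> 'n \<Rightarrow> 'k \<Rightarrow> 'm \<Rightarrow> real ^ 'n \<Rightarrow> real" where
  "entry_partial A j a b \<theta> = frechet_derivative A (at \<theta>) (axis j 1) $ a $ b"

lemma bounded_linear_matrix_entry: "bounded_linear (\<lambda>m :: real ^ 'm::finite ^ 'k::finite. m $ a $ b)"
  by (intro bounded_linear_compose[OF bounded_linear_vec_nth bounded_linear_vec_nth])

lemma axis_1_in_Basis [simp]: "axis j (1 :: real) \<in> Basis"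
  by (auto simp: Basis_vec_def)

lemma
  fixes A :: "real ^ 'n::finite \<Rightarrow> real ^ 'n ^ 'n" and C :: real
  assumes C2: "class_C (Suc (Suc 0)) A" and C1: "C_norm (Suc (Suc 0)) UNIV A \<le> ereal C"
    and per: "torus_periodic A"
  shows matrix_entry_continuous: "continuous_on UNIV (\<lambda>\<theta>. A \<theta> $ a $ b)"
    and matrix_entry_bound: "\<bar>A \<theta> $ a $ b\<bar> \<le> C"
    and matrix_entry_periodic: "torus_periodic (\<lambda>\<theta>. A \<theta> $ a $ b)"
    and entry_partial_continuous: "continuous_on UNIV (entry_partial A j a b)"
    and entry_partial_bound: "\<bar>entry_partial A j a b \<theta>\<bar> \<le> C"
    and entry_partial_periodic: "torus_periodic (entry_partial A j a b)"
    and entry_partial_lipschitz: "\<bar>entry_partial A j a b x - entry_partial A j a b y\<bar> \<le> real CARD('n) * C * norm (x - y)"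
    and entry_partial_derivative: "((\<lambda>s. A (\<theta> + s *\<^sub>R axis j 1) $ a $ b) has_real_derivative entry_partial A j a b \<theta>) (at 0)"
proof -
  have diff: "A differentiable (at x)" for x using C2 by simp
  let ?A' = "\<lambda>x. frechet_derivative A (at x) (axis j 1)"
  have C1': "class_C (Suc 0) ?A'" using C2 by simp
  have diff': "?A' differentiable (at x)" for x using C1' by simp
  have cont: "continuous_on UNIV A" "continuous_on UNIV ?A'"
    using class_C_mono[OF C2, of 0] class_C_mono[OF C1', of 0] by auto
  note bl = bounded_linear_matrix_entry[where ?'m = 'n and ?'k = 'n, of a b]
  show "continuous_on UNIV (\<lambda>\<theta>. A \<theta> $ a $ b)" "continuous_on UNIV (entry_partial A j a b)"
    unfolding entry_partial_def[abs_def] by (rule bounded_linear.continuous_on[OF bl]; rule cont)+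
  show "\<bar>A \<theta> $ a $ b\<bar> \<le> C"
    using abs_matrix_entry_le_infnorm[of "A \<theta>" a b] C_norm_bound[OF C1, of "[]" \<theta>] by simp
  show "\<bar>entry_partial A j a b \<theta>\<bar> \<le> C"
    using abs_matrix_entry_le_infnorm[of "?A' \<theta>" a b] C_norm_bound[OF C1, of "[axis j 1]" \<theta>]
    by (simp add: entry_partial_def)
  show "torus_periodic (\<lambda>\<theta>. A \<theta> $ a $ b)" using per by (simp add: torus_periodic_def)
  show "torus_periodic (entry_partial A j a b)"
    using torus_periodic_frechet_derivative[OF per, of "axis j 1"] by (simp add: torus_periodic_def entry_partial_def)
  have d2: "((\<lambda>x. ?A' x $ a $ b) has_derivative (\<lambda>h. frechet_derivative ?A' (at x) h $ a $ b)) (at x)" for x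
    using bounded_linear.has_derivative[OF bl] diff'[of x] frechet_derivative_works by blast
  have "norm (entry_partial A j a b x - entry_partial A j a b y) \<le> real DIM(real ^ 'n) * C * norm (x - y)"
  proof (rule lipschitz_if_partials_bounded[of UNIV])
    show "entry_partial A j a b differentiable at x" for x
      using d2[of x] unfolding entry_partial_def[abs_def] differentiable_def by blast
    fix x and e :: "real ^ 'n" assume e: "e \<in> Basis"
    have "frechet_derivative (entry_partial A j a b) (at x) = (\<lambda>h. frechet_derivative ?A' (at x) h $ a $ b)"
      using frechet_derivative_at[OF d2[of x]] by (simp add: entry_partial_def[abs_def])
    then show "norm (frechet_derivative (entry_partial A j a b) (at x) e) \<le> C"
      using abs_matrix_entry_le_infnorm[of "frechet_derivative ?A' (at x) e" a b]
        C_norm_bound[OF C1, of "[axis j 1, e]" x] e by simp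
  qed auto
  then show "\<bar>entry_partial A j a b x - entry_partial A j a b y\<bar> \<le> real CARD('n) * C * norm (x - y)" by simp
  have "((\<lambda>s. A (\<theta> + s *\<^sub>R axis j 1)) has_derivative (\<lambda>s. frechet_derivative A (at \<theta>) (s *\<^sub>R axis j 1))) (at 0)"
    by (rule has_derivative_compose[of _ _ _ _ A])
       (use diff[of \<theta>] frechet_derivative_works in \<open>auto intro!: derivative_eq_intros\<close>)
  then have "((\<lambda>s. A (\<theta> + s *\<^sub>R axis j 1)) has_vector_derivative ?A' \<theta>) (at 0)"
    unfolding has_vector_derivative_def
    using linear_frechet_derivative[OF diff[of \<theta>]] by (simp add: linear_scale)
  from bounded_linear.has_vector_derivative[OF bl this]
  show "((\<lambda>s. A (\<theta> + s *\<^sub>R axis j 1) $ a $ b) has_real_derivative entry_partial A j a b \<theta>) (at 0)"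
    by (simp add: has_real_derivative_iff_has_vector_derivative entry_partial_def)
qed

section \<open>The rescaled Hamiltonian\<close>

lemma C_norm_mono: "l \<le> k \<Longrightarrow> C_norm l S f \<le> C_norm k S f"
  unfolding C_norm_def by (rule SUP_subset_mono) auto

lemma directional_derivative:
  fixes f :: "'a::real_normed_vector \<Rightarrow> real"
  assumes "f differentiable (at z)"
  shows "((\<lambda>s. f (z + s *\<^sub>R v)) has_real_derivative frechet_derivative f (at z) v) (at 0)"
proof -
  have "((\<lambda>s. f (z + s *\<^sub>R v)) has_derivative (\<lambda>s. frechet_derivative f (at z) (s *\<^sub>R v))) (at 0)"
    by (rule has_derivative_compose[of _ _ _ _ f])
       (use assms frechet_derivative_works in \<open>auto intro!: derivative_eq_intros\<close>)
  moreover have "frechet_derivative f (at z) (s *\<^sub>R v) = frechet_derivative f (at z) v * s" for s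
    using linear_scale[OF linear_frechet_derivative[OF assms], of s v] by simp
  ultimately show ?thesis unfolding has_field_derivative_def by simp
qed

lemma inner_matrix_vector_mult:
  fixes m :: "real ^ 'n::finite ^ 'n" and v w :: "real ^ 'n"
  shows "(m *v v) \<bullet> w = (\<Sum>a\<in>UNIV. \<Sum>b\<in>UNIV. m $ a $ b * (w $ a * v $ b))"
  by (simp add: inner_vec_def matrix_vector_mult_def sum_distrib_left sum_distrib_right mult_ac)

text \<open>
  The hypotheses on one Hamiltonian at one scale \<open>\<epsilon>\<close>. The constant \<open>speed\<close> is chosen so that, in the region \<open>\<bar>I\<bar> \<le> 2\<epsilon>\<close>, the angles
  deviate from the linear motion with velocity at most \<open>\<epsilon> speed\<close> and the actions move with velocity at
  most \<open>\<epsilon>\<^sup>2 speed\<close>; the summand \<open>1\<close> covers the contribution of \<open>R\<close>, by \<open>\<epsilon> C2 \<le> 1\<close>.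
\<close>

locale rescaled_system =
  fixes d :: nat and \<omega> :: "(real, 'n::{finite,linorder}) vec"
    and H R :: "(real, 'n) vec \<times> (real, 'n) vec \<Rightarrow> real"
    and A :: "(real, 'n) vec \<Rightarrow> ((real, 'n) vec, 'n) vec"
    and \<epsilon> C1 C2 n speed :: real
  assumes H_C2: "class_C (Suc (Suc 0)) H"
    and A_C2: "class_C (Suc (Suc 0)) A" and A_periodic: "torus_periodic A"
    and A_norm: "C_norm (Suc (Suc 0)) UNIV A \<le> ereal C1"
    and H_eq: "\<And>\<theta> I. H (\<theta>, I) = \<omega> \<bullet> I + (A \<theta> *v I) \<bullet> I + R (\<theta>, I)"
    and R_norm: "C_norm (Suc 0) (UNIV \<times> {I. infnorm I < 3}) (\<lambda>(\<theta>, J). R (\<theta>, \<epsilon> *\<^sub>R J) / \<epsilon> ^ 3) \<le> ereal C2"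
    and \<omega>_slow: "\<And>j. j \<in> slow d \<Longrightarrow> \<omega> $ j = 0" and \<omega>_norm: "infnorm \<omega> = 1"
    and \<epsilon>_pos: "\<epsilon> > 0" and \<epsilon>_C2: "\<epsilon> * C2 \<le> 1" and C1_pos: "C1 > 0" and C2_pos: "C2 > 0"
    and n_def: "n = real CARD('n)" and speed_def: "speed = 4 * n\<^sup>2 * C1 + 1"
begin

definition remainder :: "(real, 'n) vec \<times> (real, 'n) vec \<Rightarrow> real" where
  "remainder = (\<lambda>(\<theta>, J). R (\<theta>, \<epsilon> *\<^sub>R J) / \<epsilon> ^ 3)"

lemma n_ge_1: "n \<ge> 1" by (simp add: n_def Suc_leI)

lemma speed_ge_1: "speed \<ge> 1" using C1_pos by (simp add: speed_def)

lemma H_differentiable: "H differentiable (at z)"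
  using H_C2 unfolding class_C.simps by blast

lemma A_entry_bound: "\<bar>A \<theta> $ a $ b\<bar> \<le> C1"
  by (rule matrix_entry_bound[OF A_C2 A_norm A_periodic])

text \<open>
  The regularity of the remainder is inherited from \<open>H\<close> and \<open>A\<close>; the hypothesis on its norm only
  speaks of the values of its formal partial derivatives.
\<close>

lemma remainder_differentiable: "remainder differentiable (at z)"
proof -
  have A: "(\<lambda>z::(real, 'n) vec \<times> (real, 'n) vec. A (fst z) $ a $ b) differentiable (at z)" for a b z
  proof -
    have "A differentiable (at (fst z))" using A_C2 by simp
    then have "(\<lambda>z. A (fst z)) differentiable (at z)"
      by (intro differentiable_compose[of A fst]) (auto intro: bounded_linear_imp_differentiable bounded_linear_fst)
    then show ?thesis
      using bounded_linear.has_derivative[OF bounded_linear_matrix_entry] unfolding differentiable_def by blast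
  qed
  have lin: "(\<lambda>z::(real, 'n) vec \<times> (real, 'n) vec. snd z $ a) differentiable (at z)" for a z
    by (intro bounded_linear_imp_differentiable bounded_linear_compose[OF bounded_linear_vec_nth bounded_linear_snd])
  have "(\<lambda>z. H (fst z, \<epsilon> *\<^sub>R snd z)) differentiable (at z)"
    by (rule differentiable_compose[OF H_differentiable])
       (intro bounded_linear_imp_differentiable bounded_linear_Pair bounded_linear_fst
         bounded_linear_compose[OF bounded_linear_scaleR_right bounded_linear_snd])
  moreover have "(\<lambda>z::(real, 'n) vec \<times> (real, 'n) vec. \<omega> \<bullet> (\<epsilon> *\<^sub>R snd z)) differentiable (at z)"
    by (intro bounded_linear_imp_differentiable bounded_linear_compose[OF bounded_linear_inner_right]
         bounded_linear_compose[OF bounded_linear_scaleR_right bounded_linear_snd])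
  moreover have "(\<lambda>z. \<Sum>a\<in>UNIV. \<Sum>b\<in>UNIV. A (fst z) $ a $ b * ((\<epsilon> * snd z $ a) * (\<epsilon> * snd z $ b))) differentiable (at z)"
    by (intro differentiable_sum finite ballI differentiable_mult A lin differentiable_const)
  ultimately have "(\<lambda>z. (H (fst z, \<epsilon> *\<^sub>R snd z) - \<omega> \<bullet> (\<epsilon> *\<^sub>R snd z) -
      (\<Sum>a\<in>UNIV. \<Sum>b\<in>UNIV. A (fst z) $ a $ b * ((\<epsilon> * snd z $ a) * (\<epsilon> * snd z $ b)))) * inverse (\<epsilon> ^ 3)) differentiable (at z)"
    by (intro differentiable_mult differentiable_diff differentiable_const)
  also have "(\<lambda>z. (H (fst z, \<epsilon> *\<^sub>R snd z) - \<omega> \<bullet> (\<epsilon> *\<^sub>R snd z) -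
      (\<Sum>a\<in>UNIV. \<Sum>b\<in>UNIV. A (fst z) $ a $ b * ((\<epsilon> * snd z $ a) * (\<epsilon> * snd z $ b)))) * inverse (\<epsilon> ^ 3)) = remainder"
  proof
    fix z
    have "remainder z = (H (fst z, \<epsilon> *\<^sub>R snd z) - \<omega> \<bullet> (\<epsilon> *\<^sub>R snd z) -
        (A (fst z) *v (\<epsilon> *\<^sub>R snd z)) \<bullet> (\<epsilon> *\<^sub>R snd z)) * inverse (\<epsilon> ^ 3)"
      by (simp add: remainder_def H_eq divide_inverse split_def)
    then show "(H (fst z, \<epsilon> *\<^sub>R snd z) - \<omega> \<bullet> (\<epsilon> *\<^sub>R snd z) -
      (\<Sum>a\<in>UNIV. \<Sum>b\<in>UNIV. A (fst z) $ a $ b * ((\<epsilon> * snd z $ a) * (\<epsilon> * snd z $ b)))) * inverse (\<epsilon> ^ 3) = remainder z"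
      by (simp only: inner_matrix_vector_mult vector_scaleR_component real_scaleR_def)
  qed
  finally show ?thesis .
qed

lemma remainder_partial_bound:
  assumes "infnorm J < 3" "b \<in> Basis"
  shows "\<bar>frechet_derivative remainder (at (\<theta>, J)) b\<bar> \<le> C2"
  using C_norm_bound[OF R_norm, of "[b]" "(\<theta>, J)"] assms
  by (simp add: remainder_def infnorm_def)

lemma H_remainder: "H (\<theta>, I) = \<omega> \<bullet> I + (\<Sum>a\<in>UNIV. \<Sum>b\<in>UNIV. A \<theta> $ a $ b * (I $ a * I $ b)) + \<epsilon> ^ 3 * remainder (\<theta>, I /\<^sub>R \<epsilon>)"
  using \<epsilon>_pos by (simp add: H_eq inner_matrix_vector_mult remainder_def)

lemma H_partial_angle:
  "frechet_derivative H (at (\<theta>, I)) (axis j 1, 0) =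
    (\<Sum>a\<in>UNIV. \<Sum>b\<in>UNIV. entry_partial A j a b \<theta> * (I $ a * I $ b)) +
    \<epsilon> ^ 3 * frechet_derivative remainder (at (\<theta>, I /\<^sub>R \<epsilon>)) (axis j 1, 0)"
proof (rule DERIV_unique)
  show "((\<lambda>s. H ((\<theta>, I) + s *\<^sub>R (axis j 1, 0))) has_real_derivative frechet_derivative H (at (\<theta>, I)) (axis j 1, 0)) (at 0)"
    by (rule directional_derivative[OF H_differentiable])
  have "((\<lambda>s. \<omega> \<bullet> I + (\<Sum>a\<in>UNIV. \<Sum>b\<in>UNIV. A (\<theta> + s *\<^sub>R axis j 1) $ a $ b * (I $ a * I $ b)) +
      \<epsilon> ^ 3 * remainder ((\<theta>, I /\<^sub>R \<epsilon>) + s *\<^sub>R (axis j 1, 0))) has_real_derivative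
     0 + (\<Sum>a\<in>UNIV. \<Sum>b\<in>UNIV. entry_partial A j a b \<theta> * (I $ a * I $ b)) +
    \<epsilon> ^ 3 * frechet_derivative remainder (at (\<theta>, I /\<^sub>R \<epsilon>)) (axis j 1, 0)) (at 0)"
    by (intro DERIV_add DERIV_const DERIV_sum DERIV_cmult DERIV_cmult_right
        directional_derivative[OF remainder_differentiable] entry_partial_derivative[OF A_C2 A_norm A_periodic])
  then show "((\<lambda>s. H ((\<theta>, I) + s *\<^sub>R (axis j 1, 0))) has_real_derivative
    (\<Sum>a\<in>UNIV. \<Sum>b\<in>UNIV. entry_partial A j a b \<theta> * (I $ a * I $ b)) +
    \<epsilon> ^ 3 * frechet_derivative remainder (at (\<theta>, I /\<^sub>R \<epsilon>)) (axis j 1, 0)) (at 0)"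
    by (simp add: H_remainder)
qed

lemma H_partial_action:
  "frechet_derivative H (at (\<theta>, I)) (0, axis j 1) =
    \<omega> $ j + (\<Sum>a\<in>UNIV. \<Sum>b\<in>UNIV. A \<theta> $ a $ b * (axis j 1 $ a * I $ b + I $ a * axis j 1 $ b)) +
    \<epsilon> ^ 2 * frechet_derivative remainder (at (\<theta>, I /\<^sub>R \<epsilon>)) (0, axis j 1)"
proof (rule DERIV_unique)
  show "((\<lambda>s. H ((\<theta>, I) + s *\<^sub>R (0, axis j 1))) has_real_derivative frechet_derivative H (at (\<theta>, I)) (0, axis j 1)) (at 0)"
    by (rule directional_derivative[OF H_differentiable])
  let ?D = "frechet_derivative remainder (at (\<theta>, I /\<^sub>R \<epsilon>))"
  have D: "\<epsilon> ^ 3 * ?D (inverse \<epsilon> *\<^sub>R (0, axis j 1)) = \<epsilon> ^ 2 * ?D (0, axis j 1)"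
    using linear_scale[OF linear_frechet_derivative[OF remainder_differentiable], of _ "inverse \<epsilon>" "(0, axis j 1)"] \<epsilon>_pos
    by (simp add: power2_eq_square power3_eq_cube del: scaleR_Pair)
  have q: "((\<lambda>s. (I $ a + s * axis j 1 $ a) * (I $ b + s * axis j 1 $ b)) has_real_derivative
      axis j 1 $ a * I $ b + I $ a * axis j 1 $ b) (at 0)" for a b
    by (auto intro!: derivative_eq_intros)
  have "((\<lambda>s. (\<omega> \<bullet> I + s * \<omega> $ j) + (\<Sum>a\<in>UNIV. \<Sum>b\<in>UNIV. A \<theta> $ a $ b * ((I $ a + s * axis j 1 $ a) * (I $ b + s * axis j 1 $ b))) +
      \<epsilon> ^ 3 * remainder ((\<theta>, I /\<^sub>R \<epsilon>) + s *\<^sub>R (inverse \<epsilon> *\<^sub>R (0, axis j 1)))) has_real_derivative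
     (0 + 1 * \<omega> $ j) + (\<Sum>a\<in>UNIV. \<Sum>b\<in>UNIV. A \<theta> $ a $ b * (axis j 1 $ a * I $ b + I $ a * axis j 1 $ b)) +
    \<epsilon> ^ 3 * ?D (inverse \<epsilon> *\<^sub>R (0, axis j 1))) (at 0)"
    by (intro DERIV_add DERIV_const DERIV_sum DERIV_cmult DERIV_cmult_right DERIV_ident q
        directional_derivative[OF remainder_differentiable])
  then show "((\<lambda>s. H ((\<theta>, I) + s *\<^sub>R (0, axis j 1))) has_real_derivative
    \<omega> $ j + (\<Sum>a\<in>UNIV. \<Sum>b\<in>UNIV. A \<theta> $ a $ b * (axis j 1 $ a * I $ b + I $ a * axis j 1 $ b)) +
    \<epsilon> ^ 2 * frechet_derivative remainder (at (\<theta>, I /\<^sub>R \<epsilon>)) (0, axis j 1)) (at 0)"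
    unfolding D by (simp add: H_remainder inner_add_right inner_axis scaleR_right_distrib mult_ac)
qed

lemma abs_double_sum_le:
  fixes u :: "'n \<Rightarrow> 'n \<Rightarrow> real"
  assumes "\<And>a b. \<bar>u a b\<bar> \<le> B"
  shows "\<bar>\<Sum>a\<in>UNIV. \<Sum>b\<in>UNIV. u a b\<bar> \<le> n\<^sup>2 * B"
proof -
  have "\<bar>\<Sum>a\<in>UNIV. \<Sum>b\<in>UNIV. u a b\<bar> \<le> (\<Sum>a\<in>(UNIV::'n set). \<Sum>b\<in>(UNIV::'n set). B)"
    by (intro order_trans[OF sum_abs] sum_mono assms)
  then show ?thesis by (simp add: power2_eq_square n_def)
qed

lemma infnorm_less_if_components:
  fixes v :: "(real, 'n) vec"
  assumes "\<And>j. \<bar>v $ j\<bar> \<le> B" "B < B'"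
  shows "infnorm v < B'"
proof -
  have "infnorm v = Max ((\<lambda>i. \<bar>v \<bullet> i\<bar>) ` Basis)" by (rule infnorm_Max)
  also have "\<dots> \<le> B"
    by (subst Max_le_iff) (use assms(1) in \<open>auto simp: Basis_vec_def inner_axis\<close>)
  finally show ?thesis using assms(2) by simp
qed

context
  fixes \<theta> I :: "(real, 'n) vec"
  assumes I: "\<And>a. \<bar>I $ a\<bar> \<le> 2 * \<epsilon>"
begin

lemma rescaled_action_small: "infnorm (I /\<^sub>R \<epsilon>) < 3"
proof (rule infnorm_less_if_components)
  show "\<bar>(I /\<^sub>R \<epsilon>) $ j\<bar> \<le> 2" for j
    using I[of j] \<epsilon>_pos by (simp add: abs_mult field_simps)
qed simp

lemma action_product_bound: "\<bar>I $ a * I $ b\<bar> \<le> 4 * \<epsilon>\<^sup>2"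
proof -
  have "\<bar>I $ a * I $ b\<bar> \<le> (2 * \<epsilon>) * (2 * \<epsilon>)" unfolding abs_mult using I \<epsilon>_pos by (intro mult_mono) auto
  then show ?thesis by (simp add: power2_eq_square)
qed

lemma remainder_force_bound:
  "\<bar>\<epsilon> ^ 3 * frechet_derivative remainder (at (\<theta>, I /\<^sub>R \<epsilon>)) (axis j 1, 0)\<bar> \<le> \<epsilon> ^ 3 * C2"
proof -
  have "(axis j 1, 0) \<in> (Basis :: ((real, 'n) vec \<times> (real, 'n) vec) set)" by (simp add: Basis_prod_def)
  from remainder_partial_bound[OF rescaled_action_small this] \<epsilon>_pos
  show ?thesis by (simp add: abs_mult)
qed

lemma force_bound: "\<bar>frechet_derivative H (at (\<theta>, I)) (axis j 1, 0)\<bar> \<le> \<epsilon>\<^sup>2 * speed"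
proof -
  have "\<bar>\<Sum>a\<in>UNIV. \<Sum>b\<in>UNIV. entry_partial A j a b \<theta> * (I $ a * I $ b)\<bar> \<le> n\<^sup>2 * (C1 * (4 * \<epsilon>\<^sup>2))"
    unfolding abs_mult[of "entry_partial _ _ _ _ _"]
    by (intro abs_double_sum_le)
       (unfold abs_mult[of "entry_partial _ _ _ _ _"], intro mult_mono action_product_bound entry_partial_bound[OF A_C2 A_norm A_periodic], use C1_pos in auto)
  moreover have "\<epsilon> ^ 3 * C2 \<le> \<epsilon>\<^sup>2 * 1"
    using mult_left_mono[OF \<epsilon>_C2, of "\<epsilon>\<^sup>2"] by (simp add: power2_eq_square power3_eq_cube mult_ac)
  ultimately show ?thesis using remainder_force_bound[of j] unfolding H_partial_angle speed_def
    by (simp add: algebra_simps)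
qed

lemma frequency_bound: "\<bar>frechet_derivative H (at (\<theta>, I)) (0, axis j 1) - \<omega> $ j\<bar> \<le> \<epsilon> * speed"
proof -
  have ax: "\<bar>axis j 1 $ a\<bar> \<le> (1::real)" for a by (simp add: axis_def)
  have "\<bar>axis j 1 $ a * I $ b + I $ a * axis j 1 $ b\<bar> \<le> 1 * (2 * \<epsilon>) + (2 * \<epsilon>) * 1" for a b
    by (intro order_trans[OF abs_triangle_ineq] add_mono; unfold abs_mult; intro mult_mono ax I)
       (use \<epsilon>_pos in auto)
  then have "\<bar>A \<theta> $ a $ b * (axis j 1 $ a * I $ b + I $ a * axis j 1 $ b)\<bar> \<le> C1 * (4 * \<epsilon>)" for a b
    unfolding abs_mult using C1_pos by (intro mult_mono A_entry_bound) auto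
  then have "\<bar>\<Sum>a\<in>UNIV. \<Sum>b\<in>UNIV. A \<theta> $ a $ b * (axis j 1 $ a * I $ b + I $ a * axis j 1 $ b)\<bar> \<le> n\<^sup>2 * (C1 * (4 * \<epsilon>))"
    by (rule abs_double_sum_le)
  moreover have "\<bar>\<epsilon> ^ 2 * frechet_derivative remainder (at (\<theta>, I /\<^sub>R \<epsilon>)) (0, axis j 1)\<bar> \<le> \<epsilon> * 1"
  proof -
    have "(0, axis j 1) \<in> (Basis :: ((real, 'n) vec \<times> (real, 'n) vec) set)" by (simp add: Basis_prod_def)
    from remainder_partial_bound[OF rescaled_action_small this, of \<theta>]
    have "\<bar>\<epsilon> ^ 2 * frechet_derivative remainder (at (\<theta>, I /\<^sub>R \<epsilon>)) (0, axis j 1)\<bar> \<le> \<epsilon>\<^sup>2 * C2"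
      by (simp add: abs_mult mult_left_mono)
    also have "\<dots> \<le> \<epsilon> * 1" using mult_left_mono[OF \<epsilon>_C2, of \<epsilon>] \<epsilon>_pos by (simp add: power2_eq_square mult_ac)
    finally show ?thesis .
  qed
  ultimately show ?thesis unfolding H_partial_action speed_def by (simp add: algebra_simps)
qed

end

end

section \<open>The motion of the actions\<close>

lemma hamiltonian_field_component:
  fixes H :: "(real ^ 'n::finite) \<times> (real ^ 'n) \<Rightarrow> real"
  assumes "H differentiable (at z)"
  shows "fst (hamiltonian_field H z) $ j = frechet_derivative H (at z) (0, axis j 1)"
    and "snd (hamiltonian_field H z) $ j = - frechet_derivative H (at z) (axis j 1, 0)"
  using hamiltonian_field_inner[OF assms, of "axis j 1"] by (simp_all add: inner_axis')

lemma component_has_derivative: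
  assumes "(z has_vector_derivative (u, w)) (at t within S)"
  shows "((\<lambda>t. fst (z t) $ j) has_real_derivative u $ j) (at t within S)"
    and "((\<lambda>t. snd (z t) $ j) has_real_derivative w $ j) (at t within S)"
  using bounded_linear.has_vector_derivative[OF bounded_linear_compose[OF bounded_linear_vec_nth[of j] bounded_linear_fst] assms]
    bounded_linear.has_vector_derivative[OF bounded_linear_compose[OF bounded_linear_vec_nth[of j] bounded_linear_snd] assms]
  by (simp_all add: has_real_derivative_iff_has_vector_derivative)

context rescaled_system
begin

text \<open>
  A solution along which the actions stay of size \<open>2\<epsilon>\<close>, together with the resulting Lipschitz bounds
  for the actions and for the deviation of the angles from the linear motion.
\<close>

definition slow_motion :: "real \<Rightarrow> (real \<Rightarrow> (real, 'n) vec \<times> (real, 'n) vec) \<Rightarrow> bool" where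
  "slow_motion T z \<longleftrightarrow>
     (\<forall>t\<in>{0..T}. (z has_vector_derivative hamiltonian_field H (z t)) (at t within {0..T})) \<and>
     (\<forall>t\<in>{0..T}. \<forall>j. \<bar>snd (z t) $ j\<bar> \<le> 2 * \<epsilon>) \<and>
     (\<forall>s\<in>{0..T}. \<forall>t\<in>{0..T}. \<forall>j.
        \<bar>snd (z s) $ j - snd (z t) $ j\<bar> \<le> \<epsilon>\<^sup>2 * speed * \<bar>s - t\<bar> \<and>
        \<bar>(fst (z s) $ j - fst (z t) $ j) - (s - t) * \<omega> $ j\<bar> \<le> \<epsilon> * speed * \<bar>s - t\<bar>)"

text \<open>
  The box has radius \<open>2\<epsilon>\<close> in the actions. As these start within \<open>\<epsilon>\<close> of the origin and move with
  velocity at most \<open>\<epsilon>\<^sup>2 speed\<close>, they need at least the time \<open>1/(\<epsilon> speed)\<close> to leave it. In the angles the box is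
  large enough for the linear motion and the deviation from it.
\<close>

lemma slow_motion_exists:
  assumes T: "T \<ge> 0" "\<epsilon> * T * speed \<le> 1" and I0: "infnorm I0 = 1"
  obtains z where "z 0 = (\<theta>0, \<epsilon> *\<^sub>R I0)" "slow_motion T z"
proof -
  define B where "B = (1 + \<epsilon> * speed) * T"
  have B: "B \<ge> 0" using T \<epsilon>_pos speed_ge_1 by (simp add: B_def)
  define lo where "lo = (\<theta>0 - (\<chi> j. B), (\<chi> j. - (2 * \<epsilon>)) :: (real, 'n) vec)"
  define hi where "hi = (\<theta>0 + (\<chi> j. B), (\<chi> j. 2 * \<epsilon>) :: (real, 'n) vec)"
  have box: "(u, v) \<in> cbox lo hi \<longleftrightarrow> (\<forall>j. \<bar>u $ j - \<theta>0 $ j\<bar> \<le> B \<and> \<bar>v $ j\<bar> \<le> 2 * \<epsilon>)" for u v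
    proof -
    have 1: "\<bar>x - y\<bar> \<le> B \<longleftrightarrow> y - B \<le> x \<and> x \<le> y + B" "\<bar>x\<bar> \<le> 2 * \<epsilon> \<longleftrightarrow> - (2 * \<epsilon>) \<le> x \<and> x \<le> 2 * \<epsilon>" for x y
      by linarith+
    show ?thesis unfolding lo_def hi_def cbox_Pair_eq mem_Times_iff mem_box_cart 1 by auto
  qed
  have ne: "cbox lo hi \<noteq> {}"
    using box[of \<theta>0 0] B \<epsilon>_pos by auto
  obtain z where z0: "z 0 = (\<theta>0, \<epsilon> *\<^sub>R I0)" and
    z: "\<And>t. t \<in> {0..T} \<Longrightarrow> (z has_vector_derivative hamiltonian_field H (clamp lo hi (z t))) (at t within {0..T})"
    using clamped_hamiltonian_flow_exists[OF H_C2 T(1) ne] by metis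
  have c: "\<bar>snd (clamp lo hi x) $ j\<bar> \<le> 2 * \<epsilon>" for x j
  proof -
    have "clamp lo hi x \<in> cbox lo hi" using ne by (intro clamp_in_interval) (auto simp: box_ne_empty)
    then show ?thesis using box[of "fst (clamp lo hi x)" "snd (clamp lo hi x)"] by simp
  qed
  let ?w = "\<lambda>t. hamiltonian_field H (clamp lo hi (z t))"
  have force: "\<bar>snd (?w t) $ j\<bar> \<le> \<epsilon>\<^sup>2 * speed" for t j
    using force_bound[of "snd (clamp lo hi (z t))", OF c, of "fst (clamp lo hi (z t))" j]
    by (simp add: hamiltonian_field_component[OF H_differentiable])
  have freq: "\<bar>fst (?w t) $ j - \<omega> $ j\<bar> \<le> \<epsilon> * speed" for t j
    using frequency_bound[of "snd (clamp lo hi (z t))", OF c, of "fst (clamp lo hi (z t))" j]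
    by (simp add: hamiltonian_field_component[OF H_differentiable])
  have d: "((\<lambda>t. fst (z t) $ j) has_real_derivative fst (?w t) $ j) (at t within {0..T})"
      "((\<lambda>t. snd (z t) $ j) has_real_derivative snd (?w t) $ j) (at t within {0..T})" if "t \<in> {0..T}" for t j
    using component_has_derivative[of z "fst (?w t)" "snd (?w t)" t] z[OF that] by simp_all
  have lip_I: "\<bar>snd (z s) $ j - snd (z t) $ j\<bar> \<le> \<epsilon>\<^sup>2 * speed * \<bar>s - t\<bar>" if "s \<in> {0..T}" "t \<in> {0..T}" for s t j
  proof -
    have "norm (snd (z s) $ j - snd (z t) $ j) \<le> \<epsilon>\<^sup>2 * speed * norm (s - t)"
      by (rule field_differentiable_bound[where S="{0..T}", OF _ d(2)]) (use force that in auto)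
    then show ?thesis by simp
  qed
  have lip_\<theta>: "\<bar>(fst (z s) $ j - fst (z t) $ j) - (s - t) * \<omega> $ j\<bar> \<le> \<epsilon> * speed * \<bar>s - t\<bar>" if "s \<in> {0..T}" "t \<in> {0..T}" for s t j
  proof -
    have "norm ((fst (z s) $ j - s * \<omega> $ j) - (fst (z t) $ j - t * \<omega> $ j)) \<le> \<epsilon> * speed * norm (s - t)"
    proof (rule field_differentiable_bound[where S="{0..T}"])
      show "((\<lambda>t. fst (z t) $ j - t * \<omega> $ j) has_field_derivative fst (?w t) $ j - \<omega> $ j) (at t within {0..T})"
        if "t \<in> {0..T}" for t
        using d(1)[OF that, of j] by (auto intro!: derivative_eq_intros)
    qed (use freq that in auto)
    then show ?thesis by (simp add: algebra_simps)
  qed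
  have "z t \<in> cbox lo hi" if t: "t \<in> {0..T}" for t
  proof -
    have "\<bar>fst (z t) $ j - \<theta>0 $ j\<bar> \<le> B" for j
    proof -
      have "\<bar>\<omega> $ j\<bar> \<le> 1" using component_le_infnorm_cart[of \<omega> j] \<omega>_norm by simp
      then have "\<bar>t * \<omega> $ j\<bar> \<le> T * 1" unfolding abs_mult using t by (intro mult_mono) auto
      moreover have "\<epsilon> * speed * \<bar>t - 0\<bar> \<le> \<epsilon> * speed * T" using t \<epsilon>_pos speed_ge_1 by (intro mult_left_mono) auto
      ultimately show ?thesis using lip_\<theta>[OF t, of 0 j] T z0 unfolding B_def by (simp add: algebra_simps)
    qed
    moreover have "\<bar>snd (z t) $ j\<bar> \<le> 2 * \<epsilon>" for j
    proof -
      have "\<bar>\<epsilon> * I0 $ j\<bar> \<le> \<epsilon> * 1" unfolding abs_mult using component_le_infnorm_cart[of I0 j] I0 \<epsilon>_pos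
        by (intro mult_mono) auto
      moreover have "\<epsilon>\<^sup>2 * speed * \<bar>t - 0\<bar> \<le> \<epsilon>\<^sup>2 * speed * T" using t speed_ge_1 by (intro mult_left_mono) auto
      moreover have "\<epsilon>\<^sup>2 * speed * T \<le> \<epsilon> * 1"
        using mult_left_mono[OF T(2), of \<epsilon>] \<epsilon>_pos by (simp add: power2_eq_square mult_ac)
      ultimately show ?thesis using lip_I[OF t, of 0 j] T z0 by simp
    qed
    ultimately show ?thesis using box[of "fst (z t)" "snd (z t)"] by simp
  qed
  then have "clamp lo hi (z t) = z t" if "t \<in> {0..T}" for t using that by simp
  with z have sol: "(z has_vector_derivative hamiltonian_field H (z t)) (at t within {0..T})" and
    small: "\<bar>snd (z t) $ j\<bar> \<le> 2 * \<epsilon>" if "t \<in> {0..T}" for t j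
    using that c[of "z t" j] by simp_all
  show thesis by (rule that[of z, OF z0]) (use sol small lip_I lip_\<theta> in \<open>auto simp: slow_motion_def\<close>)
qed

text \<open>
  The constant that the bound of \<open>averaging_along_trajectory\<close> yields for \<open>f = \<partial>\<^sub>j A\<^sub>a\<^sub>b\<close> and
  \<open>h = I\<^sub>a I\<^sub>b\<close>, with \<open>M = C1\<close>, \<open>L = n C1\<close>, \<open>H0 = 4\<epsilon>\<^sup>2\<close>, \<open>H1 = 4\<epsilon>\<^sup>3 speed\<close> and \<open>K = n \<epsilon> speed\<close>, after division
  by \<open>\<epsilon>/Q\<close>.
\<close>

definition averaging_constant :: "real \<Rightarrow> real \<Rightarrow> real" where
  "averaging_constant c \<delta> = c * C1 * (4 * \<delta> * n + 4 * \<delta> * n\<^sup>2 * speed + 4 * \<delta> * speed + 8)"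

lemma entry_average_error:
  fixes a b j :: 'n
  assumes z: "slow_motion (\<delta> / \<epsilon>) z" and \<delta>: "\<delta> > 0"
    and \<rho>: "averaging_measure d \<omega> (c / Q) (c * T) \<rho>" and c: "c > 0" and Q: "Q \<ge> 1" and T: "T > 0"
    and small: "\<epsilon> * T \<le> 1 / Q"
  defines "h \<equiv> \<lambda>t. snd (z t) $ a * snd (z t) $ b" and "g \<equiv> entry_partial A j a b"
  shows "(\<lambda>t. h t * (g (fst (z t)) - torus_average d g (fst (z t)))) integrable_on {0..\<delta> / \<epsilon>}"
    and "\<bar>integral {0..\<delta> / \<epsilon>} (\<lambda>t. h t * (g (fst (z t)) - torus_average d g (fst (z t))))\<bar>
      \<le> \<epsilon> / Q * averaging_constant c \<delta>"
proof -
  let ?\<tau> = "\<delta> / \<epsilon>"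
  have \<tau>: "?\<tau> \<ge> 0" using \<delta> \<epsilon>_pos by simp
  define m where "m t = max 0 (min t ?\<tau>)" for t
  have m: "m t \<in> {0..?\<tau>}" and m_id: "t \<in> {0..?\<tau>} \<Longrightarrow> m t = t"
    and m_lip: "\<bar>m s - m t\<bar> \<le> \<bar>s - t\<bar>" for s t using \<tau> by (auto simp: m_def)
  \<comment> \<open>Averaging looks at arbitrary times, so the motion is continued linearly with frozen actions outside
     \<open>[0, \<tau>]\<close>; this preserves all Lipschitz bounds.\<close>
  define \<theta> where "\<theta> t = fst (z (m t)) + (t - m t) *\<^sub>R \<omega>" for t
  have small_I: "\<bar>snd (z (m t)) $ i\<bar> \<le> 2 * \<epsilon>"
    and lip_I: "\<bar>snd (z (m s)) $ i - snd (z (m t)) $ i\<bar> \<le> \<epsilon>\<^sup>2 * speed * \<bar>s - t\<bar>"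
    and lip_\<theta>: "\<bar>(fst (z (m s)) $ i - fst (z (m t)) $ i) - (m s - m t) * \<omega> $ i\<bar> \<le> \<epsilon> * speed * \<bar>s - t\<bar>" for s t i
  proof -
    show "\<bar>snd (z (m t)) $ i\<bar> \<le> 2 * \<epsilon>" using z m by (simp add: slow_motion_def)
    have "\<epsilon>\<^sup>2 * speed * \<bar>m s - m t\<bar> \<le> \<epsilon>\<^sup>2 * speed * \<bar>s - t\<bar>" "\<epsilon> * speed * \<bar>m s - m t\<bar> \<le> \<epsilon> * speed * \<bar>s - t\<bar>"
      using m_lip \<epsilon>_pos speed_ge_1 by (auto intro!: mult_left_mono)
    then show "\<bar>snd (z (m s)) $ i - snd (z (m t)) $ i\<bar> \<le> \<epsilon>\<^sup>2 * speed * \<bar>s - t\<bar>"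
      "\<bar>(fst (z (m s)) $ i - fst (z (m t)) $ i) - (m s - m t) * \<omega> $ i\<bar> \<le> \<epsilon> * speed * \<bar>s - t\<bar>"
      using z m[of s] m[of t] unfolding slow_motion_def by (blast intro: order_trans)+
  qed
  have h0: "\<bar>h (m t)\<bar> \<le> 4 * \<epsilon>\<^sup>2" for t
    unfolding h_def by (rule action_product_bound) (rule small_I)
  have h1: "\<bar>h (m s) - h (m t)\<bar> \<le> 4 * \<epsilon> ^ 3 * speed * \<bar>s - t\<bar>" for s t
  proof -
    let ?I = "\<lambda>s i. snd (z (m s)) $ i"
    have "h (m s) - h (m t) = (?I s a - ?I t a) * ?I s b + ?I t a * (?I s b - ?I t b)"
      by (simp add: h_def algebra_simps)
    also have "\<bar>\<dots>\<bar> \<le> \<epsilon>\<^sup>2 * speed * \<bar>s - t\<bar> * (2 * \<epsilon>) + 2 * \<epsilon> * (\<epsilon>\<^sup>2 * speed * \<bar>s - t\<bar>)"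
      by (intro order_trans[OF abs_triangle_ineq] add_mono; unfold abs_mult; intro mult_mono lip_I small_I)
         (use \<epsilon>_pos speed_ge_1 in auto)
    finally show ?thesis by (simp add: power2_eq_square power3_eq_cube algebra_simps)
  qed
  have K: "norm (\<theta> s - \<theta> t - (s - t) *\<^sub>R \<omega>) \<le> n * \<epsilon> * speed * \<bar>s - t\<bar>" for s t
  proof -
    have "norm (\<theta> s - \<theta> t - (s - t) *\<^sub>R \<omega>) \<le> (\<Sum>i\<in>UNIV. \<bar>(\<theta> s - \<theta> t - (s - t) *\<^sub>R \<omega>) $ i\<bar>)"
      by (rule norm_le_l1_cart)
    also have "\<dots> \<le> (\<Sum>i\<in>(UNIV :: 'n set). \<epsilon> * speed * \<bar>s - t\<bar>)"
    proof (rule sum_mono)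
      fix i
      have "(\<theta> s - \<theta> t - (s - t) *\<^sub>R \<omega>) $ i = (fst (z (m s)) $ i - fst (z (m t)) $ i) - (m s - m t) * \<omega> $ i"
        by (simp add: \<theta>_def algebra_simps)
      then show "\<bar>(\<theta> s - \<theta> t - (s - t) *\<^sub>R \<omega>) $ i\<bar> \<le> \<epsilon> * speed * \<bar>s - t\<bar>" using lip_\<theta> by simp
    qed
    also have "\<dots> = n * \<epsilon> * speed * \<bar>s - t\<bar>" by (simp add: n_def)
    finally show ?thesis .
  qed
  have L: "n * C1 \<ge> 0" using n_ge_1 C1_pos by simp
  note avg = averaging_along_trajectory[OF \<rho> entry_partial_periodic[OF A_C2 A_norm A_periodic]
      entry_partial_bound[OF A_C2 A_norm A_periodic] L
      entry_partial_lipschitz[OF A_C2 A_norm A_periodic, folded n_def] h0 h1 K \<tau>, of j a b, folded g_def]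
  have cong: "h (m t) * (g (\<theta> t) - torus_average d g (\<theta> t)) = h t * (g (fst (z t)) - torus_average d g (fst (z t)))"
    if "t \<in> {0..?\<tau>}" for t using m_id[OF that] by (simp add: \<theta>_def)
  show "(\<lambda>t. h t * (g (fst (z t)) - torus_average d g (fst (z t)))) integrable_on {0..\<delta> / \<epsilon>}"
    using avg(2) by (rule integrable_eq) (rule cong)
  have "\<bar>integral {0..?\<tau>} (\<lambda>t. h t * (g (fst (z t)) - torus_average d g (fst (z t))))\<bar> =
      \<bar>integral {0..?\<tau>} (\<lambda>t. h (m t) * (g (\<theta> t) - torus_average d g (\<theta> t)))\<bar>"
    using cong by (intro arg_cong[where f=abs] Henstock_Kurzweil_Integration.integral_cong) simp
  also have "\<dots> \<le> ?\<tau> * (4 * \<epsilon>\<^sup>2) * (n * C1) * (c / Q) +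
      (?\<tau> * (4 * \<epsilon>\<^sup>2) * (n * C1) * (n * \<epsilon> * speed) + ?\<tau> * C1 * (4 * \<epsilon> ^ 3 * speed) + 2 * (4 * \<epsilon>\<^sup>2) * C1) * (c * T)"
    by (rule avg(1))
  also have "\<dots> = \<epsilon> * (4 * \<delta> * n * c * C1) * (1 / Q) +
      \<epsilon> * (c * C1 * (4 * \<delta> * n\<^sup>2 * speed + 4 * \<delta> * speed + 8)) * (\<epsilon> * T)"
    using \<epsilon>_pos by (simp add: field_simps power2_eq_square power3_eq_cube)
  also have "\<dots> \<le> \<epsilon> * (4 * \<delta> * n * c * C1) * (1 / Q) +
      \<epsilon> * (c * C1 * (4 * \<delta> * n\<^sup>2 * speed + 4 * \<delta> * speed + 8)) * (1 / Q)"
    using small \<epsilon>_pos c C1_pos \<delta> speed_ge_1 n_ge_1 by (intro add_left_mono mult_left_mono) auto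
  also have "\<dots> = \<epsilon> / Q * averaging_constant c \<delta>"
    using Q by (simp add: averaging_constant_def field_simps)
  finally show "\<bar>integral {0..?\<tau>} (\<lambda>t. h t * (g (fst (z t)) - torus_average d g (fst (z t))))\<bar>
      \<le> \<epsilon> / Q * averaging_constant c \<delta>" .
qed

text \<open>
  Integrate the equation for \<open>I\<^sub>j\<close> and replace each \<open>\<partial>\<^sub>j A\<^sub>a\<^sub>b\<close> by its average. The remainder
  contributes \<open>\<epsilon>\<^sup>3 C2\<close> over a time \<open>\<delta>/\<epsilon>\<close>, which is at most \<open>\<delta> C2 \<epsilon>/Q\<close> since \<open>\<epsilon> \<le> 1/Q\<close>.
\<close>

lemma action_drift:
  fixes j :: 'n
  assumes z: "slow_motion (\<delta> / \<epsilon>) z" and \<delta>: "\<delta> > 0"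
    and \<rho>: "averaging_measure d \<omega> (c / Q) (c * T) \<rho>" and c: "c > 0" and Q: "Q \<ge> 1" and T: "T > 0"
    and small: "\<epsilon> * T \<le> 1 / Q" "\<epsilon> \<le> 1 / Q"
  defines "v \<equiv> \<lambda>a b t. snd (z t) $ a * snd (z t) $ b * torus_average d (entry_partial A j a b) (fst (z t))"
  shows "\<bar>snd (z (\<delta> / \<epsilon>)) $ j - snd (z 0) $ j + (\<Sum>a\<in>UNIV. \<Sum>b\<in>UNIV. integral {0..\<delta> / \<epsilon>} (v a b))\<bar>
      \<le> \<epsilon> / Q * (n\<^sup>2 * averaging_constant c \<delta> + \<delta> * C2)"
    and "\<And>a b. v a b integrable_on {0..\<delta> / \<epsilon>}"
proof -
  let ?\<tau> = "\<delta> / \<epsilon>"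
  have \<tau>: "?\<tau> \<ge> 0" using \<delta> \<epsilon>_pos by simp
  have sol: "(z has_vector_derivative hamiltonian_field H (z t)) (at t within {0..?\<tau>})" if "t \<in> {0..?\<tau>}" for t
    using z that by (simp add: slow_motion_def)
  have zc: "continuous_on {0..?\<tau>} z"
    by (rule continuous_on_vector_derivative) (rule sol)
  let ?h = "\<lambda>a b t. snd (z t) $ a * snd (z t) $ b" and ?g = "\<lambda>a b t. entry_partial A j a b (fst (z t))"
  let ?r = "\<lambda>t. \<epsilon> ^ 3 * frechet_derivative remainder (at (fst (z t), snd (z t) /\<^sub>R \<epsilon>)) (axis j 1, 0)"
  let ?D = "\<lambda>a b t. ?h a b t * (?g a b t - torus_average d (entry_partial A j a b) (fst (z t)))"
  have Dint: "?D a b integrable_on {0..?\<tau>}" and Dbd: "\<bar>integral {0..?\<tau>} (?D a b)\<bar> \<le> \<epsilon> / Q * averaging_constant c \<delta>" for a b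
    using entry_average_error[OF z \<delta> \<rho> c Q T small(1)] by auto
  have pint: "(\<lambda>t. ?h a b t * ?g a b t) integrable_on {0..?\<tau>}" for a b
    by (intro integrable_continuous_real continuous_intros zc
        continuous_on_compose2[OF entry_partial_continuous[OF A_C2 A_norm A_periodic]]) auto
  have v_eq: "v a b = (\<lambda>t. ?h a b t * ?g a b t - ?D a b t)" for a b
    by (simp add: v_def fun_eq_iff algebra_simps)
  show vint: "v a b integrable_on {0..?\<tau>}" for a b
    unfolding v_eq by (intro integrable_diff pint Dint)
  have F: "((\<lambda>t. - ((\<Sum>a\<in>UNIV. \<Sum>b\<in>UNIV. ?h a b t * ?g a b t) + ?r t)) has_integral (snd (z ?\<tau>) $ j - snd (z 0) $ j)) {0..?\<tau>}"
  proof (rule fundamental_theorem_of_calculus[OF \<tau>])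
    fix t assume t: "t \<in> {0..?\<tau>}"
    have "((\<lambda>t. snd (z t) $ j) has_real_derivative snd (hamiltonian_field H (z t)) $ j) (at t within {0..?\<tau>})"
      by (rule component_has_derivative(2)[of z "fst (hamiltonian_field H (z t))"]) (use sol[OF t] in simp)
    also have "snd (hamiltonian_field H (z t)) $ j = - ((\<Sum>a\<in>UNIV. \<Sum>b\<in>UNIV. ?h a b t * ?g a b t) + ?r t)"
      using H_partial_angle[of "fst (z t)" "snd (z t)" j]
      by (simp add: hamiltonian_field_component[OF H_differentiable] mult_ac)
    finally show "((\<lambda>t. snd (z t) $ j) has_vector_derivative - ((\<Sum>a\<in>UNIV. \<Sum>b\<in>UNIV. ?h a b t * ?g a b t) + ?r t)) (at t within {0..?\<tau>})"
      by (simp add: has_real_derivative_iff_has_vector_derivative)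
  qed
  have P: "((\<lambda>t. \<Sum>a\<in>UNIV. \<Sum>b\<in>UNIV. ?h a b t * ?g a b t) has_integral (\<Sum>a\<in>UNIV. \<Sum>b\<in>UNIV. integral {0..?\<tau>} (\<lambda>t. ?h a b t * ?g a b t))) {0..?\<tau>}"
    by (intro has_integral_sum integrable_integral pint) auto
  have r: "(?r has_integral - (snd (z ?\<tau>) $ j - snd (z 0) $ j) - (\<Sum>a\<in>UNIV. \<Sum>b\<in>UNIV. integral {0..?\<tau>} (\<lambda>t. ?h a b t * ?g a b t))) {0..?\<tau>}"
    using has_integral_diff[OF has_integral_neg[OF F] P] by simp
  have rbd: "\<bar>- (snd (z ?\<tau>) $ j - snd (z 0) $ j) - (\<Sum>a\<in>UNIV. \<Sum>b\<in>UNIV. integral {0..?\<tau>} (\<lambda>t. ?h a b t * ?g a b t))\<bar> \<le> \<epsilon> ^ 3 * C2 * ?\<tau>"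
  proof -
    have "norm (- (snd (z ?\<tau>) $ j - snd (z 0) $ j) - (\<Sum>a\<in>UNIV. \<Sum>b\<in>UNIV. integral {0..?\<tau>} (\<lambda>t. ?h a b t * ?g a b t)))
        \<le> \<epsilon> ^ 3 * C2 * measure lborel {0..?\<tau>}"
    proof (rule has_integral_bound_real[OF _ finite.emptyI r])
      show "0 \<le> \<epsilon> ^ 3 * C2" using \<epsilon>_pos C2_pos by simp
      show "norm (?r t) \<le> \<epsilon> ^ 3 * C2" if "t \<in> {0..?\<tau>} - {}" for t
        using remainder_force_bound[of "snd (z t)" "fst (z t)" j] z that by (simp add: slow_motion_def)
    qed
    then show ?thesis using \<tau> by simp
  qed
  have "integral {0..?\<tau>} (v a b) = integral {0..?\<tau>} (\<lambda>t. ?h a b t * ?g a b t) - integral {0..?\<tau>} (?D a b)" for a b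
    unfolding v_eq by (rule Henstock_Kurzweil_Integration.integral_diff[OF pint Dint])
  then have "snd (z ?\<tau>) $ j - snd (z 0) $ j + (\<Sum>a\<in>UNIV. \<Sum>b\<in>UNIV. integral {0..?\<tau>} (v a b)) =
     - (- (snd (z ?\<tau>) $ j - snd (z 0) $ j) - (\<Sum>a\<in>UNIV. \<Sum>b\<in>UNIV. integral {0..?\<tau>} (\<lambda>t. ?h a b t * ?g a b t)))
     - (\<Sum>a\<in>UNIV. \<Sum>b\<in>UNIV. integral {0..?\<tau>} (?D a b))"
    by (simp add: sum_subtractf)
  moreover have "\<bar>\<Sum>a\<in>UNIV. \<Sum>b\<in>UNIV. integral {0..?\<tau>} (?D a b)\<bar> \<le> n\<^sup>2 * (\<epsilon> / Q * averaging_constant c \<delta>)"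
    by (rule abs_double_sum_le) (rule Dbd)
  moreover have "\<epsilon> ^ 3 * C2 * ?\<tau> \<le> \<epsilon> / Q * (\<delta> * C2)"
  proof -
    have "\<epsilon> ^ 3 * C2 * ?\<tau> = \<epsilon> * (\<delta> * C2) * \<epsilon>" using \<epsilon>_pos by (simp add: power3_eq_cube)
    also have "\<dots> \<le> \<epsilon> * (\<delta> * C2) * (1 / Q)" using small(2) \<epsilon>_pos \<delta> C2_pos by (intro mult_left_mono) auto
    finally show ?thesis by simp
  qed
  ultimately show "\<bar>snd (z ?\<tau>) $ j - snd (z 0) $ j + (\<Sum>a\<in>UNIV. \<Sum>b\<in>UNIV. integral {0..?\<tau>} (v a b))\<bar>
      \<le> \<epsilon> / Q * (n\<^sup>2 * averaging_constant c \<delta> + \<delta> * C2)"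
    using rbd by (simp add: algebra_simps)
qed

end

section \<open>Small divisors and the drift estimates\<close>

lemma fast_eq_Compl_slow: "fast d = - slow d" by (auto simp: fast_def slow_def)

lemma fast_nonempty:
  assumes "d < CARD('n::{finite,linorder})"
  shows "fast d \<noteq> ({} :: 'n set)"
proof -
  have "{i :: 'n. i \<le> Max UNIV} = UNIV" by auto
  then have "(Max UNIV :: 'n) \<in> fast d" using assms by (simp add: fast_def)
  then show ?thesis by blast
qed

text \<open>
  The maximum in the definition of \<open>\<Psi>\<close> is over a finite set, because only the finitely many choices of
  the fast entries of \<open>k\<close> matter.
\<close>

lemma inverse_abs_le_Psi:
  fixes \<omega> :: "(real, 'n::{finite,linorder}) vec" and k :: "'n \<Rightarrow> int"
  assumes "0 < (\<Sum>j\<in>fast d. \<bar>k j\<bar>)" "of_int (\<Sum>j\<in>fast d. \<bar>k j\<bar>) \<le> Q"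
  shows "inverse \<bar>\<Sum>j\<in>fast d. of_int (k j) * \<omega> $ j\<bar> \<le> Psi d \<omega> Q"
  unfolding Psi_def
proof (rule Max_ge)
  let ?F = "fast d :: 'n set"
  let ?v = "\<lambda>k. inverse \<bar>\<Sum>j\<in>?F. of_int (k j) * \<omega> $ j\<bar>"
  let ?S = "{?v k | k :: 'n \<Rightarrow> int. 0 < (\<Sum>j\<in>?F. \<bar>k j\<bar>) \<and> of_int (\<Sum>j\<in>?F. \<bar>k j\<bar>) \<le> Q}"
  show "?v k \<in> ?S" using assms by blast
  have "?S \<subseteq> ?v ` (\<Pi>\<^sub>E j\<in>?F. {- \<lfloor>Q\<rfloor>..\<lfloor>Q\<rfloor>})"
  proof
    fix x assume "x \<in> ?S"
    then obtain k :: "'n \<Rightarrow> int" where k: "x = ?v k" "of_int (\<Sum>j\<in>?F. \<bar>k j\<bar>) \<le> Q" by blast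
    have "\<bar>k j\<bar> \<le> \<lfloor>Q\<rfloor>" if "j \<in> ?F" for j
    proof -
      have "\<bar>k j\<bar> \<le> (\<Sum>j\<in>?F. \<bar>k j\<bar>)" using that by (intro member_le_sum) auto
      also have "\<dots> \<le> \<lfloor>Q\<rfloor>" using k(2) by (simp add: le_floor_iff)
      finally show ?thesis .
    qed
    then have "restrict k ?F \<in> (\<Pi>\<^sub>E j\<in>?F. {- \<lfloor>Q\<rfloor>..\<lfloor>Q\<rfloor>})" by (auto simp: abs_le_iff minus_le_iff)
    moreover have "x = ?v (restrict k ?F)" unfolding k(1)
      by (intro arg_cong[where f="\<lambda>s. inverse \<bar>s\<bar>"] sum.cong) auto
    ultimately show "x \<in> ?v ` (\<Pi>\<^sub>E j\<in>?F. {- \<lfloor>Q\<rfloor>..\<lfloor>Q\<rfloor>})" by blast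
  qed
  then show "finite ?S" by (rule finite_subset) (intro finite_imageI finite_PiE; simp)
qed

text \<open>
  A unit vector in a direction where \<open>\<bar>\<omega>\<^sub>j\<bar> = 1\<close> competes in the maximum.
\<close>

lemma Psi_ge_1:
  fixes \<omega> :: "(real, 'n::{finite,linorder}) vec"
  assumes \<omega>: "infnorm \<omega> = 1" "\<And>j. j \<in> slow d \<Longrightarrow> \<omega> $ j = 0" and Q: "Q \<ge> 1"
  shows "Psi d \<omega> Q \<ge> 1"
proof -
  have "infnorm \<omega> \<in> (\<lambda>i. \<bar>\<omega> \<bullet> i\<bar>) ` Basis" unfolding infnorm_Max by (rule Max_in) auto
  then obtain b where "b \<in> Basis" "\<bar>\<omega> \<bullet> b\<bar> = 1" unfolding \<omega>(1) by auto
  then obtain j where j: "\<bar>\<omega> $ j\<bar> = 1" by (auto simp: Basis_vec_def inner_axis)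
  then have jf: "j \<in> fast d" using \<omega>(2)[of j] by (auto simp: fast_eq_Compl_slow)
  let ?k = "\<lambda>i. if i = j then 1 else 0 :: int"
  have s1: "(\<Sum>i\<in>fast d. \<bar>?k i\<bar>) = 1"
    using jf sum.delta[of "fast d" j "\<lambda>_. 1::int"] by (simp add: if_distrib cong: if_cong)
  have "(\<Sum>i\<in>fast d. of_int (?k i) * \<omega> $ i) = (\<Sum>i\<in>fast d. if i = j then \<omega> $ i else 0)"
    by (intro sum.cong) auto
  also have "\<dots> = \<omega> $ j" using jf by (subst sum.delta) auto
  finally have s2: "(\<Sum>i\<in>fast d. of_int (?k i) * \<omega> $ i) = \<omega> $ j" .
  have "inverse \<bar>\<Sum>i\<in>fast d. of_int (?k i) * \<omega> $ i\<bar> \<le> Psi d \<omega> Q"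
    by (rule inverse_abs_le_Psi) (use s1 Q in simp_all)
  then show ?thesis unfolding s2 j by simp
qed

text \<open>
  Nonresonance excludes the value \<open>0\<close> of the divisor, for which \<^const>\<open>inverse\<close> would return \<open>0\<close>.
\<close>

lemma small_divisor_bound:
  fixes \<omega> :: "(real, 'n::{finite,linorder}) vec" and k :: "'n \<Rightarrow> int"
  assumes nr: "nonresonant d \<omega>" and k: "\<exists>j\<in>fast d. k j \<noteq> 0" "of_int (\<Sum>j\<in>fast d. \<bar>k j\<bar>) \<le> Q"
  shows "1 \<le> Psi d \<omega> Q * \<bar>\<Sum>j\<in>fast d. of_int (k j) * \<omega> $ j\<bar>"
proof -
  obtain j where j: "j \<in> fast d" "k j \<noteq> 0" using k(1) by blast
  have "\<bar>k j\<bar> \<le> (\<Sum>j\<in>fast d. \<bar>k j\<bar>)" using j by (intro member_le_sum) auto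
  then have "0 < (\<Sum>j\<in>fast d. \<bar>k j\<bar>)" using j by linarith
  then have "inverse \<bar>\<Sum>j\<in>fast d. of_int (k j) * \<omega> $ j\<bar> \<le> Psi d \<omega> Q" using k(2) by (rule inverse_abs_le_Psi)
  moreover have "(\<Sum>j\<in>fast d. of_int (k j) * \<omega> $ j) \<noteq> 0" using nr k(1) unfolding nonresonant_def by blast
  ultimately show ?thesis by (simp add: inverse_eq_divide divide_le_eq)
qed

text \<open>
  The supremum that defines \<open>\<Delta>\<close> need not be attained, since \<open>\<Psi>\<close> jumps; an admissible \<open>Q\<close> above half of
  it suffices, at the price of a factor \<open>2\<close>.
\<close>

lemma almost_optimal_order:
  fixes \<omega> :: "(real, 'n::{finite,linorder}) vec"
  assumes \<omega>: "infnorm \<omega> = 1" "\<And>j. j \<in> slow d \<Longrightarrow> \<omega> $ j = 0" and x: "Psi d \<omega> 1 \<le> x"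
  obtains Q where "Q \<ge> 1" "Q * Psi d \<omega> Q \<le> x" "1 / Q \<le> 2 * inverse (Delta d \<omega> x)"
proof -
  let ?S = "{Q. Q \<ge> 1 \<and> Q * Psi d \<omega> Q \<le> x}"
  have one: "1 \<in> ?S" using x by simp
  have bdd: "bdd_above ?S"
  proof (rule bdd_aboveI)
    fix Q assume Q: "Q \<in> ?S"
    then have Q': "Q \<ge> 1" "Q * Psi d \<omega> Q \<le> x" by auto
    have "Q * 1 \<le> Q * Psi d \<omega> Q" using Psi_ge_1[OF \<omega>, where Q=Q] Q' by (intro mult_left_mono) auto
    from order_trans[OF this Q'(2)] show "Q \<le> x" by simp
  qed
  have D: "Delta d \<omega> x \<ge> 1" unfolding Delta_def using cSup_upper[OF one bdd] .
  then have "Delta d \<omega> x / 2 < Sup ?S" unfolding Delta_def by linarith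
  then obtain Q where Q: "Q \<in> ?S" "Delta d \<omega> x / 2 < Q"
    using less_cSup_iff[OF _ bdd] one by (metis (no_types, lifting) empty_iff)
  have "1 / Q \<le> 1 / (Delta d \<omega> x / 2)" using Q D by (intro divide_left_mono) auto
  then show thesis using Q that by (auto simp: inverse_eq_divide)
qed

lemma norm_le_card_mult:
  fixes v :: "real ^ 'n::finite"
  assumes "\<And>j. \<bar>v $ j\<bar> \<le> B"
  shows "norm v \<le> real CARD('n) * B"
proof -
  have "norm v \<le> (\<Sum>j\<in>UNIV. \<bar>v $ j\<bar>)" by (rule norm_le_l1_cart)
  also have "\<dots> \<le> (\<Sum>j\<in>(UNIV :: 'n set). B)" by (intro sum_mono assms)
  finally show ?thesis by simp
qed

context rescaled_system
begin

lemma A_continuous: "continuous_on UNIV A"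
  using class_C_mono[OF A_C2, of 0] by simp

lemma norm_A_bounded: "\<exists>M. \<forall>\<theta>. norm (A \<theta>) \<le> M"
proof -
  have "norm (A \<theta>) \<le> real DIM(((real, 'n) vec, 'n) vec) * C1" for \<theta>
  proof -
    have "norm (A \<theta>) \<le> sqrt (real DIM(((real, 'n) vec, 'n) vec)) * infnorm (A \<theta>)" by (rule norm_le_infnorm)
    also have "\<dots> \<le> real DIM(((real, 'n) vec, 'n) vec) * C1"
    proof (rule mult_mono)
      have "(1::real) \<le> real DIM(((real, 'n) vec, 'n) vec)" using DIM_positive[where 'a="((real, 'n) vec, 'n) vec"] by linarith
      then show "sqrt (real DIM(((real, 'n) vec, 'n) vec)) \<le> real DIM(((real, 'n) vec, 'n) vec)"
        by (intro real_le_lsqrt) (auto simp: power2_eq_square)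
      show "infnorm (A \<theta>) \<le> C1" using C_norm_bound[OF A_norm, of "[]" \<theta>] by simp
    qed (auto simp: infnorm_pos_le)
    finally show ?thesis .
  qed
  then show ?thesis by blast
qed

lemma entry_average_has_derivative:
  assumes "averaging_measure d \<omega> a' b' \<rho>"
  shows "((\<lambda>s. torus_average d (\<lambda>\<theta>. A \<theta> $ a $ b) (\<theta> + s *\<^sub>R axis j 1)) has_real_derivative
     torus_average d (entry_partial A j a b) \<theta>) (at 0)"
proof (rule torus_average_has_derivative[OF assms])
  show "0 \<le> n * C1" using n_ge_1 C1_pos by simp
qed (rule matrix_entry_continuous[OF A_C2 A_norm A_periodic] matrix_entry_periodic[OF A_C2 A_norm A_periodic]
    matrix_entry_bound[OF A_C2 A_norm A_periodic] entry_partial_continuous[OF A_C2 A_norm A_periodic]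
    entry_partial_periodic[OF A_C2 A_norm A_periodic] entry_partial_bound[OF A_C2 A_norm A_periodic]
    entry_partial_derivative[OF A_C2 A_norm A_periodic] entry_partial_lipschitz[OF A_C2 A_norm A_periodic, folded n_def])+

lemma average_entry_partial_fast:
  assumes "averaging_measure d \<omega> a' b' \<rho>" "j \<in> fast d"
  shows "torus_average d (entry_partial A j a b) \<theta> = 0"
  by (rule torus_average_fast_derivative_eq_0[OF entry_average_has_derivative[OF assms(1)] assms(2)])

lemma average_entry_partial_eq:
  assumes \<rho>: "averaging_measure d \<omega> a' b' \<rho>"
    and D: "((\<lambda>s. torus_average d A (\<theta> + s *\<^sub>R axis i 1)) has_vector_derivative Astar) (at 0)"
  shows "torus_average d (entry_partial A i a b) \<theta> = Astar $ a $ b"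
proof -
  obtain M where M: "\<And>\<theta>. norm (A \<theta>) \<le> M" using norm_A_bounded by blast
  have "((\<lambda>s. torus_average d A (\<theta> + s *\<^sub>R axis i 1) $ a $ b) has_vector_derivative Astar $ a $ b) (at 0)"
    by (rule bounded_linear.has_vector_derivative[OF bounded_linear_matrix_entry D])
  then have "((\<lambda>s. torus_average d (\<lambda>\<theta>. A \<theta> $ a $ b) (\<theta> + s *\<^sub>R axis i 1)) has_real_derivative Astar $ a $ b) (at 0)"
    by (simp add: torus_average_component[OF A_continuous M] has_real_derivative_iff_has_vector_derivative)
  from DERIV_unique[OF entry_average_has_derivative[OF \<rho>] this] show ?thesis .
qed

lemma fast_drift_bound:
  assumes z: "slow_motion (\<delta> / \<epsilon>) z" and \<delta>: "\<delta> > 0"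
    and \<rho>: "averaging_measure d \<omega> (c / Q) (c * T) \<rho>" and c: "c > 0" and Q: "Q \<ge> 1" and T: "T > 0"
    and small: "\<epsilon> * T \<le> 1 / Q" "\<epsilon> \<le> 1 / Q" and j: "j \<in> fast d"
  shows "\<bar>snd (z (\<delta> / \<epsilon>)) $ j - snd (z 0) $ j\<bar> \<le> \<epsilon> / Q * (n\<^sup>2 * averaging_constant c \<delta> + \<delta> * C2)"
  using action_drift(1)[OF z \<delta> \<rho> c Q T small, of j]
  by (simp add: average_entry_partial_fast[OF \<rho> j])

text \<open>
  During the time \<open>\<delta>/\<epsilon>\<close> the actions change by at most \<open>\<epsilon> \<delta> speed\<close> and the slow angles by at most
  \<open>\<delta> speed\<close>. Hence the averaged force may be evaluated at the initial point, with a relative error of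
  order \<open>\<delta>\<close>; this is the last term of the bound.
\<close>

lemma slow_drift_bound:
  assumes z: "slow_motion (\<delta> / \<epsilon>) z" "z 0 = (\<theta>0, \<epsilon> *\<^sub>R I0)" and \<delta>: "\<delta> > 0" "\<delta> * speed \<le> 1"
    and \<rho>: "averaging_measure d \<omega> (c / Q) (c * T) \<rho>" and c: "c > 0" and Q: "Q \<ge> 1" and T: "T > 0"
    and small: "\<epsilon> * T \<le> 1 / Q" "\<epsilon> \<le> 1 / Q" and I0: "infnorm I0 = 1"
    and D: "((\<lambda>s. torus_average d A (\<theta>0 + s *\<^sub>R axis i 1)) has_vector_derivative Astar) (at 0)"
  shows "\<bar>snd (z (\<delta> / \<epsilon>)) $ i - snd (z 0) $ i + \<epsilon> * \<delta> * ((Astar *v I0) \<bullet> I0)\<bar>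
    \<le> \<epsilon> / Q * (n\<^sup>2 * averaging_constant c \<delta> + \<delta> * C2) + \<epsilon> * \<delta>\<^sup>2 * (n\<^sup>2 * C1 * speed * (4 * n\<^sup>2 + 3))"
proof -
  let ?\<tau> = "\<delta> / \<epsilon>"
  have \<tau>: "?\<tau> \<ge> 0" using \<delta> \<epsilon>_pos by simp
  let ?v = "\<lambda>a b t. snd (z t) $ a * snd (z t) $ b * torus_average d (entry_partial A i a b) (fst (z t))"
  define w where "w a b = \<epsilon>\<^sup>2 * (Astar $ a $ b * (I0 $ a * I0 $ b))" for a b
  define e where "e = \<epsilon>\<^sup>2 * \<delta> * (C1 * speed * (4 * n\<^sup>2 + 3))"
  note avg_bd = torus_average_bound[OF entry_partial_continuous[OF A_C2 A_norm A_periodic] entry_partial_bound[OF A_C2 A_norm A_periodic], of d i]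
  note avg_lip = torus_average_lipschitz_slow[OF entry_partial_continuous[OF A_C2 A_norm A_periodic]
      entry_partial_bound[OF A_C2 A_norm A_periodic] entry_partial_lipschitz[OF A_C2 A_norm A_periodic], folded n_def, of d i]
  note avg_eq = average_entry_partial_eq[OF \<rho> D]
  have pointwise: "\<bar>?v a b t - w a b\<bar> \<le> e" if t: "t \<in> {0..?\<tau>}" for a b t
  proof -
    have t\<epsilon>: "\<epsilon> * t \<le> \<delta>" using t \<epsilon>_pos by (simp add: field_simps)
    have z0: "0 \<in> {0..?\<tau>}" using \<tau> by simp
    have dI: "\<bar>snd (z t) $ j - \<epsilon> * I0 $ j\<bar> \<le> \<epsilon> * (\<delta> * speed)" for j
    proof -
      have "\<bar>snd (z t) $ j - \<epsilon> * I0 $ j\<bar> \<le> \<epsilon>\<^sup>2 * speed * \<bar>t - 0\<bar>"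
        using z t z0 unfolding slow_motion_def by force
      also have "\<dots> = \<epsilon> * speed * (\<epsilon> * t)" using t by (simp add: power2_eq_square)
      also have "\<dots> \<le> \<epsilon> * speed * \<delta>" using t\<epsilon> \<epsilon>_pos speed_ge_1 by (intro mult_left_mono) auto
      finally show ?thesis by (simp add: mult_ac)
    qed
    have Ib: "\<bar>snd (z t) $ j\<bar> \<le> 2 * \<epsilon>" for j using z t by (simp add: slow_motion_def)
    have I0b: "\<bar>\<epsilon> * I0 $ j\<bar> \<le> \<epsilon>" for j
    proof -
      have "\<bar>\<epsilon> * I0 $ j\<bar> \<le> \<epsilon> * 1" unfolding abs_mult using component_le_infnorm_cart[of I0 j] I0 \<epsilon>_pos
        by (intro mult_mono) auto
      then show ?thesis by simp
    qed
    have slow_part: "norm (\<chi> j. if j \<in> fast d then 0 else fst (z t) $ j - \<theta>0 $ j) \<le> n * (\<delta> * speed)"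
      unfolding n_def
    proof (rule norm_le_card_mult)
      fix j
      show "\<bar>(\<chi> j. if j \<in> fast d then 0 else fst (z t) $ j - \<theta>0 $ j) $ j\<bar> \<le> \<delta> * speed"
      proof (cases "j \<in> fast d")
        case False
        then have "\<omega> $ j = 0" using \<omega>_slow by (simp add: fast_eq_Compl_slow)
        have "\<bar>(fst (z t) $ j - fst (z 0) $ j) - (t - 0) * \<omega> $ j\<bar> \<le> \<epsilon> * speed * \<bar>t - 0\<bar>"
          using z(1) t z0 unfolding slow_motion_def by blast
        also have "\<dots> = speed * (\<epsilon> * t)" using t by simp
        also have "\<dots> \<le> speed * \<delta>" using t\<epsilon> speed_ge_1 by (intro mult_left_mono) auto
        finally show ?thesis using False z(2) \<open>\<omega> $ j = 0\<close> by (simp add: mult.commute)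
      qed (use \<delta> speed_ge_1 in simp)
    qed
    \<comment> \<open>The angles are moved to their initial value first, then the actions.\<close>
    let ?g = "torus_average d (entry_partial A i a b) (fst (z t))"
    have "\<bar>?g - Astar $ a $ b\<bar> \<le> n * C1 * (n * (\<delta> * speed))"
    proof -
      have "\<bar>?g - Astar $ a $ b\<bar> \<le> n * C1 * norm (\<chi> j. if j \<in> fast d then 0 else fst (z t) $ j - \<theta>0 $ j)"
        using avg_lip[of a b "fst (z t)" \<theta>0] by (simp add: avg_eq)
      also have "\<dots> \<le> n * C1 * (n * (\<delta> * speed))"
        using slow_part n_ge_1 C1_pos by (intro mult_left_mono) auto
      finally show ?thesis .
    qed
    moreover have "\<bar>snd (z t) $ a * snd (z t) $ b\<bar> \<le> 4 * \<epsilon>\<^sup>2" by (rule action_product_bound[OF Ib])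
    ultimately have 1: "\<bar>snd (z t) $ a * snd (z t) $ b * (?g - Astar $ a $ b)\<bar> \<le> 4 * \<epsilon>\<^sup>2 * (n * C1 * (n * (\<delta> * speed)))"
      unfolding abs_mult[of "_ * _"] by (intro mult_mono) auto
    have "snd (z t) $ a * snd (z t) $ b - (\<epsilon> * I0 $ a) * (\<epsilon> * I0 $ b) =
        (snd (z t) $ a - \<epsilon> * I0 $ a) * snd (z t) $ b + (\<epsilon> * I0 $ a) * (snd (z t) $ b - \<epsilon> * I0 $ b)"
      by (simp add: algebra_simps)
    also have "\<bar>\<dots>\<bar> \<le> \<epsilon> * (\<delta> * speed) * (2 * \<epsilon>) + \<epsilon> * (\<epsilon> * (\<delta> * speed))"
      by (rule order_trans[OF abs_triangle_ineq], rule add_mono; subst abs_mult; rule mult_mono)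
         (use dI Ib I0b \<epsilon>_pos \<delta> speed_ge_1 in auto)
    finally have "\<bar>snd (z t) $ a * snd (z t) $ b - (\<epsilon> * I0 $ a) * (\<epsilon> * I0 $ b)\<bar> \<le> 3 * \<epsilon>\<^sup>2 * (\<delta> * speed)"
      by (simp add: power2_eq_square algebra_simps)
    moreover have "\<bar>Astar $ a $ b\<bar> \<le> C1" using avg_bd[of a b \<theta>0] by (simp add: avg_eq)
    ultimately have 2: "\<bar>Astar $ a $ b * (snd (z t) $ a * snd (z t) $ b - (\<epsilon> * I0 $ a) * (\<epsilon> * I0 $ b))\<bar> \<le> C1 * (3 * \<epsilon>\<^sup>2 * (\<delta> * speed))"
      unfolding abs_mult[of "Astar $ a $ b"] using C1_pos by (intro mult_mono) auto
    have "?v a b t - w a b = snd (z t) $ a * snd (z t) $ b * (?g - Astar $ a $ b) +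
        Astar $ a $ b * (snd (z t) $ a * snd (z t) $ b - (\<epsilon> * I0 $ a) * (\<epsilon> * I0 $ b))"
      by (simp add: w_def power2_eq_square algebra_simps)
    also have "\<bar>\<dots>\<bar> \<le> 4 * \<epsilon>\<^sup>2 * (n * C1 * (n * (\<delta> * speed))) + C1 * (3 * \<epsilon>\<^sup>2 * (\<delta> * speed))"
      by (rule order_trans[OF abs_triangle_ineq add_mono[OF 1 2]])
    also have "\<dots> = e" by (simp add: e_def power2_eq_square algebra_simps)
    finally show ?thesis .
  qed
  have integrated: "\<bar>integral {0..?\<tau>} (?v a b) - w a b * ?\<tau>\<bar> \<le> e * ?\<tau>" for a b
  proof -
    have "((\<lambda>t. w a b) has_integral w a b * ?\<tau>) {0..?\<tau>}"
      using has_integral_const_real[of "w a b" 0 ?\<tau>] \<tau> by (simp add: mult.commute)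
    then have "((\<lambda>t. ?v a b t - w a b) has_integral (integral {0..?\<tau>} (?v a b) - w a b * ?\<tau>)) {0..?\<tau>}"
      by (rule has_integral_diff[OF integrable_integral[OF
            action_drift(2)[OF z(1) \<delta>(1) \<rho> c Q T small, where j=i and a=a and b=b]]])
    moreover have "e \<ge> 0" using \<epsilon>_pos \<delta> C1_pos speed_ge_1 by (simp add: e_def)
    ultimately have "norm (integral {0..?\<tau>} (?v a b) - w a b * ?\<tau>) \<le> e * measure lborel {0..?\<tau>}"
      using pointwise by (intro has_integral_bound_real[OF _ finite.emptyI]) auto
    then show ?thesis using \<tau> by simp
  qed
  have "\<bar>\<Sum>a\<in>UNIV. \<Sum>b\<in>UNIV. integral {0..?\<tau>} (?v a b) - w a b * ?\<tau>\<bar> \<le> n\<^sup>2 * (e * ?\<tau>)"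
    by (rule abs_double_sum_le) (rule integrated)
  moreover have "(\<Sum>a\<in>UNIV. \<Sum>b\<in>UNIV. w a b * ?\<tau>) = \<epsilon> * \<delta> * ((Astar *v I0) \<bullet> I0)"
    using \<epsilon>_pos unfolding inner_matrix_vector_mult w_def sum_distrib_left
    by (intro sum.cong refl) (simp add: power2_eq_square)
  moreover have "n\<^sup>2 * (e * ?\<tau>) = \<epsilon> * \<delta>\<^sup>2 * (n\<^sup>2 * C1 * speed * (4 * n\<^sup>2 + 3))"
    using \<epsilon>_pos by (simp add: e_def power2_eq_square)
  ultimately have "\<bar>(\<Sum>a\<in>UNIV. \<Sum>b\<in>UNIV. integral {0..?\<tau>} (?v a b)) - \<epsilon> * \<delta> * ((Astar *v I0) \<bullet> I0)\<bar>
      \<le> \<epsilon> * \<delta>\<^sup>2 * (n\<^sup>2 * C1 * speed * (4 * n\<^sup>2 + 3))"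
    by (simp add: sum_subtractf)
  with action_drift(1)[OF z(1) \<delta>(1) \<rho> c Q T small, of i] show ?thesis by linarith
qed

end

section \<open>Drift in the slow directions\<close>

theorem theorem1:
  assumes "CARD('n::{finite,linorder}) \<ge> 2"
  shows "\<exists>\<kappa>>0. \<forall>C1>0. \<forall>(Astar :: ((real, 'n) vec, 'n) vec) (I0 :: (real, 'n) vec).
    Astar \<noteq> 0 \<and> I0 \<notin> {v. (Astar *v v) \<bullet> v = 0} \<and> infnorm I0 = 1 \<longrightarrow>
    (\<exists>c>0. \<exists>\<delta>>0. \<forall>C2>0. \<exists>\<mu>0>0. \<exists>C>0.
      \<forall>(l :: nat) (d :: nat) (\<omega> :: (real, 'n) vec) (H :: (real, 'n) vec \<times> (real, 'n) vec \<Rightarrow> real)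
        (A :: (real, 'n) vec \<Rightarrow> ((real, 'n) vec, 'n) vec) (R :: (real, 'n) vec \<times> (real, 'n) vec \<Rightarrow> real)
        (\<theta>star :: (real, 'n) vec) (i :: 'n) (\<epsilon> :: real).
        3 \<le> l \<and> 1 \<le> d \<and> d \<le> CARD('n) - 1 \<and>
        (\<forall>j\<in>slow d. \<omega> $ j = 0) \<and> nonresonant d \<omega> \<and> infnorm \<omega> = 1 \<and>
        class_C l H \<and> (\<forall>I. torus_periodic (\<lambda>\<theta>. H (\<theta>, I))) \<and>
        class_C l A \<and> torus_periodic A \<and> (\<forall>\<theta>. transpose (A \<theta>) = A \<theta>) \<and>
        (\<forall>\<theta> I. H (\<theta>, I) = \<omega> \<bullet> I + (A \<theta> *v I) \<bullet> I + R (\<theta>, I)) \<and>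
        (\<forall>\<theta>. (\<lambda>I. R (\<theta>, I)) \<in> O[at 0](\<lambda>I. norm I ^ 3)) \<and>
        i \<in> slow d \<and>
        ((\<lambda>s. torus_average d A (\<theta>star + s *\<^sub>R axis i 1)) has_vector_derivative Astar) (at 0) \<and>
        \<epsilon> > 0 \<and> \<kappa> / \<epsilon> \<ge> Psi d \<omega> 1 \<and>
        C_norm l UNIV A \<le> ereal C1 \<and>
        C_norm l (UNIV \<times> {I. infnorm I < 3}) (\<lambda>(\<theta>, J). R (\<theta>, \<epsilon> *\<^sub>R J) / \<epsilon> ^ 3) \<le> ereal C2 \<and>
        0 < mu \<kappa> d \<omega> \<epsilon> \<and> mu \<kappa> d \<omega> \<epsilon> \<le> \<mu>0
        \<longrightarrow>
        (\<exists>\<theta> I. let \<tau> = \<delta> / \<epsilon> in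
          hamiltonian_solution H {0..\<tau>} \<theta> I \<and>
          I 0 = \<epsilon> *\<^sub>R I0 \<and>
          infnorm (I \<tau> - I 0) \<ge> \<bar>I \<tau> $ i - I 0 $ i\<bar> \<and>
          \<bar>I \<tau> $ i - I 0 $ i\<bar> \<ge> c * \<epsilon> \<and>
          (MAX j\<in>fast d. \<bar>I \<tau> $ j - I 0 $ j\<bar>) \<le> C * \<epsilon> * mu \<kappa> d \<omega> \<epsilon>))"
proof -
  obtain K :: real where K: "K > 0" and
    averaging: "\<And>d (\<omega> :: (real, 'n) vec) Q T. \<lbrakk>Q \<ge> 1; T > 0; \<And>j. j \<in> slow d \<Longrightarrow> \<omega> $ j = 0;
      \<And>k :: 'n \<Rightarrow> int. \<lbrakk>\<exists>j\<in>fast d. k j \<noteq> 0; of_int (\<Sum>j\<in>fast d. \<bar>k j\<bar>) \<le> Q\<rbrakk> \<Longrightarrow>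
         1 \<le> T * \<bar>\<Sum>j\<in>fast d. of_int (k j) * \<omega> $ j\<bar>\<rbrakk>
     \<Longrightarrow> \<exists>\<rho>. averaging_measure d \<omega> (K / Q) (K * T) \<rho>"
    by (rule averaging_measure_exists) blast
  define n where "n = real CARD('n)"
  have n: "n \<ge> 1" by (simp add: n_def Suc_leI)
  show ?thesis
  proof (rule exI[of _ "1::real"], rule conjI[OF zero_less_one], intro allI impI, elim conjE, goal_cases)
    case (1 C1 Astar I0)
    then have C1: "0 < C1" and nondeg: "I0 \<notin> {v. (Astar *v v) \<bullet> v = 0}" and I0: "infnorm I0 = 1"
      by simp_all
    define \<alpha> where "\<alpha> = (Astar *v I0) \<bullet> I0"
    have \<alpha>: "\<bar>\<alpha>\<bar> > 0" using nondeg by (simp add: \<alpha>_def)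
    define speed where "speed = 4 * n\<^sup>2 * C1 + 1"
    have speed: "speed > 0" using C1 by (simp add: speed_def add_nonneg_pos)
    define D where "D = n\<^sup>2 * C1 * speed * (4 * n\<^sup>2 + 3)"
    have D: "D > 0" unfolding D_def using n C1 speed by (intro mult_pos_pos) (auto simp: add_nonneg_pos)
    \<comment> \<open>The first bound keeps the motion in the region \<open>\<bar>I\<bar> \<le> 2\<epsilon>\<close>; the second makes the error of freezing the
       averaged force at the initial point at most a quarter of the expected drift \<open>\<epsilon> \<delta> \<bar>\<alpha>\<bar>\<close>.\<close>
    define \<delta> where "\<delta> = min (1 / speed) (\<bar>\<alpha>\<bar> / (4 * D))"
    have \<delta>: "\<delta> > 0" using speed \<alpha> D by (simp add: \<delta>_def)
    have \<delta>_speed: "\<delta> * speed \<le> 1" and \<delta>_D: "\<delta> * D \<le> \<bar>\<alpha>\<bar> / 4"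
    proof -
      have "\<delta> \<le> 1 / speed" "\<delta> \<le> \<bar>\<alpha>\<bar> / (4 * D)" by (simp_all add: \<delta>_def)
      then show "\<delta> * speed \<le> 1" "\<delta> * D \<le> \<bar>\<alpha>\<bar> / 4" using speed D by (simp_all add: field_simps)
    qed
    define E where "E = K * C1 * (4 * \<delta> * n + 4 * \<delta> * n\<^sup>2 * speed + 4 * \<delta> * speed + 8)"
    have E: "E > 0" unfolding E_def using K C1 \<delta> n speed by (intro mult_pos_pos add_nonneg_pos add_nonneg_nonneg mult_nonneg_nonneg) auto
    have c: "\<delta> * \<bar>\<alpha>\<bar> / 2 > 0" using \<delta> \<alpha> by simp
    show ?case
    proof (rule exI, rule conjI[OF c], rule exI, rule conjI[OF \<delta>], intro allI impI, goal_cases)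
      case (1 C2)
      then have C2: "C2 > 0" .
      define W where "W = n\<^sup>2 * E + \<delta> * C2"
      have W: "W > 0" unfolding W_def using n E \<delta> C2 by (intro add_pos_pos mult_pos_pos) auto
      \<comment> \<open>The first bound gives \<open>\<epsilon> C2 \<le> 1\<close>; the second makes the averaging error at most another quarter of
         the expected drift.\<close>
      define \<mu>0 where "\<mu>0 = min (1 / (2 * C2)) (\<delta> * \<bar>\<alpha>\<bar> / (8 * W))"
      have \<mu>0: "\<mu>0 > 0" using C2 W \<delta> \<alpha> by (simp add: \<mu>0_def)
      have \<mu>0_C2: "2 * \<mu>0 * C2 \<le> 1" and \<mu>0_W: "2 * \<mu>0 * W \<le> \<delta> * \<bar>\<alpha>\<bar> / 4"
      proof -
        have "\<mu>0 \<le> 1 / (2 * C2)" "\<mu>0 \<le> \<delta> * \<bar>\<alpha>\<bar> / (8 * W)" by (simp_all add: \<mu>0_def)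
        then show "2 * \<mu>0 * C2 \<le> 1" "2 * \<mu>0 * W \<le> \<delta> * \<bar>\<alpha>\<bar> / 4" using C2 W by (simp_all add: field_simps)
      qed
      have W2: "2 * W > 0" using W by simp
      show ?case
      proof (rule exI, rule conjI[OF \<mu>0], rule exI, rule conjI[OF W2], intro allI impI, elim conjE, goal_cases)
        case (1 l d \<omega> H A R \<theta>star i \<epsilon>)
        have l: "3 \<le> l" and d: "d \<le> CARD('n) - 1" and \<omega>0: "\<forall>j\<in>slow d. \<omega> $ j = 0"
          and nr: "nonresonant d \<omega>" and \<omega>1: "infnorm \<omega> = 1"
          and H: "class_C l H" and A: "class_C l A" "torus_periodic A"
          and Heq: "\<forall>\<theta> I. H (\<theta>, I) = \<omega> \<bullet> I + (A \<theta> *v I) \<bullet> I + R (\<theta>, I)"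
          and deriv: "((\<lambda>s. torus_average d A (\<theta>star + s *\<^sub>R axis i 1)) has_vector_derivative Astar) (at 0)"
          and \<epsilon>: "\<epsilon> > 0" and \<Psi>: "Psi d \<omega> 1 \<le> 1 / \<epsilon>"
          and An: "C_norm l UNIV A \<le> ereal C1"
          and Rn: "C_norm l (UNIV \<times> {I. infnorm I < 3}) (\<lambda>(\<theta>, J). R (\<theta>, \<epsilon> *\<^sub>R J) / \<epsilon> ^ 3) \<le> ereal C2"
          and \<mu>: "mu 1 d \<omega> \<epsilon> \<le> \<mu>0"
          by fact+
        have slow0: "\<And>j. j \<in> slow d \<Longrightarrow> \<omega> $ j = 0" using \<omega>0 by blast
        obtain Q where Q: "Q \<ge> 1" "Q * Psi d \<omega> Q \<le> 1 / \<epsilon>" "1 / Q \<le> 2 * mu 1 d \<omega> \<epsilon>"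
          unfolding mu_def using almost_optimal_order[OF \<omega>1 slow0 \<Psi>] by blast
        define T where "T = Psi d \<omega> Q"
        have T: "T \<ge> 1" unfolding T_def by (rule Psi_ge_1[OF \<omega>1 slow0 Q(1)])
        have \<epsilon>T: "\<epsilon> * T \<le> 1 / Q" using Q(1,2) \<epsilon> by (simp add: T_def field_simps)
        have "\<epsilon> * 1 \<le> \<epsilon> * T" using T \<epsilon> by (intro mult_left_mono) auto
        with \<epsilon>T have \<epsilon>Q: "\<epsilon> \<le> 1 / Q" by linarith
        have Q\<mu>0: "1 / Q \<le> 2 * \<mu>0" using Q(3) \<mu> by linarith
        have "\<epsilon> * C2 \<le> 2 * \<mu>0 * C2" using \<epsilon>Q Q\<mu>0 C2 by (intro mult_right_mono) auto
        then have \<epsilon>C2: "\<epsilon> * C2 \<le> 1" using \<mu>0_C2 by linarith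
        interpret rescaled_system d \<omega> H R A \<epsilon> C1 C2 n speed
        proof
          show "class_C (Suc (Suc 0)) H" "class_C (Suc (Suc 0)) A"
            by (rule class_C_mono[OF H], use l in linarith) (rule class_C_mono[OF A(1)], use l in linarith)
          show "C_norm (Suc (Suc 0)) UNIV A \<le> ereal C1"
            by (rule order_trans[OF C_norm_mono An]) (use l in linarith)
          show "C_norm (Suc 0) (UNIV \<times> {I. infnorm I < 3}) (\<lambda>(\<theta>, J). R (\<theta>, \<epsilon> *\<^sub>R J) / \<epsilon> ^ 3) \<le> ereal C2"
            by (rule order_trans[OF C_norm_mono Rn]) (use l in linarith)
        qed (use A Heq slow0 \<omega>1 \<epsilon> \<epsilon>C2 C1 C2 n_def speed_def in simp_all)
        have avgE: "averaging_constant K \<delta> = E" by (simp add: averaging_constant_def E_def)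
        obtain \<rho> where \<rho>: "averaging_measure d \<omega> (K / Q) (K * T) \<rho>"
          using averaging[of Q T d \<omega>] Q(1) T slow0 small_divisor_bound[OF nr, of _ Q, folded T_def] by auto
        have "\<epsilon> * (\<delta> / \<epsilon>) * speed \<le> 1" using \<epsilon> \<delta>_speed by simp
        then obtain z where z0: "z 0 = (\<theta>star, \<epsilon> *\<^sub>R I0)" and z: "slow_motion (\<delta> / \<epsilon>) z"
          using slow_motion_exists[of "\<delta> / \<epsilon>" I0 \<theta>star] I0 \<delta> \<epsilon> by auto
        let ?\<tau> = "\<delta> / \<epsilon>"
        have fast: "\<bar>snd (z ?\<tau>) $ j - snd (z 0) $ j\<bar> \<le> 2 * W * \<epsilon> * mu 1 d \<omega> \<epsilon>" if "j \<in> fast d" for j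
        proof -
          have "\<bar>snd (z ?\<tau>) $ j - snd (z 0) $ j\<bar> \<le> \<epsilon> / Q * W"
            using fast_drift_bound[OF z \<delta> \<rho> K Q(1) _ \<epsilon>T \<epsilon>Q that] T by (simp add: W_def avgE)
          also have "\<dots> = \<epsilon> * W * (1 / Q)" by simp
          also have "\<dots> \<le> \<epsilon> * W * (2 * mu 1 d \<omega> \<epsilon>)" using \<epsilon> W Q(3) by (intro mult_left_mono) auto
          finally show ?thesis by (simp add: mult_ac)
        qed
        have drift: "\<bar>snd (z ?\<tau>) $ i - snd (z 0) $ i\<bar> \<ge> \<delta> * \<bar>\<alpha>\<bar> / 2 * \<epsilon>"
        proof -
          have "\<bar>snd (z ?\<tau>) $ i - snd (z 0) $ i + \<epsilon> * \<delta> * \<alpha>\<bar> \<le> \<epsilon> / Q * W + \<epsilon> * \<delta>\<^sup>2 * D"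
            using slow_drift_bound[OF z z0 \<delta> \<delta>_speed \<rho> K Q(1) _ \<epsilon>T \<epsilon>Q I0 deriv] T
            by (simp add: W_def avgE D_def \<alpha>_def)
          moreover have "\<epsilon> / Q * W \<le> \<epsilon> * (\<delta> * \<bar>\<alpha>\<bar> / 4)"
          proof -
            have "1 / Q * W \<le> 2 * \<mu>0 * W" using Q\<mu>0 W by (intro mult_right_mono) auto
            then have "1 / Q * W \<le> \<delta> * \<bar>\<alpha>\<bar> / 4" using \<mu>0_W by linarith
            then have "\<epsilon> * (1 / Q * W) \<le> \<epsilon> * (\<delta> * \<bar>\<alpha>\<bar> / 4)" using \<epsilon> by (intro mult_left_mono) auto
            then show ?thesis by simp
          qed
          moreover have "\<epsilon> * \<delta>\<^sup>2 * D \<le> \<epsilon> * (\<delta> * \<bar>\<alpha>\<bar> / 4)"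
            using mult_left_mono[OF \<delta>_D, of "\<epsilon> * \<delta>"] \<epsilon> \<delta> by (simp add: power2_eq_square mult_ac)
          moreover have "\<bar>\<epsilon> * \<delta> * \<alpha>\<bar> = \<epsilon> * (\<delta> * \<bar>\<alpha>\<bar>)" using \<epsilon> \<delta> by (simp add: abs_mult)
          ultimately have "\<bar>snd (z ?\<tau>) $ i - snd (z 0) $ i\<bar> \<ge> \<epsilon> * (\<delta> * \<bar>\<alpha>\<bar>) - 2 * (\<epsilon> * (\<delta> * \<bar>\<alpha>\<bar> / 4))"
            by linarith
          then show ?thesis by (simp add: algebra_simps)
        qed
        have ne: "fast d \<noteq> ({} :: 'n set)" using d assms by (intro fast_nonempty) simp
        show ?case
        proof (rule exI[of _ "\<lambda>t. fst (z t)"], rule exI[of _ "\<lambda>t. snd (z t)"], unfold Let_def, intro conjI)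
          show "hamiltonian_solution H {0..?\<tau>} (\<lambda>t. fst (z t)) (\<lambda>t. snd (z t))"
            by (rule hamiltonian_solution_if_field[OF H_differentiable]) (use z in \<open>simp add: slow_motion_def\<close>)
          show "snd (z 0) = \<epsilon> *\<^sub>R I0" by (simp add: z0)
          show "\<bar>snd (z ?\<tau>) $ i - snd (z 0) $ i\<bar> \<le> infnorm (snd (z ?\<tau>) - snd (z 0))"
            using component_le_infnorm_cart[of "snd (z ?\<tau>) - snd (z 0)" i] by simp
          show "(MAX j\<in>fast d. \<bar>snd (z ?\<tau>) $ j - snd (z 0) $ j\<bar>) \<le> 2 * W * \<epsilon> * mu 1 d \<omega> \<epsilon>"
            by (rule Max.boundedI) (use ne fast in auto)
        qed (rule drift)
      qed
    qed
  qed
qed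

end
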